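(* Let $\mathcal C$ be a structurally nowhere dense class of graphs. For every $r\in\mathbb N$ and $\varepsilon>0$ there exists $c(r,\varepsilon)$ such that every $G\in\mathcal C$ admits a weak $r$-neighborhood cover with degree at most $c(r,\varepsilon)\cdot|V(G)|^{\varepsilon}$ and spread at most $34r$. In particular, $\mathcal C$ admits flip-closed sparse weak neighborhood covers.
   Context: Graphs are finite, loopless, undirected, vertex-colored (finitely many unary predicates). Transductions: given first-order formulas $\nu(x),\eta(x,y)$ (with $\eta$ symmetric irreflexive) over the graph signature plus extra unary predicates, a transduction maps $G$ to all graphs obtained by interpreting the extra predicates arbitrarily, restricting to vertices satisfying $\nu$ and taking edges defined by $\eta$; a class $\mathcal D$ is a transduction of $\mathcal C$ if some fixed transduction produces all graphs of $\mathcal D$ from graphs of $\mathcal C$. Weak coloring number: for an order $\prec$ on $V(G)$, $u$ is weakly $r$-reachable from $v$ if some path of length $\le r$ from $v$ to $u$ has $u$ as its $\prec$-minimum; $\mathrm{wcol}_r(G)$ is the minimum over orders of the maximum over $v$ of the number of vertices weakly $r$-reachable from $v$. A class is nowhere dense if for all $r,\varepsilon$ there is $c$ with $\mathrm{wcol}_r(H)\le c|V(H)|^{\varepsilon}$ for every subgraph $H$ of a graph in the class; structurally nowhere dense means a transduction of a nowhere dense class. A weak $r$-neighborhood cover with degree $d$ and spread $s$ of $G$: a family of vertex sets, each contained in $N_s[c]$ for some vertex $c$, such that each $N_r[w]$ lies in some member and each vertex lies in at most $d$ members. A flip $(A,B)$ complements adjacency between $A$ and $B$; $\mathcal C_\ell$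 is the class of graphs obtained from graphs of $\mathcal C$ by at most $\ell$ flips. $\mathcal C$ admits flip-closed sparse weak neighborhood covers if there are functions $g(r,\varepsilon,\ell)$ and $\sigma(r)\ge r$ such that every $n$-vertex graph in $\mathcal C_\ell$ has a weak $r$-neighborhood cover of degree $g(r,\varepsilon,\ell)n^{\varepsilon}$ and spread $\sigma(r)$, for all $r,\ell$ and $\varepsilon>0$. *)

theory Defs
  imports Complex_Main
begin

record 'a graph =
  verts :: "'a set"
  edges :: "'a \<Rightarrow> 'a \<Rightarrow> bool"
  colors :: "nat \<Rightarrow> 'a set"

definition wf_graph :: "('a, 'c) graph_scheme \<Rightarrow> bool" where
  "wf_graph G \<longleftrightarrow> finite (verts G)
     \<and> (\<forall>u v. edges G u v \<longrightarrow> u \<in> verts G \<and> v \<in> verts G \<and> u \<noteq> v)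
     \<and> (\<forall>u v. edges G u v \<longrightarrow> edges G v u)
     \<and> (\<forall>i. colors G i \<subseteq> verts G)"

definition graph_iso :: "'b graph \<Rightarrow> 'a graph \<Rightarrow> bool" where
  "graph_iso G H \<longleftrightarrow> (\<exists>f. bij_betw f (verts G) (verts H)
     \<and> (\<forall>u\<in>verts G. \<forall>v\<in>verts G. edges G u v \<longleftrightarrow> edges H (f u) (f v))
     \<and> (\<forall>i. \<forall>u\<in>verts G. u \<in> colors G i \<longleftrightarrow> f u \<in> colors H i))"

definition subgraph :: "'a graph \<Rightarrow> 'a graph \<Rightarrow> bool" where
  "subgraph H G \<longleftrightarrow> wf_graph H \<and> verts H \<subseteq> verts G
     \<and> (\<forall>u v. edges H u v \<longrightarrow> edges G u v)"

definition walk :: "'a graph \<Rightarrow> 'a list \<Rightarrow> bool" where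
  "walk G xs \<longleftrightarrow> xs \<noteq> [] \<and> set xs \<subseteq> verts G \<and> successively (edges G) xs"

definition ball :: "'a graph \<Rightarrow> 'a \<Rightarrow> nat \<Rightarrow> 'a set" where
  "ball G v r = {u. \<exists>xs. walk G xs \<and> hd xs = v \<and> last xs = u \<and> length xs \<le> r + 1}"

definition wreach :: "'a graph \<Rightarrow> ('a \<Rightarrow> nat) \<Rightarrow> nat \<Rightarrow> 'a \<Rightarrow> 'a set" where
  "wreach G rk r v = {u. \<exists>xs. walk G xs \<and> hd xs = v \<and> last xs = u \<and> length xs \<le> r + 1
                         \<and> (\<forall>w\<in>set xs. rk u \<le> rk w)}"

text \<open>Linear orders on V(G) are represented by bijections V(G) -> {0..<|V(G)|}.\<close>
definition wcol :: "nat \<Rightarrow> 'a graph \<Rightarrow> nat" where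
  "wcol r G = (if verts G = {} then 0 else
     Min {Max ((\<lambda>v. card (wreach G rk r v)) ` verts G) | rk.
            bij_betw rk (verts G) {0..<card (verts G)}})"

definition nowhere_dense :: "'a graph set \<Rightarrow> bool" where
  "nowhere_dense C \<longleftrightarrow> (\<forall>r. \<forall>\<epsilon>>0. \<exists>c::real. \<forall>G\<in>C. \<forall>H. subgraph H G \<longrightarrow>
       real (wcol r H) \<le> c * real (card (verts H)) powr \<epsilon>)"

text \<open>Variables are natural numbers. Col i x: x has original color i;
  XCol i x: x lies in the i-th extra (transduction) unary predicate.\<close>
datatype fo =
    Eq nat nat
  | Adj nat nat
  | Col nat nat
  | XCol nat nat
  | Neg fo
  | Conj fo fo
  | Ex nat fo

fun sat :: "'a graph \<Rightarrow> (nat \<Rightarrow> 'a set) \<Rightarrow> (nat \<Rightarrow> 'a) \<Rightarrow> fo \<Rightarrow> bool" where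
  "sat G P s (Eq x y) = (s x = s y)"
| "sat G P s (Adj x y) = edges G (s x) (s y)"
| "sat G P s (Col i x) = (s x \<in> colors G i)"
| "sat G P s (XCol i x) = (s x \<in> P i)"
| "sat G P s (Neg \<phi>) = (\<not> sat G P s \<phi>)"
| "sat G P s (Conj \<phi> \<psi>) = (sat G P s \<phi> \<and> sat G P s \<psi>)"
| "sat G P s (Ex x \<phi>) = (\<exists>a\<in>verts G. sat G P (s(x := a)) \<phi>)"

text \<open>A transduction: domain formula nu (free variable 0), edge formula eta
  (free variables 0 and 1), and a list of formulas defining the colors of the output
  (free variable 0). The edge relation is symmetrised and made irreflexive.\<close>
record transduction =
  t_nu :: fo
  t_eta :: fo
  t_col :: "fo list"

definition apply_trans :: "transduction \<Rightarrow> 'a graph \<Rightarrow> (nat \<Rightarrow> 'a set) \<Rightarrow> 'a graph" where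
  "apply_trans T G P =
     (let V = {a \<in> verts G. sat G P (\<lambda>_. a) (t_nu T)};
          e = (\<lambda>a b. sat G P (\<lambda>i. if i = 0 then a else b) (t_eta T))
      in \<lparr> verts = V,
           edges = (\<lambda>a b. a \<in> V \<and> b \<in> V \<and> a \<noteq> b \<and> e a b \<and> e b a),
           colors = (\<lambda>i. if i < length (t_col T)
                         then {a \<in> V. sat G P (\<lambda>_. a) (t_col T ! i)} else {}) \<rparr>)"

definition is_transduction_of :: "'a graph set \<Rightarrow> 'b graph set \<Rightarrow> bool" where
  "is_transduction_of D C \<longleftrightarrow>
     (\<exists>T. \<forall>H\<in>D. \<exists>G\<in>C. \<exists>P. graph_iso (apply_trans T G P) H)"

definition weak_nbhd_cover :: "'a graph \<Rightarrow> nat \<Rightarrow> real \<Rightarrow> nat \<Rightarrow> 'a set set \<Rightarrow> bool" where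
  "weak_nbhd_cover G r d s X \<longleftrightarrow>
     (\<forall>S\<in>X. \<exists>c\<in>verts G. S \<subseteq> ball G c s)
   \<and> (\<forall>w\<in>verts G. \<exists>S\<in>X. ball G w r \<subseteq> S)
   \<and> (\<forall>v\<in>verts G. real (card {S\<in>X. v \<in> S}) \<le> d)"

definition flip :: "'a graph \<Rightarrow> 'a set \<times> 'a set \<Rightarrow> 'a graph" where
  "flip G AB = G\<lparr> edges := (\<lambda>u v. u \<in> verts G \<and> v \<in> verts G \<and> u \<noteq> v \<and>
       (edges G u v \<noteq> ((u \<in> fst AB \<and> v \<in> snd AB) \<or> (u \<in> snd AB \<and> v \<in> fst AB)))) \<rparr>"

definition flip_class :: "'a graph set \<Rightarrow> nat \<Rightarrow> 'a graph set" where
  "flip_class C l = {foldl flip G fs | G fs. G \<in> C \<and> length fs \<le> l}"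

definition flip_closed_sparse_covers :: "'a graph set \<Rightarrow> bool" where
  "flip_closed_sparse_covers C \<longleftrightarrow>
     (\<exists>(g :: nat \<Rightarrow> real \<Rightarrow> nat \<Rightarrow> real) (\<sigma> :: nat \<Rightarrow> nat). (\<forall>r. \<sigma> r \<ge> r) \<and>
        (\<forall>r l. \<forall>\<epsilon>>0. \<forall>G\<in>flip_class C l. \<exists>X.
            weak_nbhd_cover G r (g r \<epsilon> l * real (card (verts G)) powr \<epsilon>) (\<sigma> r) X))"

end

theory Submission
  imports Defs "HOL-Library.Nat_Bijection"
begin

text \<open>
  It suffices to cover balls of radius r by sets of radius 2r. The relation "v lies in the r-ball of u"
  is first-order definable in the sparse graph G with finitely many colours. Order the vertices so
  that every r-ball consists of few intervals, cut the order greedily into intervals contained in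
  some ball, and let each interval generate the cluster formed by the balls around its elements;
  a vertex then lies in few clusters. By Welzl's reweighting argument such an order exists
  as soon as the number of traces of balls on any set A is at most c |A|^(1 + \<epsilon>).

  To bound the number of traces: if a bounded set T meets all short walks from u and u' to a, and
  u, u' have the same type over T, then (u, a) and (u', a) have the same type (Gaifman locality).
  If S separates many u from A, then, since no dense fan structure exists in a nowhere dense class,
  all but polynomially many of them are separated from S by one of polynomially many sets of bounded
  size, so there are at most polynomially many traces in |S|. Finally, for a weak colouring order of a
  subgraph of polynomial size, each u is separated from A by the set of vertices weakly reachable from a
  single vertex that is itself weakly reachable from A; these sets S have size |A|^\<epsilon>, and
  there are only |A|^(1 + \<epsilon>) of them.
\<close>

subsection \<open>Types of tuples\<close>

text \<open>The estimate may involve |A| only: the sparse graph G that encodes a graph H can be far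
  larger than H, so separators of size |V(G)|^\<epsilon> would be useless. A bootstrap removes
  |V(G)|. Taking S = A already gives a polynomial bound on the number of traces, with a bad exponent
  D. It bounds a subgraph in which all relevant walks can be tested, the weak colouring numbers of
  that subgraph are about |A|^\<epsilon>, and in the second round the exponent D acts only on sets S
  of that small size.

  Types replace formulas because colours can absorb membership in finitely many sets: a flipped
  graph is governed by types of the same rank over more colours, so flips need no formula of their
  own, and bounded distance in the interpreted graph only costs additional rank.\<close>

definition atoms :: "('v \<Rightarrow> 'v \<Rightarrow> bool) \<Rightarrow> ('v \<Rightarrow> nat) \<Rightarrow> 'v list \<Rightarrow> nat set" where
  "atoms E \<kappa> xs =
     {prod_encode (0, prod_encode (i, j)) | i j. i < length xs \<and> j < length xs \<and> xs ! i = xs ! j}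
   \<union> {prod_encode (1, prod_encode (i, j)) | i j. i < length xs \<and> j < length xs \<and> E (xs ! i) (xs ! j)}
   \<union> {prod_encode (2, prod_encode (i, \<kappa> (xs ! i))) | i. i < length xs}"

text \<open>The rank-q type of a tuple, coded as a number so that the types of all structures with colours
  in K lie in a single finite set.\<close>
primrec tp :: "'v set \<Rightarrow> ('v \<Rightarrow> 'v \<Rightarrow> bool) \<Rightarrow> ('v \<Rightarrow> nat) \<Rightarrow> nat \<Rightarrow> 'v list \<Rightarrow> nat" where
  "tp V E \<kappa> 0 xs = set_encode (atoms E \<kappa> xs)"
| "tp V E \<kappa> (Suc q) xs =
     prod_encode (tp V E \<kappa> q xs, set_encode ((\<lambda>c. tp V E \<kappa> q (xs @ [c])) ` V))"

lemma atoms_mem: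
  "prod_encode (0, prod_encode (i, j)) \<in> atoms E \<kappa> xs \<longleftrightarrow>
     i < length xs \<and> j < length xs \<and> xs ! i = xs ! j"
  "prod_encode (Suc 0, prod_encode (i, j)) \<in> atoms E \<kappa> xs \<longleftrightarrow>
     i < length xs \<and> j < length xs \<and> E (xs ! i) (xs ! j)"
  "prod_encode (2, prod_encode (i, l)) \<in> atoms E \<kappa> xs \<longleftrightarrow> i < length xs \<and> l = \<kappa> (xs ! i)"
  by (auto simp: atoms_def)

lemma atoms_bounded:
  assumes "\<kappa> ` set xs \<subseteq> K"
  shows "atoms E \<kappa> xs \<subseteq> prod_encode ` ({..2} \<times> prod_encode ` ({..<length xs} \<times> ({..<length xs} \<union> K)))"
proof -
  have "\<kappa> (xs ! i) \<in> K" if "i < length xs" for i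
    using assms that by auto
  then show ?thesis
    unfolding atoms_def by (fastforce simp: image_iff)
qed

lemma finite_atoms: "finite (atoms E \<kappa> xs)"
  by (rule finite_subset[OF atoms_bounded[of \<kappa> xs "\<kappa> ` set xs"]]) auto

lemma atoms_eq_iff:
  assumes "length xs = length ys"
  shows "atoms E \<kappa> xs = atoms E' \<kappa>' ys \<longleftrightarrow>
    (\<forall>i<length xs. \<forall>j<length xs. (xs ! i = xs ! j \<longleftrightarrow> ys ! i = ys ! j) \<and>
        (E (xs ! i) (xs ! j) \<longleftrightarrow> E' (ys ! i) (ys ! j))) \<and>
    (\<forall>i<length xs. \<kappa> (xs ! i) = \<kappa>' (ys ! i))" (is "?L = ?R")
proof
  assume L: ?L
  show ?R
  proof (intro conjI allI impI)
    fix i j assume ij: "i < length xs" "j < length xs"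
    show "xs ! i = xs ! j \<longleftrightarrow> ys ! i = ys ! j"
      using L ij atoms_mem(1)[of i j E \<kappa> xs] atoms_mem(1)[of i j E' \<kappa>' ys] assms by simp
    show "E (xs ! i) (xs ! j) \<longleftrightarrow> E' (ys ! i) (ys ! j)"
      using L ij atoms_mem(2)[of i j E \<kappa> xs] atoms_mem(2)[of i j E' \<kappa>' ys] assms by simp
  next
    fix i assume i: "i < length xs"
    show "\<kappa> (xs ! i) = \<kappa>' (ys ! i)"
      using L i atoms_mem(3)[of i _ E \<kappa> xs] atoms_mem(3)[of i _ E' \<kappa>' ys] assms by auto
  qed
next
  assume R: ?R
  show ?L
    unfolding atoms_def assms
    by (intro arg_cong2[of _ _ _ _ "(\<union>)"]) (use R assms in \<open>auto 0 3\<close>)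
qed

lemma tp_0_iff:
  assumes "length xs = length ys"
  shows "tp V E \<kappa> 0 xs = tp V' E' \<kappa>' 0 ys \<longleftrightarrow>
    (\<forall>i<length xs. \<forall>j<length xs. (xs ! i = xs ! j \<longleftrightarrow> ys ! i = ys ! j) \<and>
        (E (xs ! i) (xs ! j) \<longleftrightarrow> E' (ys ! i) (ys ! j))) \<and>
    (\<forall>i<length xs. \<kappa> (xs ! i) = \<kappa>' (ys ! i))"
  using atoms_eq_iff[OF assms] by (simp add: set_encode_eq finite_atoms)

text \<open>One round of the Ehrenfeucht-Fraisse game. Together with \<open>tp_0_iff\<close> this is
  the interface through which equality of types is established.\<close>

lemma tp_Suc_iff:
  assumes "finite V"
  shows "tp V E \<kappa> (Suc q) xs = tp V E \<kappa> (Suc q) ys \<longleftrightarrow>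
    tp V E \<kappa> q xs = tp V E \<kappa> q ys \<and>
    (\<forall>c\<in>V. \<exists>d\<in>V. tp V E \<kappa> q (xs @ [c]) = tp V E \<kappa> q (ys @ [d])) \<and>
    (\<forall>d\<in>V. \<exists>c\<in>V. tp V E \<kappa> q (ys @ [d]) = tp V E \<kappa> q (xs @ [c]))"
proof -
  have "A ` V = B ` V \<longleftrightarrow> (\<forall>c\<in>V. \<exists>d\<in>V. A c = B d) \<and> (\<forall>d\<in>V. \<exists>c\<in>V. B d = A c)" for A B :: "'a \<Rightarrow> nat"
    by (auto simp: set_eq_iff image_iff)
  then show ?thesis
    using assms by (simp add: set_encode_eq)
qed

lemma tp_forth:
  assumes "finite V" "tp V E \<kappa> (Suc q) xs = tp V E \<kappa> (Suc q) ys" "c \<in> V"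
  obtains d where "d \<in> V" "tp V E \<kappa> q (xs @ [c]) = tp V E \<kappa> q (ys @ [d])"
  using assms by (auto simp only: tp_Suc_iff)

lemma tp_mono:
  assumes "tp V E \<kappa> q xs = tp V E \<kappa> q ys" "q' \<le> q"
  shows "tp V E \<kappa> q' xs = tp V E \<kappa> q' ys"
  using assms(2,1) by (induction rule: inc_induct) auto

lemma tp_forth_list:
  assumes "finite V" "tp V E \<kappa> (q + length cs) xs = tp V E \<kappa> (q + length cs) ys" "set cs \<subseteq> V"
  shows "\<exists>ds. length ds = length cs \<and> set ds \<subseteq> V \<and> tp V E \<kappa> q (xs @ cs) = tp V E \<kappa> q (ys @ ds)"
  using assms(2,3)
proof (induction cs arbitrary: xs ys)
  case Nil
  then show ?case by simp
next
  case (Cons c cs)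
  obtain d where d: "d \<in> V"
    "tp V E \<kappa> (q + length cs) (xs @ [c]) = tp V E \<kappa> (q + length cs) (ys @ [d])"
    using tp_forth[OF assms(1), of E \<kappa> "q + length cs" xs ys c] Cons.prems by auto
  obtain ds where "length ds = length cs" "set ds \<subseteq> V"
    "tp V E \<kappa> q ((xs @ [c]) @ cs) = tp V E \<kappa> q ((ys @ [d]) @ ds)"
    using Cons.IH[OF d(2)] Cons.prems by auto
  then show ?case
    using d(1) by (intro exI[of _ "d # ds"]) auto
qed

text \<open>\<open>js\<close> may drop, permute or repeat positions. In the inductive step the
  position of the new element is appended to \<open>js\<close>, so that this element survives the
  projection.\<close>

lemma tp_sub:
  assumes "finite V" "length xs = length ys" "tp V E \<kappa> q xs = tp V E \<kappa> q ys"
    "set js \<subseteq> {..<length xs}"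
  shows "tp V E \<kappa> q (map ((!) xs) js) = tp V E \<kappa> q (map ((!) ys) js)"
  using assms(2-)
proof (induction q arbitrary: xs ys js)
  case 0
  have "js ! i < length xs" if "i < length js" for i
    using 0(3) that nth_mem by blast
  then show ?case
    using 0 by (subst tp_0_iff) (auto simp: tp_0_iff simp del: tp.simps)
next
  case (Suc q)
  have *: "\<exists>d\<in>V. tp V E \<kappa> q (map ((!) xs) js @ [c]) = tp V E \<kappa> q (map ((!) ys) js @ [d])"
    if eq: "length xs = length ys" "tp V E \<kappa> (Suc q) xs = tp V E \<kappa> (Suc q) ys"
      "set js \<subseteq> {..<length xs}" and c: "c \<in> V" for xs ys c
  proof -
    obtain d where d: "d \<in> V" "tp V E \<kappa> q (xs @ [c]) = tp V E \<kappa> q (ys @ [d])"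
      using tp_forth[OF assms(1) eq(2) c] by blast
    have app: "map ((!) (zs @ [e])) (js @ [length xs]) = map ((!) zs) js @ [e]"
      if "length zs = length xs" for zs :: "'a list" and e
      using eq(3) that by (auto simp: nth_append)
    have "set (js @ [length xs]) \<subseteq> {..<length (xs @ [c])}"
      using eq(3) by auto
    from Suc.IH[OF _ d(2) this] have
      "tp V E \<kappa> q (map ((!) xs) js @ [c]) = tp V E \<kappa> q (map ((!) ys) js @ [d])"
      using app[of xs c] app[of ys d] eq(1) by (simp only: length_append_singleton)
    then show ?thesis
      using d(1) by blast
  qed
  have "tp V E \<kappa> q xs = tp V E \<kappa> q ys"
    using Suc.prems by simp
  then have "tp V E \<kappa> q (map ((!) xs) js) = tp V E \<kappa> q (map ((!) ys) js)"
    using Suc.IH Suc.prems by blast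
  then show ?case
    unfolding tp_Suc_iff[OF assms(1)] using *[of xs ys] *[of ys xs] Suc.prems by auto
qed

text \<open>Depends only on colours, rank and length of the tuple; this makes the number of types
  bounded uniformly over a whole class of graphs.\<close>

primrec tp_range :: "nat set \<Rightarrow> nat \<Rightarrow> nat \<Rightarrow> nat set" where
  "tp_range K 0 n = set_encode `
     Pow (prod_encode ` ({..2} \<times> prod_encode ` ({..<n} \<times> ({..<n} \<union> K))))"
| "tp_range K (Suc q) n = prod_encode ` (tp_range K q n \<times> set_encode ` Pow (tp_range K q (Suc n)))"

lemma finite_tp_range: "finite K \<Longrightarrow> finite (tp_range K q n)"
  by (induction q arbitrary: n) auto

lemma tp_in_range:
  assumes "\<kappa> ` V \<subseteq> K" "set xs \<subseteq> V"
  shows "tp V E \<kappa> q xs \<in> tp_range K q (length xs)"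
  using assms(2)
proof (induction q arbitrary: xs)
  case 0
  then show ?case
    using atoms_bounded[of \<kappa> xs K E] assms(1) by auto
next
  case (Suc q)
  have "tp V E \<kappa> q (xs @ [c]) \<in> tp_range K q (Suc (length xs))" if "c \<in> V" for c
    using Suc.IH[of "xs @ [c]"] Suc.prems that by auto
  then show ?case
    using Suc.IH[OF Suc.prems] by auto
qed

section \<open>Bounded distance and the rank that detects it\<close>

primrec nb :: "'v set \<Rightarrow> ('v \<Rightarrow> 'v \<Rightarrow> bool) \<Rightarrow> nat \<Rightarrow> 'v \<Rightarrow> 'v \<Rightarrow> bool" where
  "nb V E 0 x y \<longleftrightarrow> x = y"
| "nb V E (Suc n) x y \<longleftrightarrow> nb V E n x y \<or> (\<exists>z\<in>V. nb V E n x z \<and> E z y)"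

lemma nb_refl: "nb V E n x x"
  by (induction n) auto

lemma nb_mono: "nb V E n x y \<Longrightarrow> n \<le> n' \<Longrightarrow> nb V E n' x y"
  by (induction n' rule: nat_induct) (auto simp: le_Suc_eq)

lemma nb_trans: "nb V E n x y \<Longrightarrow> nb V E n' y z \<Longrightarrow> nb V E (n + n') x z"
  by (induction n' arbitrary: z) auto

lemma nb_sym:
  assumes "\<And>x y. E x y \<Longrightarrow> E y x" "x \<in> V" "y \<in> V" "nb V E n x y"
  shows "nb V E n y x"
  using assms(3,4)
proof (induction n arbitrary: y)
  case (Suc n)
  show ?case
  proof (cases "nb V E n x y")
    case False
    then obtain z where z: "z \<in> V" "nb V E n x z" "E z y"
      using Suc.prems by auto
    then have "nb V E (Suc 0) y z"
      using assms(1) Suc.prems(1) by auto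
    then show ?thesis
      using nb_trans[of V E "Suc 0" y z n x] Suc.IH[of z] z by simp
  qed (use Suc in auto)
qed auto

text \<open>Each step of a path costs one round: the vertex before the end is copied, and the rest
  of the path is seen by the remaining rank.\<close>

lemma tp_nb:
  assumes "finite V" "length xs = length ys" "tp V E \<kappa> n xs = tp V E \<kappa> n ys"
    "i < length xs" "j < length xs"
  shows "nb V E n (xs ! i) (xs ! j) \<longleftrightarrow> nb V E n (ys ! i) (ys ! j)"
  using assms(2-)
proof (induction n arbitrary: xs ys j)
  case 0
  then show ?case by (simp add: tp_0_iff del: tp.simps)
next
  case (Suc n)
  have *: "nb V E (Suc n) (ys ! i) (ys ! j)"
    if eq: "length xs = length ys" "tp V E \<kappa> (Suc n) xs = tp V E \<kappa> (Suc n) ys"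
      "i < length xs" "j < length xs" and nb: "nb V E (Suc n) (xs ! i) (xs ! j)" for xs ys
  proof (cases "nb V E n (xs ! i) (xs ! j)")
    case True
    then show ?thesis
      using Suc.IH[of xs ys j] eq by auto
  next
    case False
    then obtain z where z: "z \<in> V" "nb V E n (xs ! i) z" "E z (xs ! j)"
      using nb by auto
    obtain d where d: "d \<in> V" "tp V E \<kappa> n (xs @ [z]) = tp V E \<kappa> n (ys @ [d])"
      using tp_forth[OF assms(1) eq(2) z(1)] by blast
    have "nb V E n (ys ! i) d"
      using Suc.IH[of "xs @ [z]" "ys @ [d]" "length xs"] z d eq by (simp add: nth_append)
    moreover have "E d (ys ! j)"
    proof -
      have "tp V E \<kappa> 0 (xs @ [z]) = tp V E \<kappa> 0 (ys @ [d])"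
        using tp_mono[OF d(2)] by blast
      then have "E ((xs @ [z]) ! length xs) ((xs @ [z]) ! j) \<longleftrightarrow> E ((ys @ [d]) ! length xs) ((ys @ [d]) ! j)"
        using eq by (subst (asm) tp_0_iff) auto
      then show ?thesis
        using eq z by (simp add: nth_append)
    qed
    ultimately show ?thesis
      using d(1) by auto
  qed
  show ?case
    using *[of xs ys] *[of ys xs] Suc.prems by (intro iffI) simp_all
qed

subsection \<open>Locality of types\<close>

text \<open>The rank that the groups need for q further rounds if they never contain more than
  \<open>P\<close> elements in total. With D = 5^q, a round spends up to \<open>P\<close> moves on
  copying a scattered set or one move on the new point, must still see distances up to 3 D, and
  leaves \<open>loc_rank P q\<close>. Radii grow by the factor 5 because chains of 4 D steps between
  different groups have to be excluded.\<close>

primrec loc_rank :: "nat \<Rightarrow> nat \<Rightarrow> nat" where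
  "loc_rank P 0 = 0"
| "loc_rank P (Suc q) = loc_rank P q + P + 3 * 5 ^ q + 1"

declare tp.simps [simp del]

locale sym_structure =
  fixes V :: "'v set" and E :: "'v \<Rightarrow> 'v \<Rightarrow> bool" and \<kappa> :: "'v \<Rightarrow> nat"
  assumes fin: "finite V" and sym: "\<And>x y. E x y \<Longrightarrow> E y x"
begin

abbreviation "ty \<equiv> tp V E \<kappa>"
abbreviation "near \<equiv> nb V E"

text \<open>The tuples zs and zs' consist of corresponding elements of the groups X i and Y i; corresponding
  groups have the same type, and distinct groups are far apart.\<close>
definition matched :: "nat \<Rightarrow> nat \<Rightarrow> nat \<Rightarrow> (nat \<Rightarrow> 'v list) \<Rightarrow> (nat \<Rightarrow> 'v list) \<Rightarrow>
    'v list \<Rightarrow> 'v list \<Rightarrow> bool" where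
  "matched P q g X Y zs zs' \<longleftrightarrow>
     (\<forall>i<g. set (X i) \<subseteq> V \<and> set (Y i) \<subseteq> V \<and> length (X i) = length (Y i) \<and>
        ty (loc_rank P q) (X i) = ty (loc_rank P q) (Y i)) \<and>
     (\<forall>i<g. \<forall>j<g. i \<noteq> j \<longrightarrow>
        (\<forall>x\<in>set (X i). \<forall>x'\<in>set (X j). \<not> near (5 ^ q) x x') \<and>
        (\<forall>y\<in>set (Y i). \<forall>y'\<in>set (Y j). \<not> near (5 ^ q) y y')) \<and>
     (\<Sum>i<g. length (X i)) + q \<le> P \<and>
     length zs = length zs' \<and>
     (\<forall>k<length zs. \<exists>i<g. \<exists>j<length (X i). zs ! k = X i ! j \<and> zs' ! k = Y i ! j)"

lemma matchedD:
  assumes "matched P q g X Y zs zs'"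
  shows "i < g \<Longrightarrow> set (X i) \<subseteq> V" "i < g \<Longrightarrow> set (Y i) \<subseteq> V"
    "i < g \<Longrightarrow> length (X i) = length (Y i)"
    "i < g \<Longrightarrow> ty (loc_rank P q) (X i) = ty (loc_rank P q) (Y i)"
    "i < g \<Longrightarrow> j < g \<Longrightarrow> i \<noteq> j \<Longrightarrow> x \<in> set (X i) \<Longrightarrow> x' \<in> set (X j) \<Longrightarrow> n \<le> 5 ^ q \<Longrightarrow> \<not> near n x x'"
    "i < g \<Longrightarrow> j < g \<Longrightarrow> i \<noteq> j \<Longrightarrow> x \<in> set (Y i) \<Longrightarrow> x' \<in> set (Y j) \<Longrightarrow> n \<le> 5 ^ q \<Longrightarrow> \<not> near n x x'"
    "(\<Sum>i<g. length (X i)) + q \<le> P" "length zs = length zs'"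
    "k < length zs \<Longrightarrow> \<exists>i<g. \<exists>j<length (X i). zs ! k = X i ! j \<and> zs' ! k = Y i ! j"
  using assms nb_mono[of V E n x x' "5 ^ q"] unfolding matched_def by blast+

lemma matched_swap: "matched P q g X Y zs zs' \<Longrightarrow> matched P q g Y X zs' zs"
proof -
  assume m: "matched P q g X Y zs zs'"
  have "(\<Sum>i<g. length (Y i)) = (\<Sum>i<g. length (X i))"
    using m by (intro sum.cong) (auto simp: matched_def)
  then have "(\<Sum>i<g. length (Y i)) + q \<le> P"
    using m unfolding matched_def by linarith
  moreover have "\<exists>i<g. \<exists>j<length (Y i). zs' ! k = Y i ! j \<and> zs ! k = X i ! j" if "k < length zs'" for k
    using m that unfolding matched_def by metis
  ultimately show ?thesis
    using m unfolding matched_def by simp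
qed

lemma matched_less: "matched P (Suc q) g X Y zs zs' \<Longrightarrow> matched P q g X Y zs zs'"
proof -
  assume m: "matched P (Suc q) g X Y zs zs'"
  have "ty (loc_rank P q) (X i) = ty (loc_rank P q) (Y i)" if "i < g" for i
    by (intro tp_mono[OF matchedD(4)[OF m that]]) simp
  then show ?thesis
    unfolding matched_def using matchedD[OF m] by simp
qed

lemma near_sym: "x \<in> V \<Longrightarrow> y \<in> V \<Longrightarrow> near n x y \<Longrightarrow> near n y x"
  using nb_sym[of E x V y n] sym by blast

text \<open>If all elements of the type of c near Y were exhausted by a maximum scattered set, that set
  could be copied next to X; then c is close to the copy, hence to X, and c itself can be copied.\<close>
lemma matched_far_point:
  assumes m: "matched P (Suc q) g X Y zs zs'" and c: "c \<in> V"
    and far: "\<And>i x. i < g \<Longrightarrow> x \<in> set (X i) \<Longrightarrow> \<not> near (5 ^ q) x c"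
  shows "\<exists>d\<in>V. ty (loc_rank P q) [c] = ty (loc_rank P q) [d] \<and>
    (\<forall>i<g. \<forall>y\<in>set (Y i). \<not> near (5 ^ q) y d)"
proof (rule ccontr)
  let ?D = "5 ^ q :: nat"
  define L where "L = loc_rank P q"
  define \<tau> where "\<tau> z \<longleftrightarrow> z \<in> V \<and> ty L [z] = ty L [c]" for z
  define scat where "scat Z \<longleftrightarrow> (\<forall>z\<in>Z. \<forall>z'\<in>Z. z \<noteq> z' \<longrightarrow> \<not> near (2 * ?D) z z')" for Z
  assume "\<not> ?thesis"
  then have exh: "\<exists>i<g. \<exists>y\<in>set (Y i). near ?D y d" if "\<tau> d" for d
    using that unfolding \<tau>_def L_def by metis
  note XV = matchedD(1)[OF m] and YV = matchedD(2)[OF m] and len = matchedD(3)[OF m]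
    and tpXY = matchedD(4)[OF m] and farX = matchedD(5)[OF m] and farY = matchedD(6)[OF m]
  have lenP: "length (X i) \<le> P" if "i < g" for i
    using matchedD(7)[OF m] that member_le_sum[of i "{..<g}" "\<lambda>i. length (X i)"] by auto
  obtain Zm where Zm: "Zm \<subseteq> Collect \<tau>" "scat Zm"
    and max: "\<And>Z. Z \<subseteq> Collect \<tau> \<Longrightarrow> scat Z \<Longrightarrow> card Z \<le> card Zm"
  proof -
    have "finite {Z. Z \<subseteq> Collect \<tau> \<and> scat Z}"
      by (rule finite_subset[of _ "Pow V"]) (auto simp: \<tau>_def fin)
    moreover have "{} \<in> {Z. Z \<subseteq> Collect \<tau> \<and> scat Z}"
      by (auto simp: scat_def)
    ultimately have "Max (card ` {Z. Z \<subseteq> Collect \<tau> \<and> scat Z}) \<in> card ` {Z. Z \<subseteq> Collect \<tau> \<and> scat Z}"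
      and "card Z \<le> Max (card ` {Z. Z \<subseteq> Collect \<tau> \<and> scat Z})" if "Z \<subseteq> Collect \<tau>" "scat Z" for Z
      using that by (auto intro!: Max_in Max_ge)
    then show ?thesis
      using that by (smt (verit) empty_subsetI equals0D imageE mem_Collect_eq scat_def)
  qed
  have finZm: "finite Zm"
    using Zm(1) by (intro finite_subset[OF _ fin]) (auto simp: \<tau>_def)
  define Z where "Z i = {z \<in> Zm. \<exists>y\<in>set (Y i). near ?D y z}" for i
  have finZ: "finite (Z i)" for i
    using finZm by (simp add: Z_def)
  have "\<exists>Z'. Z' \<subseteq> Collect \<tau> \<and> scat Z' \<and> card Z' = card (Z i) \<and> (\<forall>z\<in>Z'. \<exists>x\<in>set (X i). near ?D x z)"
    if i: "i < g" for i
  proof -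
    obtain zl where zl: "set zl = Z i" "distinct zl"
      using finite_distinct_list[OF finZ] by blast
    have zlV: "set zl \<subseteq> V"
      using zl(1) Zm(1) by (auto simp: Z_def \<tau>_def)
    obtain f where f: "\<And>z. z \<in> Z i \<Longrightarrow> f z \<in> set (Y i) \<and> near ?D (f z) z"
      unfolding Z_def by (atomize_elim, intro choice) auto
    \<comment> \<open>Elements of a 2 D-scattered set cannot share a D-close witness in
      \<open>Y i\<close>. So \<open>Z i\<close> has at most \<open>P\<close> elements, and the spare
      rank suffices to copy all of it.\<close>
    have "inj_on f (Z i)"
    proof (rule inj_onI, rule ccontr)
      fix z z' assume z: "z \<in> Z i" "z' \<in> Z i" "f z = f z'" "z \<noteq> z'"
      have "f z \<in> V" "z \<in> V" "z' \<in> V"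
        using f z(1,2) YV[OF i] zl(1) zlV by blast+
      then have "near (?D + ?D) z z'"
        using f[OF z(1)] f[OF z(2)] z(3) near_sym[of "f z" z ?D] nb_trans[of V E ?D z "f z" ?D z']
        by auto
      then show False
        using Zm(2) z by (auto simp: scat_def Z_def mult_2)
    qed
    then have "card (Z i) \<le> card (set (Y i))"
      using f by (intro card_inj_on_le[of f]) auto
    then have "length zl \<le> P"
      using lenP[OF i] len[OF i] card_length[of "Y i"] distinct_card[OF zl(2)] zl(1) by simp
    then have "ty (L + 3 * ?D + length zl) (Y i) = ty (L + 3 * ?D + length zl) (X i)"
      by (intro tp_mono[OF tpXY[OF i, symmetric]]) (simp add: L_def)
    then obtain dl where dl: "length dl = length zl" "set dl \<subseteq> V"
      "ty (L + 3 * ?D) (Y i @ zl) = ty (L + 3 * ?D) (X i @ dl)"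
      using tp_forth_list[OF fin _ zlV] by metis
    have lens: "length (Y i @ zl) = length (X i @ dl)"
      using dl(1) len[OF i] by simp
    have t2: "ty (2 * ?D) (Y i @ zl) = ty (2 * ?D) (X i @ dl)"
      and t1: "ty ?D (Y i @ zl) = ty ?D (X i @ dl)" and tL: "ty L (Y i @ zl) = ty L (X i @ dl)"
      and t0: "ty 0 (Y i @ zl) = ty 0 (X i @ dl)"
      by (intro tp_mono[OF dl(3)]; simp)+
    have idx: "(Y i @ zl) ! (length (X i) + a) = zl ! a" "(X i @ dl) ! (length (X i) + a) = dl ! a"
      "(X i @ dl) ! (length (Y i) + a) = dl ! a" for a
      using len[OF i] by (simp_all add: nth_append)
    have eqs: "dl ! a = dl ! b \<longleftrightarrow> zl ! a = zl ! b" if "a < length zl" "b < length zl" for a b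
      using tp_nb[OF fin lens t0, of "length (X i) + a" "length (X i) + b"] that len[OF i]
      by (simp add: idx)
    have "distinct dl"
      using eqs zl(2) dl(1) by (simp add: distinct_conv_nth)
    then have "card (set dl) = card (Z i)"
      using distinct_card zl dl(1) by metis
    moreover have "scat (set dl)"
      unfolding scat_def
    proof (intro ballI impI)
      fix z z' assume "z \<in> set dl" "z' \<in> set dl" "z \<noteq> z'"
      then obtain a b where ab: "a < length zl" "b < length zl" "z = dl ! a" "z' = dl ! b"
        by (metis in_set_conv_nth dl(1))
      then have "zl ! a \<noteq> zl ! b"
        using eqs \<open>z \<noteq> z'\<close> by metis
      moreover have "zl ! a \<in> Zm" "zl ! b \<in> Zm"
        using nth_mem[OF ab(1)] nth_mem[OF ab(2)] zl(1) by (auto simp: Z_def)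
      ultimately have "\<not> near (2 * ?D) (zl ! a) (zl ! b)"
        using Zm(2) by (auto simp: scat_def)
      then show "\<not> near (2 * ?D) z z'"
        using tp_nb[OF fin lens t2, of "length (X i) + a" "length (X i) + b"] ab len[OF i]
        by (simp add: idx)
    qed
    moreover have "set dl \<subseteq> Collect \<tau>"
    proof
      fix z assume "z \<in> set dl"
      then obtain a where a: "a < length zl" "z = dl ! a"
        by (metis in_set_conv_nth dl(1))
      have "ty L [zl ! a] = ty L [dl ! a]"
        using tp_sub[OF fin lens tL, of "[length (X i) + a]"] a len[OF i] by (simp add: idx)
      moreover have "\<tau> (zl ! a)"
        using nth_mem[OF a(1)] zl(1) Zm(1) by (auto simp: Z_def)
      ultimately show "z \<in> Collect \<tau>"
        using \<open>z \<in> set dl\<close> dl(2) a(2) by (auto simp: \<tau>_def)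
    qed
    moreover have "\<exists>x\<in>set (X i). near ?D x z" if zdl: "z \<in> set dl" for z
    proof -
      obtain a where a: "a < length zl" "z = dl ! a"
        using zdl by (metis in_set_conv_nth dl(1))
      have "zl ! a \<in> Z i"
        using nth_mem[OF a(1)] zl(1) by simp
      then obtain y where "y \<in> set (Y i)" "near ?D y (zl ! a)"
        unfolding Z_def by blast
      then obtain b where b: "b < length (X i)" "near ?D (Y i ! b) (zl ! a)"
        unfolding len[OF i] by (metis in_set_conv_nth)
      then have "near ?D (X i ! b) (dl ! a)"
        using tp_nb[OF fin lens t1, of b "length (X i) + a"] a len[OF i]
        by (simp add: idx nth_append)
      then show ?thesis
        using a b(1) nth_mem by blast
    qed
    ultimately show ?thesis
      by blast
  qed
  then obtain Z' where Z': "\<And>i. i < g \<Longrightarrow> Z' i \<subseteq> Collect \<tau> \<and> scat (Z' i) \<and> card (Z' i) = card (Z i)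
      \<and> (\<forall>z\<in>Z' i. \<exists>x\<in>set (X i). near ?D x z)"
    by metis
  have finZ': "finite (Z' i)" if "i < g" for i
    using Z'[OF that] by (intro finite_subset[OF _ fin]) (auto simp: \<tau>_def)
  \<comment> \<open>A connection of length 2 D would join two groups of \<open>X\<close> by D + 2 D
    + D steps, within the excluded range 5 D.\<close>
  have sep: "\<not> near (2 * ?D) z z'" if ij: "i < g" "j < g" "i \<noteq> j" "z \<in> Z' i" "z' \<in> Z' j" for i j z z'
  proof
    assume n: "near (2 * ?D) z z'"
    obtain x x' where x: "x \<in> set (X i)" "near ?D x z" "x' \<in> set (X j)" "near ?D x' z'"
      using Z'[OF ij(1)] Z'[OF ij(2)] ij(4,5) by meson
    have "x' \<in> V" "z' \<in> V"
      using x XV[OF ij(2)] Z'[OF ij(2)] ij(5) by (auto simp: \<tau>_def)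
    then have "near (?D + (2 * ?D + ?D)) x x'"
      using nb_trans[OF x(2) nb_trans[OF n near_sym[OF _ _ x(4)]]] by blast
    then show False
      using farX[OF ij(1-3) x(1,3), of "?D + (2 * ?D + ?D)"] by auto
  qed
  define ZU where "ZU = (\<Union>i<g. Z' i)"
  have "card ZU = (\<Sum>i<g. card (Z' i))"
    unfolding ZU_def
  proof (intro card_UN_disjoint ballI impI)
    fix i j assume "i \<in> {..<g}" "j \<in> {..<g}" "i \<noteq> j"
    then show "Z' i \<inter> Z' j = {}"
      using sep[of i j] nb_refl[of V E "2 * ?D"] by fastforce
  qed (use finZ' in auto)
  moreover have "(\<Sum>i<g. card (Z' i)) = (\<Sum>i<g. card (Z i))"
    using Z' by (intro sum.cong) auto
  moreover have "card Zm \<le> (\<Sum>i<g. card (Z i))"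
  proof -
    have "Zm \<subseteq> (\<Union>i<g. Z i)"
      using exh Zm(1) unfolding Z_def by fastforce
    then have "card Zm \<le> card (\<Union>i<g. Z i)"
      using finZ by (intro card_mono) auto
    also have "\<dots> \<le> (\<Sum>i<g. card (Z i))"
      by (rule card_UN_le) simp
    finally show ?thesis .
  qed
  ultimately have cardU: "card Zm \<le> card ZU"
    by simp
  have ZU\<tau>: "ZU \<subseteq> Collect \<tau>" and scatU: "scat ZU"
  proof -
    show "ZU \<subseteq> Collect \<tau>"
      using Z' unfolding ZU_def by auto
    show "scat ZU"
      unfolding scat_def
    proof (intro ballI impI)
      fix z z' assume "z \<in> ZU" "z' \<in> ZU" "z \<noteq> z'"
      then obtain i j where "i < g" "j < g" "z \<in> Z' i" "z' \<in> Z' j"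
        by (auto simp: ZU_def)
      then show "\<not> near (2 * ?D) z z'"
        using sep[of i j z z'] Z'[of i] \<open>z \<noteq> z'\<close> unfolding scat_def by (cases "i = j") auto
    qed
  qed
  have c\<tau>: "\<tau> c"
    using c by (simp add: \<tau>_def)
  have cU: "c \<notin> ZU"
    using Z' far unfolding ZU_def by fastforce
  \<comment> \<open>The copies are together at least as large as a maximum scattered set and do not
    contain c, since they are near \<open>X\<close> and c is not. So c cannot extend them.\<close>
  have "\<not> scat (insert c ZU)"
  proof
    assume "scat (insert c ZU)"
    then have "card (insert c ZU) \<le> card Zm"
      using max ZU\<tau> c\<tau> by simp
    moreover have "finite ZU"
      using finZ' by (auto simp: ZU_def)
    ultimately show False
      using cU cardU by simp
  qed
  then obtain z where z: "z \<in> ZU" "near (2 * ?D) z c"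
    using scatU ZU\<tau> near_sym[OF c] unfolding scat_def \<tau>_def by blast
  obtain i where "i < g" "z \<in> Z' i"
    using z(1) unfolding ZU_def by blast
  then obtain x where i: "i < g" "x \<in> set (X i)" "near ?D x z"
    using Z' by meson
  then have x3: "near (3 * ?D) x c"
    using nb_trans[OF i(3) z(2)] by (simp add: mult.commute)
  \<comment> \<open>Now c is copied next to \<open>Y i\<close>. The copy d has the type of c, so it
    is within D of some \<open>Y j\<close>. For j = i this pulls back to c being near
    \<open>X i\<close>; for j \<noteq> i the groups \<open>Y i\<close> and \<open>Y j\<close> would
    be 4 D-close.\<close>
  have "ty (Suc (L + 3 * ?D)) (X i) = ty (Suc (L + 3 * ?D)) (Y i)"
    by (intro tp_mono[OF tpXY[OF i(1)]]) (simp add: L_def)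
  then obtain d where d: "d \<in> V" "ty (L + 3 * ?D) (X i @ [c]) = ty (L + 3 * ?D) (Y i @ [d])"
    using tp_forth[OF fin _ c] by metis
  have lens: "length (X i @ [c]) = length (Y i @ [d])"
    using len[OF i(1)] by simp
  have t3: "ty (3 * ?D) (X i @ [c]) = ty (3 * ?D) (Y i @ [d])"
    and t1: "ty ?D (X i @ [c]) = ty ?D (Y i @ [d])" and tL: "ty L (X i @ [c]) = ty L (Y i @ [d])"
    by (intro tp_mono[OF d(2)]; simp)+
  have "\<tau> d"
    using tp_sub[OF fin lens tL, of "[length (X i)]"] len[OF i(1)] d(1)
    by (simp add: \<tau>_def nth_append)
  then obtain j y where j: "j < g" "y \<in> set (Y j)" "near ?D y d"
    using exh by blast
  show False
  proof (cases "j = i")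
    case True
    then obtain b where b: "b < length (X i)" "y = Y i ! b"
      using j(2) len[OF i(1)] by (auto simp: in_set_conv_nth)
    then have "near ?D (X i ! b) c"
      using tp_nb[OF fin lens t1, of b "length (X i)"] j(3) len[OF i(1)] by (simp add: nth_append)
    then show False
      using far[OF i(1)] b(1) by simp
  next
    case False
    obtain b where b: "b < length (X i)" "x = X i ! b"
      using i(2) by (auto simp: in_set_conv_nth)
    then have "near (3 * ?D) (Y i ! b) d"
      using tp_nb[OF fin lens t3, of b "length (X i)"] x3 len[OF i(1)] by (simp add: nth_append)
    moreover have "near ?D d y"
      using near_sym j YV[OF j(1)] d(1) by blast
    ultimately have "near (3 * ?D + ?D) (Y i ! b) y"
      by (rule nb_trans)
    then show False
      using farY[of i j "Y i ! b" y "3 * ?D + ?D"] i(1) j False b(1) len[OF i(1)] by auto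
  qed
qed

text \<open>A point within 5^q of a group joins it and is copied by an ordinary move there; the
  other groups stay far because the old separation was 5 times larger. A point far from all groups
  opens a group of its own, with a partner from \<open>matched_far_point\<close>.\<close>

lemma matched_forth:
  assumes m: "matched P (Suc q) g X Y zs zs'" and c: "c \<in> V"
  shows "\<exists>d\<in>V. \<exists>g X Y. matched P q g X Y (zs @ [c]) (zs' @ [d])"
proof (cases "\<exists>i<g. \<exists>x\<in>set (X i). near (5 ^ q) x c")
  case True
  let ?D = "5 ^ q :: nat"
  obtain i x where i: "i < g" "x \<in> set (X i)" "near ?D x c"
    using True by blast
  have m0: "matched P q g X Y zs zs'"
    by (rule matched_less[OF m])
  note XV = matchedD(1)[OF m] and YV = matchedD(2)[OF m] and len = matchedD(3)[OF m i(1)]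
    and tpXY = matchedD(4)[OF m] and farX = matchedD(5)[OF m] and farY = matchedD(6)[OF m]
  have "ty (Suc (loc_rank P q + ?D)) (X i) = ty (Suc (loc_rank P q + ?D)) (Y i)"
    by (intro tp_mono[OF tpXY[OF i(1)]]) simp
  then obtain d where d: "d \<in> V"
    "ty (loc_rank P q + ?D) (X i @ [c]) = ty (loc_rank P q + ?D) (Y i @ [d])"
    using tp_forth[OF fin _ c] by metis
  have lens: "length (X i @ [c]) = length (Y i @ [d])"
    using len by simp
  have t1: "ty ?D (X i @ [c]) = ty ?D (Y i @ [d])"
    and tL: "ty (loc_rank P q) (X i @ [c]) = ty (loc_rank P q) (Y i @ [d])"
    by (intro tp_mono[OF d(2)]; simp)+
  obtain b where b: "b < length (X i)" "x = X i ! b"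
    using i(2) by (auto simp: in_set_conv_nth)
  have yd: "near ?D (Y i ! b) d"
    using tp_nb[OF fin lens t1, of b "length (X i)"] i(3) b len by (simp add: nth_append)
  have bY: "Y i ! b \<in> set (Y i)"
    using b(1) len by simp
  have cfar: "\<not> near ?D c x'" "\<not> near ?D x' c" if "j < g" "j \<noteq> i" "x' \<in> set (X j)" for j x'
  proof -
    show "\<not> near ?D c x'"
      using farX[of i j x x' "?D + ?D"] nb_trans[OF i(3), of ?D x'] that i by auto
    then show "\<not> near ?D x' c"
      using near_sym XV that c by blast
  qed
  have dfar: "\<not> near ?D d y'" "\<not> near ?D y' d" if "j < g" "j \<noteq> i" "y' \<in> set (Y j)" for j y'
  proof -
    show "\<not> near ?D d y'"
      using farY[of i j "Y i ! b" y' "?D + ?D"] nb_trans[OF yd, of ?D y'] that i bY by auto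
    then show "\<not> near ?D y' d"
      using near_sym YV that d(1) by blast
  qed
  have sum: "(\<Sum>j<g. length ((X(i := X i @ [c])) j)) = Suc (\<Sum>j<g. length (X j))"
  proof -
    have "(\<Sum>j<g. length ((X(i := X i @ [c])) j)) = (\<Sum>j<g. length (X j) + (if j = i then 1 else 0))"
      by (rule sum.cong) auto
    then show ?thesis
      using i(1) by (simp add: sum.distrib)
  qed
  have "matched P q g (X(i := X i @ [c])) (Y(i := Y i @ [d])) (zs @ [c]) (zs' @ [d])"
    unfolding matched_def sum
  proof (intro conjI allI impI)
    fix k assume k: "k < length (zs @ [c])"
    show "\<exists>j<g. \<exists>l<length ((X(i := X i @ [c])) j).
       (zs @ [c]) ! k = (X(i := X i @ [c])) j ! l \<and> (zs' @ [d]) ! k = (Y(i := Y i @ [d])) j ! l"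
    proof (cases "k < length zs")
      case True
      then obtain j l where jl: "j < g" "l < length (X j)" "zs ! k = X j ! l" "zs' ! k = Y j ! l"
        using matchedD(9)[OF m0] by blast
      moreover have "length zs = length zs'" "length (X j) = length (Y j)"
        using m0 jl(1) by (auto simp: matched_def)
      ultimately show ?thesis
        using True by (intro exI[of _ j] conjI exI[of _ l]) (auto simp: nth_append)
    next
      case False
      then have "k = length zs" "length zs = length zs'"
        using k m0 by (auto simp: matched_def)
      then show ?thesis
        using i(1) len by (intro exI[of _ i] conjI exI[of _ "length (X i)"]) (auto simp: nth_append)
    qed
  next
    show "Suc (\<Sum>j<g. length (X j)) + q \<le> P"
      using m by (auto simp: matched_def)
  qed (use m0 c d(1) tL cfar dfar in \<open>auto simp: matched_def split: if_splits\<close>)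
  then show ?thesis
    using d(1) by blast
next
  case False
  then obtain d where d: "d \<in> V" "ty (loc_rank P q) [c] = ty (loc_rank P q) [d]"
    "\<forall>i<g. \<forall>y\<in>set (Y i). \<not> near (5 ^ q) y d"
    using matched_far_point[OF m c] by blast
  have m0: "matched P q g X Y zs zs'"
    by (rule matched_less[OF m])
  note XV = matchedD(1)[OF m] and YV = matchedD(2)[OF m]
  have cfar: "\<not> near (5 ^ q) c x" if "i < g" "x \<in> set (X i)" for i x
    using False that near_sym c XV by blast
  have dfar: "\<not> near (5 ^ q) d y" if "i < g" "y \<in> set (Y i)" for i y
    using d that near_sym YV by blast
  have "matched P q (Suc g) (X(g := [c])) (Y(g := [d])) (zs @ [c]) (zs' @ [d])"
    unfolding matched_def
  proof (intro conjI allI impI)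
    fix k assume k: "k < length (zs @ [c])"
    show "\<exists>j<Suc g. \<exists>l<length ((X(g := [c])) j).
       (zs @ [c]) ! k = (X(g := [c])) j ! l \<and> (zs' @ [d]) ! k = (Y(g := [d])) j ! l"
    proof (cases "k < length zs")
      case True
      then obtain j l where jl: "j < g" "l < length (X j)" "zs ! k = X j ! l" "zs' ! k = Y j ! l"
        using matchedD(9)[OF m0] by blast
      moreover have "length zs = length zs'"
        using m0 by (auto simp: matched_def)
      ultimately show ?thesis
        using True by (intro exI[of _ j] conjI exI[of _ l]) (auto simp: nth_append)
    next
      case False
      then have "k = length zs" "length zs = length zs'"
        using k m0 by (auto simp: matched_def)
      then show ?thesis
        by (intro exI[of _ g]) (auto simp: nth_append)
    qed
  next
    show "(\<Sum>j<Suc g. length ((X(g := [c])) j)) + q \<le> P"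
      using m by (auto simp: matched_def)
  qed (use m0 c d False cfar dfar in \<open>auto simp: matched_def less_Suc_eq\<close>)
  then show ?thesis
    using d(1) by blast
qed

text \<open>Gaifman locality as a strategy in the back-and-forth game. When no rounds are left,
  different groups are still more than one step apart, so no equality or edge runs between them and
  the atomic types of the single groups decide everything.\<close>

lemma matched_imp_tp_eq: "matched P q g X Y zs zs' \<Longrightarrow> ty q zs = ty q zs'"
proof (induction q arbitrary: g X Y zs zs')
  case 0
  note XV = matchedD(1)[OF 0] and YV = matchedD(2)[OF 0] and len = matchedD(8)[OF 0]
    and z = matchedD(9)[OF 0]
  have grp: "length (X i) = length (Y i)" "ty 0 (X i) = ty 0 (Y i)" if "i < g" for i
    using matchedD(3,4)[OF 0 that] by auto
  show ?case
    unfolding tp_0_iff[OF len]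
  proof (intro conjI allI impI)
    fix k l assume kl: "k < length zs" "l < length zs"
    obtain i a where ia: "i < g" "a < length (X i)" "zs ! k = X i ! a" "zs' ! k = Y i ! a"
      using z[OF kl(1)] by blast
    obtain j b where jb: "j < g" "b < length (X j)" "zs ! l = X j ! b" "zs' ! l = Y j ! b"
      using z[OF kl(2)] by blast
    have mem: "X i ! a \<in> set (X i)" "X j ! b \<in> set (X j)" "Y i ! a \<in> set (Y i)" "Y j ! b \<in> set (Y j)"
      using ia jb grp by auto
    have "(zs ! k = zs ! l \<longleftrightarrow> zs' ! k = zs' ! l) \<and> (E (zs ! k) (zs ! l) \<longleftrightarrow> E (zs' ! k) (zs' ! l))"
    proof (cases "i = j")
      case True
      then show ?thesis
        using grp[OF ia(1)] ia jb unfolding tp_0_iff[OF grp(1)[OF ia(1)]] by simp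
    next
      case False
      have "\<not> near 1 (zs ! k) (zs ! l)"
        unfolding ia jb by (rule matchedD(5)[OF 0 ia(1) jb(1) False mem(1,2)]) simp
      moreover have "\<not> near 1 (zs' ! k) (zs' ! l)"
        unfolding ia jb by (rule matchedD(6)[OF 0 ia(1) jb(1) False mem(3,4)]) simp
      moreover have "zs ! k \<in> V" "zs' ! k \<in> V"
        using mem XV[OF ia(1)] YV[OF ia(1)] ia by auto
      ultimately show ?thesis
        by auto
    qed
    then show "zs ! k = zs ! l \<longleftrightarrow> zs' ! k = zs' ! l" "E (zs ! k) (zs ! l) \<longleftrightarrow> E (zs' ! k) (zs' ! l)"
      by auto
  next
    fix k assume k: "k < length zs"
    obtain i a where ia: "i < g" "a < length (X i)" "zs ! k = X i ! a" "zs' ! k = Y i ! a"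
      using z[OF k] by blast
    then show "\<kappa> (zs ! k) = \<kappa> (zs' ! k)"
      using grp[OF ia(1)] unfolding tp_0_iff[OF grp(1)[OF ia(1)]] by simp
  qed
next
  case (Suc q)
  have "\<exists>d\<in>V. ty q (zs @ [c]) = ty q (zs' @ [d])" if "c \<in> V" for c
    using matched_forth[OF Suc.prems that] Suc.IH by meson
  moreover have "\<exists>d\<in>V. ty q (zs' @ [c]) = ty q (zs @ [d])" if "c \<in> V" for c
    using matched_forth[OF matched_swap[OF Suc.prems] that] Suc.IH by meson
  moreover have "ty q zs = ty q zs'"
    using Suc.IH matched_less[OF Suc.prems] by blast
  ultimately show ?case
    by (simp only: tp_Suc_iff[OF fin]) blast
qed

text \<open>Two singleton groups and q moves to come explain the parameter q + 2; the group of a is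
  matched with itself.\<close>

lemma tp_pair_far:
  assumes "ty (loc_rank (q + 2) q) [u] = ty (loc_rank (q + 2) q) [u']"
    "u \<in> V" "u' \<in> V" "a \<in> V" "\<not> near (5 ^ q) u a" "\<not> near (5 ^ q) u' a"
  shows "ty q [u, a] = ty q [u', a]"
proof (rule matched_imp_tp_eq)
  have "\<not> near (5 ^ q) a u" "\<not> near (5 ^ q) a u'"
    using assms near_sym by blast+
  then show "matched (q + 2) q 2 ((\<lambda>_. [a])(0 := [u])) ((\<lambda>_. [a])(0 := [u'])) [u, a] [u', a]"
    using assms unfolding matched_def
    by (auto simp: less_2_cases_iff numeral_2_eq_2 less_Suc_eq)
qed

end

subsection \<open>Bounded separators in nowhere dense classes\<close>

lemma walk_append:
  "walk G (xs @ ys) \<Longrightarrow> ys \<noteq> [] \<Longrightarrow> walk G ys" "walk G (xs @ ys) \<Longrightarrow> xs \<noteq> [] \<Longrightarrow> walk G xs"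
  by (auto simp: walk_def successively_append_iff)

lemma walk_rev: "wf_graph G \<Longrightarrow> walk G xs \<Longrightarrow> walk G (rev xs)"
  by (auto simp: walk_def wf_graph_def intro: successively_mono)

lemma card_le_mult_card_image:
  assumes "finite A" "\<And>b. b \<in> f ` A \<Longrightarrow> card {a \<in> A. f a = b} \<le> n"
  shows "card A \<le> n * card (f ` A)"
proof -
  have "card A = card (\<Union>b\<in>f ` A. {a \<in> A. f a = b})"
    by (rule arg_cong[of _ _ card]) auto
  also have "\<dots> \<le> (\<Sum>b\<in>f ` A. card {a \<in> A. f a = b})"
    using assms(1) by (intro card_UN_le) auto
  also have "\<dots> \<le> n * card (f ` A)"
    using sum_bounded_above[of "f ` A" "\<lambda>b. card {a \<in> A. f a = b}" n] assms(2) by (simp add: mult.commute)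
  finally show ?thesis .
qed

section \<open>Induced subgraphs and weakly reachable sets\<close>

definition induce :: "'a graph \<Rightarrow> 'a set \<Rightarrow> 'a graph" where
  "induce G W = \<lparr>verts = W, edges = (\<lambda>u v. u \<in> W \<and> v \<in> W \<and> edges G u v), colors = (\<lambda>_. {})\<rparr>"

lemma subgraph_induce: "wf_graph G \<Longrightarrow> W \<subseteq> verts G \<Longrightarrow> subgraph (induce G W) G"
  by (auto simp: subgraph_def induce_def wf_graph_def intro: finite_subset)

lemma walk_induce: "walk (induce G W) xs \<longleftrightarrow> walk G xs \<and> set xs \<subseteq> W" if "W \<subseteq> verts G"
proof -
  have "successively (\<lambda>u v. u \<in> W \<and> v \<in> W \<and> edges G u v) xs \<longleftrightarrow> successively (edges G) xs" if "set xs \<subseteq> W"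
    using that by (intro successively_cong) auto
  then show ?thesis
    using that by (auto simp: walk_def induce_def)
qed

lemma wreach_subset: "wreach G rk r v \<subseteq> verts G"
  by (auto simp: wreach_def walk_def)

lemma finite_wreach: "finite (verts G) \<Longrightarrow> finite (wreach G rk r v)"
  using wreach_subset finite_subset by metis

lemma wcol_order:
  assumes "finite (verts G)"
  obtains rk where "inj_on rk (verts G)" "\<And>v. v \<in> verts G \<Longrightarrow> card (wreach G rk r v) \<le> wcol r G"
proof (cases "verts G = {}")
  case True
  then show ?thesis using that[of "\<lambda>_. 0"] by simp
next
  case False
  let ?M = "{Max ((\<lambda>v. card (wreach G rk r v)) ` verts G) | rk. bij_betw rk (verts G) {0..<card (verts G)}}"
  have "Max ((\<lambda>v. card (wreach G rk r v)) ` verts G) \<le> card (verts G)" for rk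
    using assms False card_mono[OF assms wreach_subset] by auto
  then have "?M \<subseteq> {..card (verts G)}"
    by auto
  then have "finite ?M"
    using finite_subset by blast
  moreover obtain rk0 where "bij_betw rk0 (verts G) {0..<card (verts G)}"
    using ex_bij_betw_finite_nat[OF assms] by blast
  then have "?M \<noteq> {}"
    by blast
  ultimately have "Min ?M \<in> ?M"
    by (rule Min_in)
  then obtain rk where rk: "bij_betw rk (verts G) {0..<card (verts G)}"
    "wcol r G = Max ((\<lambda>v. card (wreach G rk r v)) ` verts G)"
    using False by (auto simp: wcol_def)
  then have "card (wreach G rk r v) \<le> wcol r G" if "v \<in> verts G" for v
    using that assms by simp
  then show ?thesis
    using that rk(1) bij_betw_imp_inj_on by blast
qed

lemma wreach_prefix:
  assumes "walk G (xs @ p # ys)" "length xs \<le> r" "\<And>x. x \<in> set xs \<Longrightarrow> rk p \<le> rk x" "v = hd (xs @ [p])"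
  shows "p \<in> wreach G rk r v"
  unfolding wreach_def using assms walk_append(2)[of G "xs @ [p]" ys]
  by (intro CollectI exI[of _ "xs @ [p]"]) auto

text \<open>Double counting over the k * k walks of k fans with common endpoints. The rank-minimum
  of the walk from z to b is either not z, and then weakly reachable from z and different for
  different b because the fan is disjoint, or it is z, and then z is weakly reachable from b. Either
  way each centre or endpoint accounts for at most w walks, so k * k \<le> 2 * k * w.\<close>

lemma fans_imp_wcol:
  fixes f :: "'a \<Rightarrow> 'a \<Rightarrow> 'a list"
  assumes wf: "wf_graph G" and Z: "card Z = k" "card B = k" "k > 0"
    and walk: "\<And>z b. z \<in> Z \<Longrightarrow> b \<in> B \<Longrightarrow> walk G (z # f z b)"
    and last: "\<And>z b. z \<in> Z \<Longrightarrow> b \<in> B \<Longrightarrow> f z b \<noteq> [] \<and> last (f z b) = b \<and> length (f z b) \<le> R"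
    and disj: "\<And>z b b'. z \<in> Z \<Longrightarrow> b \<in> B \<Longrightarrow> b' \<in> B \<Longrightarrow> b \<noteq> b' \<Longrightarrow> set (f z b) \<inter> set (f z b') = {}"
  obtains W where "W \<subseteq> verts G" "card W \<le> k + k * k * R" "W \<noteq> {}" "k \<le> 2 * wcol R (induce G W)"
proof -
  have fin: "finite Z" "finite B"
    using Z card_gt_0_iff by metis+
  define W where "W = Z \<union> (\<Union>z\<in>Z. \<Union>b\<in>B. set (f z b))"
  have "B \<noteq> {}" "Z \<noteq> {}"
    using Z by auto
  then have WV: "W \<subseteq> verts G" "W \<noteq> {}"
    using walk by (auto simp: W_def walk_def)
  have finW: "finite W"
    using fin by (auto simp: W_def)
  have cW: "card W \<le> k + k * k * R"
  proof -
    have "card (\<Union>b\<in>B. set (f z b)) \<le> k * R" if "z \<in> Z" for z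
    proof -
      have "card (\<Union>b\<in>B. set (f z b)) \<le> (\<Sum>b\<in>B. card (set (f z b)))"
        using fin by (intro card_UN_le)
      also have "\<dots> \<le> card B * R"
      proof (rule order_trans[OF sum_bounded_above[where K = R]])
        fix b assume "b \<in> B"
        then show "card (set (f z b)) \<le> R"
          using card_length[of "f z b"] last[OF that] by fastforce
      qed simp
      finally show ?thesis using Z by simp
    qed
    then have "(\<Sum>z\<in>Z. card (\<Union>b\<in>B. set (f z b))) \<le> k * (k * R)"
      using sum_bounded_above[of Z "\<lambda>z. card (\<Union>b\<in>B. set (f z b))" "k * R"] Z by simp
    then have "card (\<Union>z\<in>Z. \<Union>b\<in>B. set (f z b)) \<le> k * (k * R)"
      using card_UN_le[OF fin(1), of "\<lambda>z. \<Union>b\<in>B. set (f z b)"] by simp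
    then show ?thesis
      using card_Un_le[of Z "\<Union>z\<in>Z. \<Union>b\<in>B. set (f z b)"] Z by (simp add: W_def mult.assoc)
  qed
  define G' where "G' = induce G W"
  have wfG': "wf_graph G'" and vG': "verts G' = W"
    using subgraph_induce[OF wf WV(1)] by (auto simp: subgraph_def G'_def induce_def)
  obtain rk where rk: "\<And>v. v \<in> W \<Longrightarrow> card (wreach G' rk R v) \<le> wcol R G'"
    using wcol_order[of G' R] finW vG' by metis
  define w where "w = wcol R G'"
  have walk': "walk G' (z # f z b)" if "z \<in> Z" "b \<in> B" for z b
    using that walk unfolding G'_def walk_induce[OF WV(1)] by (auto simp: W_def)
  have "\<exists>p\<in>set (z # f z b). \<forall>x\<in>set (z # f z b). rk p \<le> rk x" for z b
    using arg_min_if_finite[of "set (z # f z b)" rk]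
    by (metis (no_types, lifting) List.finite_set empty_iff linorder_not_less list.set_intros(1))
  then obtain p where p: "\<And>z b. p z b \<in> set (z # f z b)" "\<And>z b x. x \<in> set (z # f z b) \<Longrightarrow> rk (p z b) \<le> rk x"
    by metis
  have fw: "finite (wreach G' rk R v)" for v
    using finite_wreach finW vG' by metis
  have A: "card {b \<in> B. p z b \<noteq> z} \<le> w" if z: "z \<in> Z" for z
  proof -
    have "inj_on (p z) {b \<in> B. p z b \<noteq> z}"
    proof (rule inj_onI, rule ccontr)
      fix b b' assume "b \<in> {b \<in> B. p z b \<noteq> z}" "b' \<in> {b \<in> B. p z b \<noteq> z}" "p z b = p z b'" "b \<noteq> b'"
      then show False
        using disj[OF z, of b b'] p(1)[of z b] p(1)[of z b'] by auto
    qed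
    moreover have "p z ` {b \<in> B. p z b \<noteq> z} \<subseteq> wreach G' rk R z"
    proof (rule image_subsetI)
      fix b assume b: "b \<in> {b \<in> B. p z b \<noteq> z}"
      obtain as bs where s: "z # f z b = as @ p z b # bs"
        using p(1) split_list by metis
      show "p z b \<in> wreach G' rk R z"
      proof (rule wreach_prefix)
        show "walk G' (as @ p z b # bs)"
          using walk'[OF z, of b] b s by simp
        show "length as \<le> R"
          using arg_cong[OF s, of length] last[OF z, of b] b by simp
        show "rk (p z b) \<le> rk x" if "x \<in> set as" for x
          using p(2)[of x z b] s that by auto
        show "z = hd (as @ [p z b])"
          using arg_cong[OF s, of hd] by (cases as) auto
      qed
    qed
    ultimately have "card {b \<in> B. p z b \<noteq> z} \<le> card (wreach G' rk R z)"
      using card_inj_on_le fw by blast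
    then show ?thesis
      using rk[of z] z by (auto simp: W_def w_def)
  qed
  have A': "card {z \<in> Z. p z b = z} \<le> w" if b: "b \<in> B" for b
  proof -
    have "{z \<in> Z. p z b = z} \<subseteq> wreach G' rk R b"
    proof
      fix z assume z: "z \<in> {z \<in> Z. p z b = z}"
      show "z \<in> wreach G' rk R b"
      proof (rule wreach_prefix)
        show "walk G' (rev (f z b) @ z # [])"
          using walk_rev[OF wfG' walk'[OF _ b, of z]] z by simp
        show "length (rev (f z b)) \<le> R" "b = hd (rev (f z b) @ [z])"
          using last[OF _ b, of z] z by (auto simp: hd_append hd_rev)
        show "rk z \<le> rk x" if "x \<in> set (rev (f z b))" for x
          using p(2)[of x z b] z that by auto
      qed
    qed
    then have "card {z \<in> Z. p z b = z} \<le> card (wreach G' rk R b)"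
      using card_mono fw by blast
    moreover have "b \<in> W"
    proof -
      obtain z where "z \<in> Z" using \<open>Z \<noteq> {}\<close> by blast
      then show ?thesis
        using last[OF _ b, of z] b last_in_set[of "f z b"] by (auto simp: W_def)
    qed
    ultimately show ?thesis
      using rk[of b] by (auto simp: w_def)
  qed
  have "Z \<times> B \<subseteq> (SIGMA z:Z. {b \<in> B. p z b \<noteq> z}) \<union> prod.swap ` (SIGMA b:B. {z \<in> Z. p z b = z})"
    by (auto simp: image_iff)
  then have "card (Z \<times> B) \<le> card ((SIGMA z:Z. {b \<in> B. p z b \<noteq> z}) \<union> prod.swap ` (SIGMA b:B. {z \<in> Z. p z b = z}))"
    using fin by (intro card_mono) auto
  also have "\<dots> \<le> card (SIGMA z:Z. {b \<in> B. p z b \<noteq> z}) + card (prod.swap ` (SIGMA b:B. {z \<in> Z. p z b = z}))"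
    by (rule card_Un_le)
  also have "\<dots> \<le> card (SIGMA z:Z. {b \<in> B. p z b \<noteq> z}) + card (SIGMA b:B. {z \<in> Z. p z b = z})"
    using fin by (intro add_left_mono card_image_le) auto
  also have "\<dots> = (\<Sum>z\<in>Z. card {b \<in> B. p z b \<noteq> z}) + (\<Sum>b\<in>B. card {z \<in> Z. p z b = z})"
    using fin by simp
  also have "\<dots> \<le> k * w + k * w"
    using sum_bounded_above[of Z "\<lambda>z. card {b \<in> B. p z b \<noteq> z}" w]
      sum_bounded_above[of B "\<lambda>b. card {z \<in> Z. p z b = z}" w] A A' Z by (intro add_mono) auto
  finally have "k * k \<le> k * w + k * w"
    by (simp only: card_cartesian_product Z)
  then have "k * k \<le> k * (2 * w)"
    by (simp only: mult_2 distrib_left)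
  then have "k \<le> 2 * w"
    using Z(3) by (simp only: mult_le_cancel1)
  then show ?thesis
    using that[OF WV(1) cW WV(2)] by (simp add: w_def G'_def)
qed

text \<open>The start z is kept outside \<open>ws\<close>: the walks of a fan share z, and a hitting
  set has to meet them after the start.\<close>

definition tails :: "'a graph \<Rightarrow> 'a set \<Rightarrow> nat \<Rightarrow> 'a \<Rightarrow> 'a list set" where
  "tails G S j z = {ws. ws \<noteq> [] \<and> length ws \<le> j \<and> walk G (z # ws) \<and> last ws \<in> S}"

definition hits :: "'a set \<Rightarrow> 'a list set \<Rightarrow> bool" where
  "hits Y F \<longleftrightarrow> (\<forall>ws\<in>F. set ws \<inter> Y \<noteq> {})"

definition unhit :: "'a graph \<Rightarrow> 'a set \<Rightarrow> nat \<Rightarrow> nat \<Rightarrow> 'a set" where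
  "unhit G S h j = {z \<in> verts G - S. \<forall>Y. finite Y \<and> card Y \<le> h \<longrightarrow> \<not> hits Y (tails G S j z)}"

primrec sep_bound :: "nat \<Rightarrow> nat \<Rightarrow> nat" where
  "sep_bound h 0 = 0"
| "sep_bound h (Suc j) = h * (1 + sep_bound h j)"

text \<open>A hitting set Y of size h exists because u is not in \<open>unhit G S h j\<close>; the
  gain is that T lies in a pool that does not depend on u. An element y of Y that lies in S or in
  the next \<open>unhit\<close> set is kept. Any other y is replaced by its own separator, since the
  rest of a walk after y is a shorter tail from y. This gives the recursion of
  \<open>sep_bound\<close>.\<close>

lemma bounded_separator:
  assumes "u \<in> verts G - S - unhit G S h j"
  shows "\<exists>T. T \<subseteq> S \<union> (\<Union>i<j. unhit G S h i) \<and> finite T \<and> card T \<le> sep_bound h j \<and>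
    hits T (tails G S j u)"
  using assms
proof (induction j arbitrary: u)
  case 0
  have "tails G S 0 u = {}"
    by (auto simp: tails_def)
  then show ?case
    by (intro exI[of _ "{}"]) (auto simp: hits_def)
next
  case (Suc j)
  obtain Y where Y: "finite Y" "card Y \<le> h" "hits Y (tails G S (Suc j) u)"
    using Suc.prems by (auto simp: unhit_def)
  have "\<exists>T. T \<subseteq> S \<union> (\<Union>i<Suc j. unhit G S h i) \<and> finite T \<and> card T \<le> 1 + sep_bound h j \<and>
      (if y \<in> S \<union> unhit G S h j then y \<in> T else y \<in> verts G \<longrightarrow> hits T (tails G S j y))" for y
  proof (cases "y \<in> S \<union> unhit G S h j")
    case True
    then show ?thesis
      by (intro exI[of _ "{y}"]) auto
  next
    case nS: False
    show ?thesis
    proof (cases "y \<in> verts G")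
      case True
      then obtain T where T: "T \<subseteq> S \<union> (\<Union>i<j. unhit G S h i)" "finite T" "card T \<le> sep_bound h j"
        "hits T (tails G S j y)"
        using Suc.IH[of y] nS by auto
      have "(\<Union>i<j. unhit G S h i) \<subseteq> (\<Union>i<Suc j. unhit G S h i)"
        by (intro UN_mono) auto
      then show ?thesis
        using T nS by (intro exI[of _ T]) auto
    next
      case False
      then show ?thesis
        using nS by (intro exI[of _ "{}"]) simp
    qed
  qed
  then obtain T where T: "\<And>y. T y \<subseteq> S \<union> (\<Union>i<Suc j. unhit G S h i)" "\<And>y. finite (T y)"
    "\<And>y. card (T y) \<le> 1 + sep_bound h j"
    "\<And>y. y \<in> S \<union> unhit G S h j \<Longrightarrow> y \<in> T y"
    "\<And>y. y \<notin> S \<union> unhit G S h j \<Longrightarrow> y \<in> verts G \<Longrightarrow> hits (T y) (tails G S j y)"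
    by metis
  have "hits (\<Union>y\<in>Y. T y) (tails G S (Suc j) u)"
    unfolding hits_def
  proof
    fix ws assume ws: "ws \<in> tails G S (Suc j) u"
    then obtain y where y: "y \<in> Y" "y \<in> set ws"
      using Y(3) by (auto simp: hits_def)
    then obtain as bs where s: "ws = as @ y # bs"
      using split_list by metis
    show "set ws \<inter> (\<Union>y\<in>Y. T y) \<noteq> {}"
    proof (cases "y \<in> S \<union> unhit G S h j")
      case True
      then show ?thesis
        using T(4) y by blast
    next
      case False
      have w: "walk G (u # ws)" "last ws \<in> S" "length ws \<le> Suc j"
        using ws by (auto simp: tails_def)
      have yb: "walk G (y # bs)"
        using walk_append(1)[of G "u # as" "y # bs"] w(1) s by simp
      have "bs \<in> tails G S j y"
        using w yb False unfolding s tails_def by (auto split: if_splits)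
      moreover have "y \<in> verts G"
        using yb by (simp add: walk_def)
      ultimately have "set bs \<inter> T y \<noteq> {}"
        using T(5) False by (auto simp: hits_def)
      then show ?thesis
        using y(1) s by auto
    qed
  qed
  moreover have "card (\<Union>y\<in>Y. T y) \<le> sep_bound h (Suc j)"
  proof -
    have "card (\<Union>y\<in>Y. T y) \<le> (\<Sum>y\<in>Y. card (T y))"
      by (rule card_UN_le[OF Y(1)])
    also have "\<dots> \<le> card Y * (1 + sep_bound h j)"
      using sum_bounded_above[of Y "\<lambda>y. card (T y)" "1 + sep_bound h j"] T(3) by simp
    also have "\<dots> \<le> h * (1 + sep_bound h j)"
      using Y(2) by (rule mult_le_mono1)
    finally show ?thesis by simp
  qed
  ultimately show ?case
    using T(1,2) Y(1) by (intro exI[of _ "\<Union>y\<in>Y. T y"]) auto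
qed

text \<open>A walk may return to u and be hit only there. Cutting it at the last visit of u leaves a
  tail from u that avoids u; it is nonempty as u is not in S. A separator without u is needed
  because types over it are taken for points outside it.\<close>

lemma hits_remove_start:
  assumes "hits T (tails G S j u)" "u \<notin> S"
  shows "hits (T - {u}) (tails G S j u)"
  unfolding hits_def
proof
  fix ws assume ws: "ws \<in> tails G S j u"
  have "u \<in> set (u # ws)" by simp
  then obtain as bs where s: "u # ws = as @ u # bs" "u \<notin> set bs"
    using split_list_last by metis
  have ne: "bs \<noteq> []"
    using ws assms(2) s by (auto simp: tails_def split: if_splits dest: arg_cong[of _ _ last])
  moreover have "last bs = last ws"
    using arg_cong[OF s(1), of last] ne ws by (auto simp: tails_def)
  moreover have "walk G (u # bs)"
    using ws s(1) walk_append(1)[of G as "u # bs"] by (simp add: tails_def)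
  moreover have "length bs \<le> j"
    using arg_cong[OF s(1), of length] ws by (auto simp: tails_def)
  ultimately have "bs \<in> tails G S j u"
    using ws by (simp add: tails_def)
  then have "set bs \<inter> T \<noteq> {}"
    using assms(1) by (simp add: hits_def)
  moreover have "set bs \<subseteq> set ws"
    using s by (cases as) auto
  ultimately show "set ws \<inter> (T - {u}) \<noteq> {}"
    using s(2) by blast
qed

text \<open>Greedy choice: fewer than k chosen tails cover at most k * R vertices, which do not form
  a hitting set, so a further disjoint tail exists.\<close>

lemma unhit_fan:
  assumes "z \<in> unhit G S (k * R) j" "j \<le> R" "n \<le> k"
  shows "\<exists>F. F \<subseteq> tails G S j z \<and> finite F \<and> card F = n \<and>
    (\<forall>ws\<in>F. \<forall>ws'\<in>F. ws \<noteq> ws' \<longrightarrow> set ws \<inter> set ws' = {})"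
  using assms(3)
proof (induction n)
  case 0
  show ?case by (intro exI[of _ "{}"]) auto
next
  case (Suc n)
  then obtain F where F: "F \<subseteq> tails G S j z" "finite F" "card F = n"
    "\<forall>ws\<in>F. \<forall>ws'\<in>F. ws \<noteq> ws' \<longrightarrow> set ws \<inter> set ws' = {}"
    by auto
  have "card (\<Union>ws\<in>F. set ws) \<le> (\<Sum>ws\<in>F. card (set ws))"
    by (rule card_UN_le[OF F(2)])
  also have "\<dots> \<le> card F * R"
  proof (rule order_trans[OF sum_bounded_above[where K = R]])
    fix ws assume "ws \<in> F"
    then show "card (set ws) \<le> R"
      using card_length[of ws] F(1) assms(2) by (force simp: tails_def)
  qed simp
  also have "\<dots> \<le> k * R"
    using F(3) Suc.prems by simp
  finally have "\<not> hits (\<Union>ws\<in>F. set ws) (tails G S j z)"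
    using assms(1) F(2) by (auto simp: unhit_def)
  then obtain ws where ws: "ws \<in> tails G S j z" "set ws \<inter> (\<Union>ws\<in>F. set ws) = {}"
    by (auto simp: hits_def)
  have "ws \<noteq> []"
    using ws(1) by (simp add: tails_def)
  then have "ws \<notin> F"
    using ws(2) hd_in_set[of ws] by blast
  then show ?case
    using F ws by (intro exI[of _ "insert ws F"]) auto
qed

lemma nowhere_denseD:
  assumes "nowhere_dense C0" "\<epsilon> > 0"
  obtains c :: real where "c \<ge> 1" "\<And>G H. G \<in> C0 \<Longrightarrow> subgraph H G \<Longrightarrow>
    real (wcol r H) \<le> c * real (card (verts H)) powr \<epsilon>"
proof -
  obtain c where c: "\<forall>G\<in>C0. \<forall>H. subgraph H G \<longrightarrow> real (wcol r H) \<le> c * real (card (verts H)) powr \<epsilon>"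
    using assms unfolding nowhere_dense_def by blast
  have "real (wcol r H) \<le> max c 1 * real (card (verts H)) powr \<epsilon>" if "G \<in> C0" "subgraph H G" for G H
    using c that by (smt (verit) mult_right_mono powr_ge_zero)
  then show ?thesis
    using that[of "max c 1"] by simp
qed

text \<open>Each point of the set is the centre of a fan with k endpoints in S. There are at most
  |S|^k sets of endpoints, and by \<open>fans_imp_wcol\<close> no k centres can share one.\<close>

lemma card_unhit:
  assumes nd: "nowhere_dense C0" and wf: "\<forall>G\<in>C0. wf_graph G"
  obtains k where "k > 0" "\<And>G S j. G \<in> C0 \<Longrightarrow> finite S \<Longrightarrow> j \<le> R \<Longrightarrow>
    card (unhit G S (k * R) j) \<le> k * card S ^ k"
proof -
  obtain c where c: "c \<ge> 1" "\<And>G H. G \<in> C0 \<Longrightarrow> subgraph H G \<Longrightarrow>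
      real (wcol R H) \<le> c * real (card (verts H)) powr (1/4)"
    using nowhere_denseD[OF nd, of "1/4"] by auto
  \<comment> \<open>k fans live on at most (k * (R + 1))^2 vertices. With exponent 1/4 the weak
    colouring number there is at most c * sqrt (k * (R + 1)), while the fans force k/2; this k makes
    the two incompatible.\<close>
  obtain k where k: "real k > 4 * c\<^sup>2 * (R + 1)"
    using reals_Archimedean2 by blast
  then have k0: "k > 0"
    by (smt (verit) c(1) gr0I mult_nonneg_nonneg of_nat_0 of_nat_0_le_iff zero_le_power2)
  have nofan: "\<not> k \<le> 2 * wcol R (induce G W)"
    if "G \<in> C0" "W \<subseteq> verts G" "card W \<le> k + k * k * R" for G W
  proof
    assume *: "k \<le> 2 * wcol R (induce G W)"
    have "real (wcol R (induce G W)) \<le> c * real (card W) powr (1/4)"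
      using c(2)[OF that(1) subgraph_induce[of G W]] wf that by (simp add: induce_def)
    also have "\<dots> \<le> c * ((real k * (R + 1))\<^sup>2) powr (1/4)"
    proof -
      have "k + k * k * R \<le> k * k + k * k * R"
        using k0 by simp
      also have "\<dots> \<le> (k * (R + 1))\<^sup>2"
        by (simp add: power2_eq_square algebra_simps)
      finally have "card W \<le> (k * (R + 1))\<^sup>2"
        using that(3) by simp
      then have "real (card W) \<le> real ((k * (R + 1))\<^sup>2)"
        by (simp only: of_nat_le_iff)
      also have "\<dots> = (real k * (R + 1))\<^sup>2"
        by (simp add: distrib_left)
      finally have "real (card W) \<le> (real k * (R + 1))\<^sup>2" .
      then show ?thesis
        using c(1) by (intro mult_left_mono powr_mono2) auto
    qed
    also have "((real k * (R + 1))\<^sup>2) powr (1/4) = sqrt (real k * (R + 1))"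
      by (simp add: powr_half_sqrt[symmetric] powr_powr flip: powr_numeral)
    finally have "real k \<le> 2 * c * sqrt (real k * (R + 1))"
      using * by simp
    then have "(real k)\<^sup>2 \<le> (2 * c * sqrt (real k * (R + 1)))\<^sup>2"
      by (intro power_mono) auto
    also have "\<dots> = 4 * c\<^sup>2 * (R + 1) * real k"
      by (simp add: power_mult_distrib)
    finally have "real k * real k \<le> (4 * c\<^sup>2 * (R + 1)) * real k"
      by (simp add: power2_eq_square)
    then show False
      using k k0 by simp
  qed
  have "card (unhit G S (k * R) j) \<le> k * card S ^ k" if G: "G \<in> C0" and S: "finite S" and j: "j \<le> R" for G S j
  proof -
    let ?U = "unhit G S (k * R) j"
    have wfG: "wf_graph G"
      using wf G by blast
    have finU: "finite ?U"
      using wfG by (auto simp: unhit_def wf_graph_def)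
    obtain F where F: "\<And>z. z \<in> ?U \<Longrightarrow> F z \<subseteq> tails G S j z \<and> finite (F z) \<and> card (F z) = k \<and>
        (\<forall>ws\<in>F z. \<forall>ws'\<in>F z. ws \<noteq> ws' \<longrightarrow> set ws \<inter> set ws' = {})"
      using unhit_fan[of _ G S k R j k] j by (metis order_refl)
    have inj: "inj_on last (F z)" if "z \<in> ?U" for z
    proof (rule inj_onI, rule ccontr)
      fix ws ws' assume *: "ws \<in> F z" "ws' \<in> F z" "last ws = last ws'" "ws \<noteq> ws'"
      then have "ws \<noteq> []" "ws' \<noteq> []"
        using F[OF that] by (auto simp: tails_def)
      then show False
        using F[OF that] * last_in_set[of ws] last_in_set[of ws'] by (metis disjoint_iff)
    qed
    have ends: "(\<lambda>z. last ` F z) ` ?U \<subseteq> {B. B \<subseteq> S \<and> card B = k}"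
      using F card_image[OF inj] by (fastforce simp: tails_def)
    have "card ?U \<le> k * card ((\<lambda>z. last ` F z) ` ?U)"
    proof (rule card_le_mult_card_image[OF finU])
      fix B assume B: "B \<in> (\<lambda>z. last ` F z) ` ?U"
      show "card {z \<in> ?U. last ` F z = B} \<le> k"
      proof (rule ccontr)
        assume "\<not> ?thesis"
        then have "k \<le> card {z \<in> ?U. last ` F z = B}"
          by simp
        then obtain Z where Z: "Z \<subseteq> {z \<in> ?U. last ` F z = B}" "card Z = k"
          by (rule obtain_subset_with_card_n) blast
        have ZU: "z \<in> ?U" if "z \<in> Z" for z
          using Z(1) that by blast
        define f where "f z b = inv_into (F z) last b" for z b
        have f: "f z b \<in> F z" "last (f z b) = b" if "z \<in> Z" "b \<in> B" for z b
          using that Z(1) unfolding f_def by (auto intro: inv_into_into f_inv_into_f)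
        have ft: "f z b \<in> tails G S j z" if "z \<in> Z" "b \<in> B" for z b
          using f[OF that] F[OF ZU[OF that(1)]] by blast
        have cB: "card B = k"
          using B ends by auto
        obtain W where "W \<subseteq> verts G" "card W \<le> k + k * k * R" "k \<le> 2 * wcol R (induce G W)"
        proof (rule fans_imp_wcol[OF wfG Z(2) cB k0, of f R])
          show "walk G (z # f z b)" "f z b \<noteq> [] \<and> last (f z b) = b \<and> length (f z b) \<le> R"
            if "z \<in> Z" "b \<in> B" for z b
            using ft[OF that] f(2)[OF that] j by (auto simp: tails_def)
          show "set (f z b) \<inter> set (f z b') = {}" if "z \<in> Z" "b \<in> B" "b' \<in> B" "b \<noteq> b'" for z b b'
            using F[OF ZU[OF that(1)]] f[OF that(1,2)] f[OF that(1,3)] that(4) by metis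
        qed
        then show False
          using nofan[OF G] by blast
      qed
    qed
    also have "card ((\<lambda>z. last ` F z) ` ?U) \<le> card {B. B \<subseteq> S \<and> card B = k}"
      using ends S by (intro card_mono) auto
    also have "\<dots> = card S choose k"
      by (rule n_subsets[OF S])
    also have "\<dots> \<le> card S ^ k"
      using binomial_fact_pow[of "card S" k] fact_ge_1[of k, where 'a = nat] mult_le_mono2[of 1 "fact k" "card S choose k"] by linarith
    finally show ?thesis
      by simp
  qed
  then show ?thesis
    using that k0 by blast
qed

subsection \<open>Counting types over separators\<close>

text \<open>All edges at \<open>ts\<close> are deleted and remembered in the colours
  \<open>cut_col\<close>, which also name the elements of \<open>ts\<close> (even numbers for
  equality, odd ones for adjacency). No information is lost, but distance now means distance
  avoiding \<open>ts\<close>, so that separation becomes being far apart.\<close>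

definition cut_rel :: "('v \<Rightarrow> 'v \<Rightarrow> bool) \<Rightarrow> 'v list \<Rightarrow> 'v \<Rightarrow> 'v \<Rightarrow> bool" where
  "cut_rel E ts x y \<longleftrightarrow> E x y \<and> x \<notin> set ts \<and> y \<notin> set ts"

definition cut_col :: "('v \<Rightarrow> 'v \<Rightarrow> bool) \<Rightarrow> ('v \<Rightarrow> nat) \<Rightarrow> 'v list \<Rightarrow> 'v \<Rightarrow> nat" where
  "cut_col E \<kappa> ts x = prod_encode (\<kappa> x, set_encode
     ({2 * j | j. j < length ts \<and> x = ts ! j} \<union> {2 * j + 1 | j. j < length ts \<and> E x (ts ! j)}))"

lemma cut_col_eqD:
  assumes "cut_col E \<kappa> ts x = cut_col E \<kappa> ts x'"
  shows "\<kappa> x = \<kappa> x'" "j < length ts \<Longrightarrow> x = ts ! j \<longleftrightarrow> x' = ts ! j"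
    "j < length ts \<Longrightarrow> E x (ts ! j) \<longleftrightarrow> E x' (ts ! j)"
proof -
  let ?A = "\<lambda>x. {2 * j | j. j < length ts \<and> x = ts ! j} \<union> {2 * j + 1 | j. j < length ts \<and> E x (ts ! j)}"
  have "finite (?A y)" for y
    by (rule finite_subset[of _ "{..<2 * length ts}"]) auto
  then have A: "?A x = ?A x'" and "\<kappa> x = \<kappa> x'"
    using assms set_encode_eq by (auto simp: cut_col_def)
  then show "\<kappa> x = \<kappa> x'" by simp
  have mem: "2 * j \<in> ?A y \<longleftrightarrow> j < length ts \<and> y = ts ! j"
    "2 * j + 1 \<in> ?A y \<longleftrightarrow> j < length ts \<and> E y (ts ! j)" for j y
    by (auto, presburger+)
  show "j < length ts \<Longrightarrow> x = ts ! j \<longleftrightarrow> x' = ts ! j"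
    using A mem(1)[of j x] mem(1)[of j x'] by (metis (no_types, lifting))
  show "j < length ts \<Longrightarrow> E x (ts ! j) \<longleftrightarrow> E x' (ts ! j)"
    using A mem(2)[of j x] mem(2)[of j x'] by (metis (no_types, lifting))
qed

lemma cut_col_range:
  assumes "\<kappa> x \<in> K" "length ts \<le> b"
  shows "cut_col E \<kappa> ts x \<in> prod_encode ` (K \<times> set_encode ` Pow {..<2 * b})"
  unfolding cut_col_def using assms by (intro imageI SigmaI PowI) auto

lemma cut_rel_transfer:
  assumes "\<And>x y. E x y \<Longrightarrow> E y x"
    and "cut_col E \<kappa> ts x = cut_col E \<kappa> ts x'" "cut_col E \<kappa> ts y = cut_col E \<kappa> ts y'"
    and "cut_rel E ts x y \<longleftrightarrow> cut_rel E ts x' y'" and "E x y"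
  shows "E x' y'"
proof -
  consider "x \<notin> set ts \<and> y \<notin> set ts" | j where "j < length ts" "y = ts ! j" | j where "j < length ts" "x = ts ! j"
    by (metis in_set_conv_nth)
  then show ?thesis
  proof cases
    case 1
    then show ?thesis using assms by (simp add: cut_rel_def)
  next
    case 2
    then show ?thesis using assms cut_col_eqD(2,3) by metis
  next
    case 3
    then show ?thesis using assms cut_col_eqD(2,3) by metis
  qed
qed

text \<open>The old edges are quantifier-free definable from \<open>cut_rel\<close> and
  \<open>cut_col\<close>, so no rank is lost.\<close>

lemma tp_cut:
  assumes "finite V" "\<And>x y. E x y \<Longrightarrow> E y x" "length xs = length ys"
    and "tp V (cut_rel E ts) (cut_col E \<kappa> ts) q xs = tp V (cut_rel E ts) (cut_col E \<kappa> ts) q ys"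
  shows "tp V E \<kappa> q xs = tp V E \<kappa> q ys"
  using assms(3,4)
proof (induction q arbitrary: xs ys)
  case 0
  note h = 0(2)[unfolded tp_0_iff[OF 0(1)]]
  have "E (xs ! i) (xs ! j) \<longleftrightarrow> E (ys ! i) (ys ! j)" if "i < length xs" "j < length xs" for i j
  proof
    have eq: "cut_col E \<kappa> ts (xs ! i) = cut_col E \<kappa> ts (ys ! i)" "cut_col E \<kappa> ts (xs ! j) = cut_col E \<kappa> ts (ys ! j)"
      "cut_rel E ts (xs ! i) (xs ! j) \<longleftrightarrow> cut_rel E ts (ys ! i) (ys ! j)"
      using h that by auto
    show "E (xs ! i) (xs ! j) \<Longrightarrow> E (ys ! i) (ys ! j)"
      using cut_rel_transfer[where E = E] assms(2) eq by blast
    show "E (ys ! i) (ys ! j) \<Longrightarrow> E (xs ! i) (xs ! j)"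
      using cut_rel_transfer[where E = E] assms(2) eq[symmetric] by blast
  qed
  moreover have "\<kappa> (xs ! i) = \<kappa> (ys ! i)" if "i < length xs" for i
    using h that by (intro cut_col_eqD(1)[of E \<kappa> ts]) simp
  ultimately show ?case
    unfolding tp_0_iff[OF 0(1)] using h by simp
next
  case (Suc q)
  have "\<exists>d\<in>V. tp V E \<kappa> q (xs @ [c]) = tp V E \<kappa> q (ys @ [d])" if cV: "c \<in> V" for c
  proof -
    obtain d where "d \<in> V" "tp V (cut_rel E ts) (cut_col E \<kappa> ts) q (xs @ [c]) =
        tp V (cut_rel E ts) (cut_col E \<kappa> ts) q (ys @ [d])"
      using tp_forth[OF assms(1) Suc.prems(2) cV] by metis
    then show ?thesis
      using Suc.IH[of "xs @ [c]" "ys @ [d]"] Suc.prems(1) by auto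
  qed
  moreover have "\<exists>c\<in>V. tp V E \<kappa> q (ys @ [d]) = tp V E \<kappa> q (xs @ [c])" if dV: "d \<in> V" for d
  proof -
    obtain c where "c \<in> V" "tp V (cut_rel E ts) (cut_col E \<kappa> ts) q (ys @ [d]) =
        tp V (cut_rel E ts) (cut_col E \<kappa> ts) q (xs @ [c])"
      using tp_forth[OF assms(1) Suc.prems(2)[symmetric] dV] by metis
    then show ?thesis
      using Suc.IH[of "ys @ [d]" "xs @ [c]"] Suc.prems(1) by auto
  qed
  moreover have "tp V E \<kappa> q xs = tp V E \<kappa> q ys"
    using Suc.IH[OF Suc.prems(1)] tp_mono[OF Suc.prems(2), of q] by simp
  ultimately show ?case
    unfolding tp_Suc_iff[OF assms(1)] by simp
qed

lemma nb_cut_walk: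
  assumes "nb (verts G) (cut_rel (edges G) ts) n u a" "u \<in> verts G" "u \<notin> set ts" "wf_graph G"
  shows "\<exists>xs. walk G xs \<and> hd xs = u \<and> last xs = a \<and> length xs \<le> n + 1 \<and> set xs \<inter> set ts = {}"
  using assms(1)
proof (induction n arbitrary: a)
  case 0
  then show ?case
    using assms by (intro exI[of _ "[u]"]) (auto simp: walk_def)
next
  case (Suc n)
  show ?case
  proof (cases "nb (verts G) (cut_rel (edges G) ts) n u a")
    case True
    then show ?thesis
      using Suc.IH[OF True] by (metis add_Suc le_SucI)
  next
    case False
    then obtain z where z: "nb (verts G) (cut_rel (edges G) ts) n u z" "cut_rel (edges G) ts z a"
      using Suc.prems by auto
    obtain xs where xs: "walk G xs" "hd xs = u" "last xs = z" "length xs \<le> n + 1" "set xs \<inter> set ts = {}"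
      using Suc.IH[OF z(1)] by blast
    moreover have "a \<in> verts G"
      using z(2) assms(4) by (auto simp: cut_rel_def wf_graph_def)
    ultimately show ?thesis
      using z(2) by (intro exI[of _ "xs @ [a]"])
        (auto simp: walk_def successively_append_iff cut_rel_def hd_append)
  qed
qed

text \<open>Endpoints count: a set containing u or a separates them. In particular every set
  separates all vertices from its own elements.\<close>

definition separates :: "'a graph \<Rightarrow> nat \<Rightarrow> 'a set \<Rightarrow> 'a \<Rightarrow> 'a \<Rightarrow> bool" where
  "separates G R S u a \<longleftrightarrow>
     (\<forall>xs. walk G xs \<and> hd xs = u \<and> last xs = a \<and> length xs \<le> R + 1 \<longrightarrow> set xs \<inter> S \<noteq> {})"

text \<open>After cutting at \<open>ts\<close> the points u and u' are far from a, so locality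
  applies in the cut structure and the result is carried back by \<open>tp_cut\<close>.\<close>

lemma separated_tp_eq:
  assumes "wf_graph G" "u \<in> verts G - set ts" "u' \<in> verts G - set ts" "a \<in> verts G"
    and "separates G (5 ^ q) (set ts) u a" "separates G (5 ^ q) (set ts) u' a"
    and "tp (verts G) (cut_rel (edges G) ts) (cut_col (edges G) \<kappa> ts) (loc_rank (q + 2) q) [u] =
      tp (verts G) (cut_rel (edges G) ts) (cut_col (edges G) \<kappa> ts) (loc_rank (q + 2) q) [u']"
  shows "tp (verts G) (edges G) \<kappa> q [u, a] = tp (verts G) (edges G) \<kappa> q [u', a]"
proof -
  have symG: "\<And>x y. edges G x y \<Longrightarrow> edges G y x" and finG: "finite (verts G)"
    using assms(1) by (auto simp: wf_graph_def)
  interpret sym_structure "verts G" "cut_rel (edges G) ts" "cut_col (edges G) \<kappa> ts"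
    using symG finG by unfold_locales (auto simp: cut_rel_def)
  have "\<not> near (5 ^ q) u a" "\<not> near (5 ^ q) u' a"
    using nb_cut_walk[of G ts "5 ^ q"] assms(1-6) unfolding separates_def by blast+
  then have "ty q [u, a] = ty q [u', a]"
    using tp_pair_far[OF assms(7)] assms(2-4) by blast
  then show ?thesis
    by (intro tp_cut[where E = "edges G", OF finG symG]) auto
qed

text \<open>A walk from u to a must meet S, and its part up to S is a tail, which T hits.\<close>

lemma hits_imp_separates:
  assumes "separates G R S u a" "u \<notin> S" "hits T (tails G S R u)"
  shows "separates G R T u a"
  unfolding separates_def
proof (intro allI impI)
  fix xs assume xs: "walk G xs \<and> hd xs = u \<and> last xs = a \<and> length xs \<le> R + 1"
  then obtain ws where ws: "xs = u # ws"
    by (cases xs) (auto simp: walk_def)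
  obtain s where s: "s \<in> set xs" "s \<in> S"
    using assms(1) xs unfolding separates_def by blast
  then have "s \<in> set ws"
    using ws assms(2) by auto
  then obtain as bs where ab: "ws = as @ s # bs"
    using split_list by metis
  have "as @ [s] \<in> tails G S R u"
    using xs ws ab s(2) walk_append(2)[of G "u # as @ [s]" bs] by (auto simp: tails_def)
  then show "set xs \<inter> T \<noteq> {}"
    using assms(3) ws ab by (fastforce simp: hits_def)
qed

lemma card_lists_length_le_bound:
  assumes "finite A"
  shows "card {xs. set xs \<subseteq> A \<and> length xs \<le> n} \<le> (n + 1) * (card A + 1) ^ n"
proof -
  have "(\<Sum>i\<le>n. card A ^ i) \<le> (\<Sum>i\<le>n. (card A + 1) ^ n)"
  proof (rule sum_mono)
    fix i assume "i \<in> {..n}"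
    then show "card A ^ i \<le> (card A + 1) ^ n"
      using power_mono[of "card A" "card A + 1" i] power_increasing[of i n "card A + 1"] by fastforce
  qed
  then show ?thesis
    using card_lists_length_le[OF assms, of n] by simp
qed

text \<open>Apart from polynomially many exceptions, each point is separated by one of polynomially many
  sets of bounded size, and over a fixed such set there are boundedly many types.\<close>
lemma card_separated_types:
  assumes nd: "nowhere_dense C0" and wf: "\<forall>G\<in>C0. wf_graph G" and K: "finite K"
  obtains c D :: nat where "\<And>G \<kappa> S B U. G \<in> C0 \<Longrightarrow> \<kappa> ` verts G \<subseteq> K \<Longrightarrow> finite S \<Longrightarrow>
    B \<subseteq> verts G \<Longrightarrow> U \<subseteq> verts G \<Longrightarrow>
    (\<And>u a. u \<in> U \<Longrightarrow> a \<in> B \<Longrightarrow> separates G (5 ^ q) S u a) \<Longrightarrow>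
    (\<And>u u'. u \<in> U \<Longrightarrow> u' \<in> U \<Longrightarrow> u \<noteq> u' \<Longrightarrow>
       \<exists>a\<in>B. tp (verts G) (edges G) \<kappa> q [u, a] \<noteq> tp (verts G) (edges G) \<kappa> q [u', a]) \<Longrightarrow>
    card U \<le> c * (card S + 1) ^ D"
proof -
  define R :: nat where "R = 5 ^ q"
  obtain k where k: "k > 0" "\<And>G S j. G \<in> C0 \<Longrightarrow> finite S \<Longrightarrow> j \<le> R \<Longrightarrow>
      card (unhit G S (k * R) j) \<le> k * card S ^ k"
    using card_unhit[OF nd wf, of R] by metis
  define h b M where "h = k * R" and "b = sep_bound h R"
    and "M = card (tp_range (prod_encode ` (K \<times> set_encode ` Pow {..<2 * b})) (loc_rank (q + 2) q) 1)"
  \<comment> \<open>The exceptional points contribute 1 + k and exponent k; the others are counted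
    by lists of length at most b over the pool, with exponent k * b, times \<open>M\<close> types. D
    dominates both exponents.\<close>
  define c D where "c = 1 + k + (b + 1) * (2 + R * k) ^ b * M" and "D = k * (b + 1)"
  show thesis
  proof (rule that[of c D])
    fix G \<kappa> S B U
    assume G: "G \<in> C0" and \<kappa>: "\<kappa> ` verts G \<subseteq> K" and S: "finite S" and B: "B \<subseteq> verts G" and U: "U \<subseteq> verts G"
      and sep: "\<And>u a. u \<in> U \<Longrightarrow> a \<in> B \<Longrightarrow> separates G (5 ^ q) S u a"
      and dist: "\<And>u u'. u \<in> U \<Longrightarrow> u' \<in> U \<Longrightarrow> u \<noteq> u' \<Longrightarrow>
        \<exists>a\<in>B. tp (verts G) (edges G) \<kappa> q [u, a] \<noteq> tp (verts G) (edges G) \<kappa> q [u', a]"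
    have wfG: "wf_graph G" and finV: "finite (verts G)"
      using wf G by (auto simp: wf_graph_def)
    \<comment> \<open>\<open>A\<close> is the common pool of all separators, \<open>X\<close> the
      set of exceptional points without a bounded separator; both are polynomial in |S|.\<close>
    define A where "A = S \<union> (\<Union>i<R. unhit G S h i)"
    define X where "X = S \<union> unhit G S h R"
    have finu: "finite (unhit G S h i)" for i
      using finV by (simp add: unhit_def)
    have finA: "finite A" and finX: "finite X"
      using S finu by (auto simp: A_def X_def)
    have s1: "card S \<le> (card S + 1) ^ k" "k * card S ^ k \<le> k * (card S + 1) ^ k"
      using self_le_power[of "card S + 1" k] k(1) power_mono[of "card S" "card S + 1" k] by auto
    have cX: "card X \<le> (1 + k) * (card S + 1) ^ k"
      using card_Un_le[of S "unhit G S h R"] k(2)[OF G S, of R] s1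
      unfolding X_def h_def distrib_right mult_1 by linarith
    have "card (\<Union>i<R. unhit G S h i) \<le> (\<Sum>i<R. card (unhit G S h i))"
      by (rule card_UN_le) simp
    also have "\<dots> \<le> R * (k * (card S + 1) ^ k)"
    proof (rule order_trans[OF sum_bounded_above[where K = "k * (card S + 1) ^ k"]])
      fix i assume "i \<in> {..<R}"
      then show "card (unhit G S h i) \<le> k * (card S + 1) ^ k"
        using order_trans[OF k(2)[OF G S, of i] s1(2)] unfolding h_def by simp
    qed simp
    finally have "card (\<Union>i<R. unhit G S h i) \<le> R * (k * (card S + 1) ^ k)" .
    moreover have "1 \<le> (card S + 1) ^ k"
      by (rule one_le_power) simp
    ultimately have "card A + 1 \<le> (card S + 1) ^ k + R * (k * (card S + 1) ^ k) + (card S + 1) ^ k"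
      using card_Un_le[of S "\<Union>i<R. unhit G S h i"] s1(1) unfolding A_def by linarith
    then have cA: "card A + 1 \<le> (2 + R * k) * (card S + 1) ^ k"
      by (simp add: algebra_simps)
    have "\<exists>ts. set ts \<subseteq> A \<and> length ts \<le> b \<and> u \<notin> set ts \<and> (\<forall>a\<in>B. separates G (5 ^ q) (set ts) u a)"
      if u: "u \<in> U - X" for u
    proof -
      have "u \<in> verts G - S - unhit G S h R"
        using u U by (auto simp: X_def)
      then obtain T where T: "T \<subseteq> A" "finite T" "card T \<le> b" "hits T (tails G S R u)"
        using bounded_separator[of u G S h R] by (auto simp: A_def b_def)
      have uS: "u \<notin> S"
        using u by (auto simp: X_def)
      obtain ts where ts: "set ts = T - {u}" "distinct ts"
        using finite_distinct_list[of "T - {u}"] T(2) by auto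
      have "length ts = card (T - {u})"
        using distinct_card[OF ts(2)] ts(1) by simp
      also have "\<dots> \<le> b"
        using T(2,3) card_mono[of T "T - {u}"] by auto
      finally have "length ts \<le> b" .
      moreover have "separates G R (set ts) u a" if "a \<in> B" for a
        unfolding ts(1)
        using hits_imp_separates[OF _ uS hits_remove_start[OF T(4) uS]] sep[of u a] u that
        by (simp add: R_def)
      ultimately show ?thesis
        using ts(1) T(1) by (intro exI[of _ ts]) (auto simp: R_def)
    qed
    then obtain ts where ts: "\<And>u. u \<in> U - X \<Longrightarrow> set (ts u) \<subseteq> A \<and> length (ts u) \<le> b \<and> u \<notin> set (ts u) \<and>
        (\<forall>a\<in>B. separates G (5 ^ q) (set (ts u)) u a)"
      by metis
    define f where "f u = (ts u, tp (verts G) (cut_rel (edges G) (ts u)) (cut_col (edges G) \<kappa> (ts u))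
        (loc_rank (q + 2) q) [u])" for u
    \<comment> \<open>The separator together with the type of u over it determines the types of all
      pairs (u, a), and these tell the elements of U apart.\<close>
    have "inj_on f (U - X)"
    proof (rule inj_onI, rule ccontr)
      fix u u' assume u: "u \<in> U - X" "u' \<in> U - X" "f u = f u'" "u \<noteq> u'"
      then obtain a where a: "a \<in> B" "tp (verts G) (edges G) \<kappa> q [u, a] \<noteq> tp (verts G) (edges G) \<kappa> q [u', a]"
        using dist by blast
      have "ts u = ts u'"
        using u(3) by (simp add: f_def)
      note ts' = ts[OF u(2), folded this]
      have "tp (verts G) (edges G) \<kappa> q [u, a] = tp (verts G) (edges G) \<kappa> q [u', a]"
      proof (rule separated_tp_eq[OF wfG])
        show "u \<in> verts G - set (ts u)" "u' \<in> verts G - set (ts u)" "a \<in> verts G"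
          using u(1,2) U B a(1) ts[OF u(1)] ts' by blast+
        show "separates G (5 ^ q) (set (ts u)) u a" "separates G (5 ^ q) (set (ts u)) u' a"
          using a(1) ts[OF u(1)] ts' by blast+
        show "tp (verts G) (cut_rel (edges G) (ts u)) (cut_col (edges G) \<kappa> (ts u)) (loc_rank (q + 2) q) [u] =
            tp (verts G) (cut_rel (edges G) (ts u)) (cut_col (edges G) \<kappa> (ts u)) (loc_rank (q + 2) q) [u']"
          using u(3) \<open>ts u = ts u'\<close> by (simp add: f_def)
      qed
      then show False
        using a(2) by simp
    qed
    moreover have "f ` (U - X) \<subseteq> {ts. set ts \<subseteq> A \<and> length ts \<le> b} \<times>
        tp_range (prod_encode ` (K \<times> set_encode ` Pow {..<2 * b})) (loc_rank (q + 2) q) 1"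
    proof (rule image_subsetI)
      fix u assume u: "u \<in> U - X"
      have "cut_col (edges G) \<kappa> (ts u) ` verts G \<subseteq> prod_encode ` (K \<times> set_encode ` Pow {..<2 * b})"
        using cut_col_range[of \<kappa> _ K "ts u" b "edges G"] \<kappa> ts[OF u] by (intro image_subsetI) blast
      then show "f u \<in> {ts. set ts \<subseteq> A \<and> length ts \<le> b} \<times>
          tp_range (prod_encode ` (K \<times> set_encode ` Pow {..<2 * b})) (loc_rank (q + 2) q) 1"
        using tp_in_range[of "cut_col (edges G) \<kappa> (ts u)" "verts G" _ "[u]"] ts[OF u] u U
        unfolding f_def by auto
    qed
    moreover have "finite ({ts. set ts \<subseteq> A \<and> length ts \<le> b} \<times>
        tp_range (prod_encode ` (K \<times> set_encode ` Pow {..<2 * b})) (loc_rank (q + 2) q) 1)"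
      using finA K by (intro finite_cartesian_product finite_lists_length_le finite_tp_range) auto
    ultimately have "card (U - X) \<le> card ({ts. set ts \<subseteq> A \<and> length ts \<le> b} \<times>
        tp_range (prod_encode ` (K \<times> set_encode ` Pow {..<2 * b})) (loc_rank (q + 2) q) 1)"
      by (rule card_inj_on_le)
    also have "\<dots> = card {ts. set ts \<subseteq> A \<and> length ts \<le> b} * M"
      by (simp add: card_cartesian_product M_def)
    also have "\<dots> \<le> ((b + 1) * (card A + 1) ^ b) * M"
      using card_lists_length_le_bound[OF finA] by (rule mult_le_mono1)
    also have "\<dots> \<le> ((b + 1) * ((2 + R * k) * (card S + 1) ^ k) ^ b) * M"
      using power_mono[OF cA, of b] by (intro mult_le_mono1 mult_le_mono2) simp
    also have "\<dots> = ((b + 1) * (2 + R * k) ^ b * M) * (card S + 1) ^ (k * b)"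
      by (simp only: power_mult_distrib power_mult[symmetric] mult_ac)
    also have "\<dots> \<le> ((b + 1) * (2 + R * k) ^ b * M) * (card S + 1) ^ D"
      by (intro mult_le_mono2 power_increasing) (auto simp: D_def)
    finally have "card (U - X) \<le> ((b + 1) * (2 + R * k) ^ b * M) * (card S + 1) ^ D" .
    moreover have "card X \<le> (1 + k) * (card S + 1) ^ D"
      using cX power_increasing[of k D "card S + 1"] mult_le_mono2[of "(card S + 1) ^ k" "(card S + 1) ^ D" "1 + k"]
      by (simp add: D_def)
    moreover have "card U \<le> card X + card (U - X)"
    proof -
      have "card U \<le> card (X \<union> (U - X))"
        using finX finV U finite_subset by (intro card_mono) auto
      then show ?thesis
        using card_Un_le[of X "U - X"] by linarith
    qed
    ultimately show "card U \<le> c * (card S + 1) ^ D"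
      by (simp add: c_def distrib_right)
  qed
qed

subsection \<open>Separators from weak colouring orders\<close>

text \<open>If k + 1 disjoint members exist, they alone cannot be hit by k points, and the
  implication is vacuous. Otherwise the union of a maximum disjoint subfamily has at most k * d0
  points and meets every member; for each such point y, recursion handles the members through y with
  y removed. The sizes d shrink while d0 stays fixed to keep the bound a plain power.\<close>

lemma hitting_kernel:
  assumes "finite F" "\<And>X. X \<in> F \<Longrightarrow> finite X \<and> card X \<le> d" "d \<le> d0"
  shows "\<exists>F'\<subseteq>F. card F' \<le> ((k + 1) * (d0 + 1)) ^ d \<and>
    (\<forall>Y. finite Y \<and> card Y \<le> k \<and> (\<forall>X\<in>F'. X \<inter> Y \<noteq> {}) \<longrightarrow> (\<forall>X\<in>F. X \<inter> Y \<noteq> {}))"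
  using assms
proof (induction d arbitrary: F)
  case 0
  have "X = {}" if "X \<in> F" for X
    using 0(2)[OF that] by auto
  then have "F \<subseteq> {{}}"
    by blast
  then have "card F \<le> card {{} :: 'a set}"
    by (intro card_mono) auto
  then show ?case
    by (intro exI[of _ F]) simp
next
  case (Suc d)
  define disj where "disj M \<longleftrightarrow> M \<subseteq> F \<and> (\<forall>X\<in>M. \<forall>X'\<in>M. X \<noteq> X' \<longrightarrow> X \<inter> X' = {})" for M
  let ?g = "((k + 1) * (d0 + 1)) ^ d"
  have g1: "1 \<le> ?g"
    by (rule one_le_power) simp
  have big: "k + 1 + k * d0 * ?g \<le> ((k + 1) * (d0 + 1)) ^ Suc d"
  proof -
    have "k + 1 \<le> (k + 1) * ?g"
      using mult_le_mono2[OF g1, of "k + 1"] by simp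
    moreover have "k * d0 * ?g \<le> (k + 1) * d0 * ?g"
      by (intro mult_le_mono1) simp
    ultimately have "k + 1 + k * d0 * ?g \<le> (k + 1) * ?g + (k + 1) * d0 * ?g"
      by (rule add_mono)
    then show ?thesis
      by (simp add: algebra_simps)
  qed
  consider "{} \<in> F" | M where "{} \<notin> F" "disj M" "card M = k + 1"
    | "{} \<notin> F" "\<And>M. disj M \<Longrightarrow> card M \<noteq> k + 1"
    by blast
  then show ?case
  proof cases
    case 1
    then show ?thesis
      using big by (intro exI[of _ "{{}}"]) auto
  next
    case 2
    have "\<not> (\<forall>X\<in>M. X \<inter> Y \<noteq> {})" if Y: "finite Y" "card Y \<le> k" for Y
    proof
      assume "\<forall>X\<in>M. X \<inter> Y \<noteq> {}"
      then obtain f where f: "\<And>X. X \<in> M \<Longrightarrow> f X \<in> X \<and> f X \<in> Y"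
        by (metis disjoint_iff)
      have "inj_on f M"
        using f 2(2) unfolding disj_def inj_on_def by (metis disjoint_iff)
      then have "card M \<le> card Y"
        using f Y(1) by (intro card_inj_on_le[of f]) auto
      then show False
        using Y(2) 2(3) by simp
    qed
    moreover have "M \<subseteq> F" "card M \<le> ((k + 1) * (d0 + 1)) ^ Suc d"
      using 2 big unfolding disj_def by linarith+
    ultimately show ?thesis
      by (intro exI[of _ M]) blast
  next
    case 3
    have finD: "finite (Collect disj)"
      by (rule finite_subset[of _ "Pow F"]) (auto simp: disj_def Suc.prems(1))
    have "disj {}"
      by (simp add: disj_def)
    then have "Max (card ` Collect disj) \<in> card ` Collect disj"
      using finD by (intro Max_in) auto
    then obtain M where M: "disj M" "card M = Max (card ` Collect disj)"
      by auto
    have max: "card M' \<le> card M" if "disj M'" for M'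
      using that finD by (simp add: M(2))
    have finM: "finite M"
      using M(1) Suc.prems(1) finite_subset by (auto simp: disj_def)
    have cM: "card M \<le> k"
    proof (rule ccontr)
      assume "\<not> card M \<le> k"
      then have "k + 1 \<le> card M"
        by simp
      then obtain M' where M': "M' \<subseteq> M" "card M' = k + 1"
        by (rule obtain_subset_with_card_n) blast
      have "disj M'"
        using M'(1) M(1) unfolding disj_def by blast
      then show False
        using 3(2) M'(2) by blast
    qed
    have finY0: "finite (\<Union>M)"
      using finM M(1) Suc.prems(2) by (auto simp: disj_def)
    have cY0: "card (\<Union>M) \<le> k * d0"
    proof -
      have "card (\<Union>M) \<le> sum card M"
        by (rule card_Union_le_sum_card)
      also have "\<dots> \<le> card M * d0"
      proof (rule order_trans[OF sum_bounded_above[where K = d0]])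
        fix X assume "X \<in> M"
        then show "card X \<le> d0"
          using M(1) Suc.prems(2)[of X] Suc.prems(3) by (auto simp: disj_def)
      qed simp
      also have "\<dots> \<le> k * d0"
        using cM by simp
      finally show ?thesis .
    qed
    have meet: "X \<inter> \<Union>M \<noteq> {}" if X: "X \<in> F" for X
    proof
      assume e: "X \<inter> \<Union>M = {}"
      have "X \<notin> M"
      proof
        assume "X \<in> M"
        then have "X = {}"
          using e by auto
        then show False
          using 3(1) X by simp
      qed
      moreover have "X \<inter> X' = {}" if "X' \<in> M" for X'
        using e that by auto
      then have "disj (insert X M)"
        using M(1) X unfolding disj_def by (simp add: Int_commute)
      ultimately show False
        using max[of "insert X M"] finM by simp
    qed
    define Fy where "Fy y = (\<lambda>X. X - {y}) ` {X \<in> F. y \<in> X}" for y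
    have "\<exists>F'\<subseteq>Fy y. card F' \<le> ?g \<and>
      (\<forall>Y. finite Y \<and> card Y \<le> k \<and> (\<forall>X\<in>F'. X \<inter> Y \<noteq> {}) \<longrightarrow> (\<forall>X\<in>Fy y. X \<inter> Y \<noteq> {}))" for y
    proof (rule Suc.IH)
      show "finite (Fy y)"
        using Suc.prems(1) by (simp add: Fy_def)
      show "finite X \<and> card X \<le> d" if XF: "X \<in> Fy y" for X
      proof -
        obtain X' where "X' \<in> F" "y \<in> X'" "X = X' - {y}"
          using XF unfolding Fy_def by blast
        then show ?thesis
          using Suc.prems(2)[of X'] by (auto simp: le_diff_conv)
      qed
      show "d \<le> d0"
        using Suc.prems(3) by simp
    qed
    then obtain Ky where Ky: "\<And>y. Ky y \<subseteq> Fy y" "\<And>y. card (Ky y) \<le> ?g"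
      "\<And>y Y. finite Y \<Longrightarrow> card Y \<le> k \<Longrightarrow> \<forall>X\<in>Ky y. X \<inter> Y \<noteq> {} \<Longrightarrow> \<forall>X\<in>Fy y. X \<inter> Y \<noteq> {}"
      by metis
    have finK: "finite (Ky y)" for y
      using Ky(1)[of y] Suc.prems(1) by (auto simp: Fy_def intro: finite_subset)
    define F' where "F' = (\<Union>y\<in>\<Union>M. insert y ` Ky y)"
    have "F' \<subseteq> F"
    proof
      fix X assume "X \<in> F'"
      then obtain y Z where "X = insert y Z" "Z \<in> Fy y"
        using Ky(1) unfolding F'_def by blast
      then show "X \<in> F"
        unfolding Fy_def by (auto simp: insert_absorb)
    qed
    moreover have "card F' \<le> ((k + 1) * (d0 + 1)) ^ Suc d"
    proof -
      have "card F' \<le> (\<Sum>y\<in>\<Union>M. card (insert y ` Ky y))"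
        unfolding F'_def by (rule card_UN_le[OF finY0])
      also have "\<dots> \<le> card (\<Union>M) * ?g"
      proof (rule order_trans[OF sum_bounded_above[where K = ?g]])
        fix y
        show "card (insert y ` Ky y) \<le> ?g"
          using card_image_le[OF finK, of "insert y" y] Ky(2)[of y] by linarith
      qed simp
      also have "\<dots> \<le> k * d0 * ?g"
        using cY0 by (rule mult_le_mono1)
      finally show ?thesis
        using big by linarith
    qed
    moreover have "X \<inter> Y \<noteq> {}"
      if Y: "finite Y" "card Y \<le> k" "\<forall>X\<in>F'. X \<inter> Y \<noteq> {}" and X: "X \<in> F" for X Y
    proof -
      obtain y where y: "y \<in> X" "y \<in> \<Union>M"
        using meet[OF X] by blast
      show ?thesis
      proof (cases "y \<in> Y")
        case False
        have "\<forall>Z\<in>Ky y. Z \<inter> Y \<noteq> {}"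
        proof
          fix Z assume "Z \<in> Ky y"
          then have "insert y Z \<in> F'"
            using y(2) unfolding F'_def by blast
          then have "insert y Z \<inter> Y \<noteq> {}"
            using Y(3) by blast
          then show "Z \<inter> Y \<noteq> {}"
            using False by simp
        qed
        then have "(X - {y}) \<inter> Y \<noteq> {}"
          using Ky(3)[OF Y(1,2), of y] X y(1) by (auto simp: Fy_def)
        then show ?thesis
          by blast
      qed (use y in blast)
    qed
    ultimately show ?thesis
      by (intro exI[of _ F']) blast
  qed
qed

lemma wreach_mono: "r \<le> r' \<Longrightarrow> wreach G rk r v \<subseteq> wreach G rk r' v"
  unfolding wreach_def by (auto intro: order_trans)

text \<open>Walk from y back to u and on to p: the first half has rank at least that of y, hence at
  least that of p.\<close>

lemma wreach_trans:
  assumes "wf_graph G" "y \<in> wreach G rk R u" "p \<in> wreach G rk R u" "rk p \<le> rk y"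
  shows "p \<in> wreach G rk (2 * R) y"
proof -
  obtain ys where ys: "walk G ys" "hd ys = u" "last ys = y" "length ys \<le> R + 1" "\<forall>w\<in>set ys. rk y \<le> rk w"
    using assms(2) by (auto simp: wreach_def)
  obtain ps where ps: "walk G ps" "hd ps = u" "last ps = p" "length ps \<le> R + 1" "\<forall>w\<in>set ps. rk p \<le> rk w"
    using assms(3) by (auto simp: wreach_def)
  obtain t where t: "ps = u # t"
    using ps(1,2) by (cases ps) (auto simp: walk_def)
  have r: "walk G (rev ys)" "rev ys \<noteq> []" "last (rev ys) = u" "hd (rev ys) = y"
    using walk_rev[OF assms(1) ys(1)] ys by (auto simp: walk_def hd_rev last_rev)
  have "walk G (rev ys @ t)"
    using r ps(1) unfolding t walk_def by (auto simp: successively_append_iff successively_Cons)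
  moreover have "last (rev ys @ t) = p"
    using r(3) ps(3) t by (cases "t = []") auto
  moreover have "hd (rev ys @ t) = y"
    using r by (simp add: hd_append)
  moreover have "\<forall>w\<in>set (rev ys @ t). rk p \<le> rk w"
    using ps(5) ys(5) assms(4) t by auto
  moreover have "length (rev ys @ t) \<le> 2 * R + 1"
    using ys(4) ps(4) t by simp
  ultimately show ?thesis
    unfolding wreach_def by blast
qed

lemma walk_min_wreach:
  fixes rk :: "'a \<Rightarrow> nat"
  assumes "wf_graph G" "walk G xs" "length xs \<le> R + 1"
  obtains p where "p \<in> set xs" "p \<in> wreach G rk R (hd xs)" "p \<in> wreach G rk R (last xs)"
proof -
  have ne: "xs \<noteq> []"
    using assms(2) by (simp add: walk_def)
  then have "Min (rk ` set xs) \<in> rk ` set xs"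
    by (intro Min_in) auto
  then obtain p where p: "p \<in> set xs" "rk p = Min (rk ` set xs)"
    by auto
  then have min: "rk p \<le> rk x" if "x \<in> set xs" for x
    using that by simp
  obtain as bs where ab: "xs = as @ p # bs"
    using split_list[OF p(1)] by blast
  have "p \<in> wreach G rk R (hd xs)"
    using assms min ab by (intro wreach_prefix[of G as p bs]) (auto simp: hd_append)
  moreover have "p \<in> wreach G rk R (last xs)"
    using walk_rev[OF assms(1,2)] assms(3) min ab
    by (intro wreach_prefix[of G "rev bs" p "rev as"]) (auto simp: hd_append hd_rev)
  ultimately show ?thesis
    using that p(1) by blast
qed

text \<open>The largest vertex y weakly reachable from both u and A has the property that all walks from u
  to A pass through the vertices weakly reachable from y; and there are few candidates for y.\<close>
lemma order_separators:
  assumes wf: "wf_graph G" and W: "W \<subseteq> verts G" "A \<subseteq> W" "U \<subseteq> W"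
    and w: "wcol (2 * R) (induce G W) \<le> m"
    and ker: "\<And>u a Y. u \<in> U \<Longrightarrow> a \<in> A \<Longrightarrow> finite Y \<Longrightarrow> card Y \<le> m \<Longrightarrow>
      (\<And>xs. walk G xs \<Longrightarrow> hd xs = u \<Longrightarrow> last xs = a \<Longrightarrow> length xs \<le> R + 1 \<Longrightarrow> set xs \<subseteq> W \<Longrightarrow> set xs \<inter> Y \<noteq> {}) \<Longrightarrow>
      separates G R Y u a"
  obtains \<S> where "finite \<S>" "card \<S> \<le> card A * wcol (2 * R) (induce G W) + 1"
    "\<And>S. S \<in> \<S> \<Longrightarrow> finite S \<and> card S \<le> wcol (2 * R) (induce G W)"
    "\<And>u. u \<in> U \<Longrightarrow> \<exists>S\<in>\<S>. \<forall>a\<in>A. separates G R S u a"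
proof -
  define G' where "G' = induce G W"
  define n where "n = wcol (2 * R) G'"
  have wf': "wf_graph G'" and vG': "verts G' = W"
    using subgraph_induce[OF wf W(1)] by (auto simp: subgraph_def G'_def induce_def)
  have finW: "finite W"
    using wf' vG' by (simp add: wf_graph_def)
  have finA: "finite A"
    using W(2) finW finite_subset by blast
  obtain rk where rk: "\<And>v. v \<in> W \<Longrightarrow> card (wreach G' rk (2 * R) v) \<le> n"
    using wcol_order[of G' "2 * R"] finW vG' unfolding n_def by metis
  have fin: "finite (wreach G' rk r v)" for r v
    using finite_wreach finW vG' by metis
  have rkR: "card (wreach G' rk R v) \<le> n" if "v \<in> W" for v
    using card_mono[OF fin wreach_mono[of R "2 * R" G' rk v]] rk[OF that] by simp
  define Q where "Q = (\<Union>a\<in>A. wreach G' rk R a)"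
  have "card Q \<le> (\<Sum>a\<in>A. card (wreach G' rk R a))"
    unfolding Q_def by (rule card_UN_le[OF finA])
  also have "\<dots> \<le> card A * n"
    using sum_bounded_above[of A "\<lambda>a. card (wreach G' rk R a)" n] rkR W(2) by auto
  finally have cQ: "card Q \<le> card A * n" .
  have finQ: "finite Q"
    using finA fin by (simp add: Q_def)
  define \<S> where "\<S> = insert {} (wreach G' rk (2 * R) ` Q)"
  have "card \<S> \<le> card (wreach G' rk (2 * R) ` Q) + 1"
    unfolding \<S>_def by (simp add: card_insert_if finQ)
  also have "\<dots> \<le> card A * n + 1"
    using card_image_le[OF finQ, of "wreach G' rk (2 * R)"] cQ by simp
  finally have c: "card \<S> \<le> card A * n + 1" .
  have S: "finite S \<and> card S \<le> n" if "S \<in> \<S>" for S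
  proof -
    have "Q \<subseteq> W"
      using wreach_subset[of G' rk R] vG' by (auto simp: Q_def)
    then show ?thesis
      using that rk fin by (auto simp: \<S>_def)
  qed
  have walk': "walk G' xs \<longleftrightarrow> walk G xs \<and> set xs \<subseteq> W" for xs
    unfolding G'_def by (rule walk_induce[OF W(1)])
  have "\<exists>S\<in>\<S>. \<forall>a\<in>A. separates G R S u a" if u: "u \<in> U" for u
  proof -
    define Y where "Y = wreach G' rk R u \<inter> Q"
    have min: "\<exists>p\<in>set xs. p \<in> Y" if "walk G xs" "hd xs = u" "last xs = a" "length xs \<le> R + 1" "set xs \<subseteq> W" "a \<in> A" for xs a
    proof -
      have "walk G' xs"
        using walk' that by blast
      from walk_min_wreach[OF wf' this that(4), of rk] show ?thesis
        using that(2,3,6) unfolding Y_def Q_def by blast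
    qed
    have fin0: "finite Y"
      using finQ by (simp add: Y_def)
    show ?thesis
    proof (cases "Y = {}")
      \<comment> \<open>Each short walk inside \<open>W\<close> from u to A has its minimum in Y, so
        there is no such walk. This case is the reason for adding the empty set to \<S>.\<close>
      case True
      then have "separates G R {} u a" if "a \<in> A" for a
        using min that by (intro ker[OF u that]) auto
      then show ?thesis
        by (auto simp: \<S>_def)
    next
      case False
      then have "Max (rk ` Y) \<in> rk ` Y"
        using fin0 by (intro Max_in) auto
      then obtain y where y: "y \<in> Y" "rk y = Max (rk ` Y)"
        by auto
      have le: "rk p \<le> rk y" if "p \<in> Y" for p
        using y(2) that fin0 by simp
      have yS: "wreach G' rk (2 * R) y \<in> \<S>"
        using y(1) by (simp add: \<S>_def Y_def)
      have "separates G R (wreach G' rk (2 * R) y) u a" if a: "a \<in> A" for a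
      proof (rule ker[OF u a])
        show "finite (wreach G' rk (2 * R) y)" "card (wreach G' rk (2 * R) y) \<le> m"
          using S[OF yS] w by (auto simp: n_def G'_def)
      next
        \<comment> \<open>Only walks inside \<open>W\<close> are checked; \<open>ker\<close> extends
          separation to all of G because the set has at most m elements.\<close>
        fix xs assume "walk G xs" "hd xs = u" "last xs = a" "length xs \<le> R + 1" "set xs \<subseteq> W"
        then obtain p where p: "p \<in> set xs" "p \<in> Y"
          using min a by blast
        then have "p \<in> wreach G' rk (2 * R) y"
          using wreach_trans[OF wf', of y rk R u p] y(1) le[OF p(2)] by (simp add: Y_def)
        then show "set xs \<inter> wreach G' rk (2 * R) y \<noteq> {}"
          using p(1) by blast
      qed
      then show ?thesis
        using yS by blast
    qed
  qed
  then show ?thesis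
    using that[of \<S>] c S finQ unfolding n_def G'_def \<S>_def by blast
qed

text \<open>Makes separation testable in a small subgraph: once W contains the kernel of the short
  walks from u to a, any set of at most m vertices that hits the walks inside W hits all of
  them.\<close>

lemma walk_kernel:
  assumes "wf_graph G"
  obtains F where "finite F" "card F \<le> ((m + 1) * (R + 2)) ^ (R + 1)"
    "\<And>X. X \<in> F \<Longrightarrow> X \<subseteq> verts G \<and> card X \<le> R + 1"
    "\<And>W Y. \<Union>F \<subseteq> W \<Longrightarrow> finite Y \<Longrightarrow> card Y \<le> m \<Longrightarrow>
      (\<And>xs. walk G xs \<Longrightarrow> hd xs = u \<Longrightarrow> last xs = a \<Longrightarrow> length xs \<le> R + 1 \<Longrightarrow> set xs \<subseteq> W \<Longrightarrow> set xs \<inter> Y \<noteq> {}) \<Longrightarrow>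
      separates G R Y u a"
proof -
  define P where "P = {set xs | xs. walk G xs \<and> hd xs = u \<and> last xs = a \<and> length xs \<le> R + 1}"
  have PV: "P \<subseteq> Pow (verts G)"
    by (auto simp: P_def walk_def)
  then have "finite P"
    using assms finite_subset by (auto simp: wf_graph_def)
  moreover have P: "finite X \<and> card X \<le> R + 1" if "X \<in> P" for X
    using that card_length order_trans by (fastforce simp: P_def)
  ultimately obtain F where F: "F \<subseteq> P" "card F \<le> ((m + 1) * (R + 1 + 1)) ^ (R + 1)"
    "\<And>Y. finite Y \<Longrightarrow> card Y \<le> m \<Longrightarrow> \<forall>X\<in>F. X \<inter> Y \<noteq> {} \<Longrightarrow> \<forall>X\<in>P. X \<inter> Y \<noteq> {}"
    using hitting_kernel[of P "R + 1" "R + 1" m] by (metis order_refl)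
  have "separates G R Y u a" if "\<Union>F \<subseteq> W" "finite Y" "card Y \<le> m"
    and hit: "\<And>xs. walk G xs \<Longrightarrow> hd xs = u \<Longrightarrow> last xs = a \<Longrightarrow> length xs \<le> R + 1 \<Longrightarrow> set xs \<subseteq> W \<Longrightarrow> set xs \<inter> Y \<noteq> {}"
    for W Y
  proof -
    have "\<forall>X\<in>F. X \<inter> Y \<noteq> {}"
    proof
      fix X assume X: "X \<in> F"
      then obtain xs where "X = set xs" "walk G xs" "hd xs = u" "last xs = a" "length xs \<le> R + 1"
        using F(1) by (auto simp: P_def)
      then show "X \<inter> Y \<noteq> {}"
        using hit[of xs] that(1) X by auto
    qed
    then show ?thesis
      using F(3)[OF that(2,3)] unfolding separates_def P_def by blast
  qed
  moreover have "finite F"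
    using F(1) \<open>finite P\<close> finite_subset by blast
  moreover have "((m + 1) * (R + 1 + 1)) = (m + 1) * (R + 2)"
    by simp
  ultimately show ?thesis
    using that[of F] F(1,2) P PV by (metis Pow_iff subsetD)
qed

text \<open>The bootstrap. The bound for S = A makes U, and with it the set W of all kernels,
  polynomial in m = |A|; so n, the weak colouring number on W, is at most a constant times
  m^\<epsilon>'. Then about m * n separators of size n account for at most c1 * (n + 1)^D points
  each, and the total has exponent 1 + \<epsilon>' * (D + 1) in m.\<close>

lemma card_types_almost_linear:
  fixes \<epsilon> :: real
  assumes nd: "nowhere_dense C0" and wf: "\<forall>G\<in>C0. wf_graph G" and K: "finite K" and \<epsilon>: "\<epsilon> > 0"
  obtains c :: real where "c \<ge> 0" "\<And>G \<kappa> A U. G \<in> C0 \<Longrightarrow> \<kappa> ` verts G \<subseteq> K \<Longrightarrow>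
    A \<subseteq> verts G \<Longrightarrow> A \<noteq> {} \<Longrightarrow> U \<subseteq> verts G \<Longrightarrow>
    (\<And>u u'. u \<in> U \<Longrightarrow> u' \<in> U \<Longrightarrow> u \<noteq> u' \<Longrightarrow>
       \<exists>a\<in>A. tp (verts G) (edges G) \<kappa> q [u, a] \<noteq> tp (verts G) (edges G) \<kappa> q [u', a]) \<Longrightarrow>
    real (card U) \<le> c * real (card A) powr (1 + \<epsilon>)"
proof -
  obtain c1 D :: nat where types: "\<And>G \<kappa> S B U. G \<in> C0 \<Longrightarrow> \<kappa> ` verts G \<subseteq> K \<Longrightarrow> finite S \<Longrightarrow>
    B \<subseteq> verts G \<Longrightarrow> U \<subseteq> verts G \<Longrightarrow>
    (\<And>u a. u \<in> U \<Longrightarrow> a \<in> B \<Longrightarrow> separates G (5 ^ q) S u a) \<Longrightarrow>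
    (\<And>u u'. u \<in> U \<Longrightarrow> u' \<in> U \<Longrightarrow> u \<noteq> u' \<Longrightarrow>
       \<exists>a\<in>B. tp (verts G) (edges G) \<kappa> q [u, a] \<noteq> tp (verts G) (edges G) \<kappa> q [u', a]) \<Longrightarrow>
    card U \<le> c1 * (card S + 1) ^ D"
    using card_separated_types[OF nd wf K, of q] by blast
  define R :: nat where "R = 5 ^ q"
  \<comment> \<open>The exponent of m in the size of W: D from U, 1 from A and R + 1 from the
    kernels.\<close>
  define E where "E = D + R + 2"
  define C1 where "C1 = 1 + c1 + c1 * (R + 2) ^ (R + 1) * (R + 1)"
  define C2 where "C2 = real C1 * 2 ^ E"
  define \<epsilon>' where "\<epsilon>' = min (1/2) (\<epsilon> / (D + 1))"
  define \<delta> where "\<delta> = \<epsilon>' / E"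
  have \<epsilon>': "\<epsilon>' > 0" "\<epsilon>' \<le> 1/2" "\<epsilon>' * (D + 1) \<le> \<epsilon>"
  proof -
    show "\<epsilon>' > 0"
      using \<epsilon> by (simp add: \<epsilon>'_def)
    show "\<epsilon>' \<le> 1/2"
      unfolding \<epsilon>'_def by (rule min.cobounded1)
    have "\<epsilon>' \<le> \<epsilon> / (D + 1)"
      by (simp add: \<epsilon>'_def)
    then show "\<epsilon>' * (D + 1) \<le> \<epsilon>"
      by (simp add: pos_le_divide_eq)
  qed
  have E0: "E > 0"
    by (simp add: E_def)
  have \<delta>: "\<delta> > 0" "real E * \<delta> = \<epsilon>'"
    using \<epsilon>'(1) E0 by (auto simp: \<delta>_def)
  obtain c2 where c2: "c2 \<ge> 1" "\<And>G H. G \<in> C0 \<Longrightarrow> subgraph H G \<Longrightarrow>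
      real (wcol (2 * R) H) \<le> c2 * real (card (verts H)) powr \<delta>"
    using nowhere_denseD[OF nd \<delta>(1), of "2 * R"] by metis
  define C3 where "C3 = c2 * C2 powr \<delta>"
  have "C2 \<ge> 1"
  proof -
    have "real C1 \<ge> 1" "(2::real) ^ E \<ge> 1"
      by (auto simp: C1_def)
    then show ?thesis
      unfolding C2_def using mult_mono[of 1 "real C1" 1 "2 ^ E"] by simp
  qed
  then have C3: "C3 \<ge> 1"
    using c2(1) \<delta>(1) ge_one_powr_ge_zero[of C2 \<delta>] mult_mono[of 1 c2 1 "C2 powr \<delta>"] by (simp add: C3_def)
  define c where "c = c1 * (C3 + 1) ^ (D + 1) + c1 * (C3\<^sup>2 + 1) ^ D"
  show thesis
  proof (rule that[of c])
    show "c \<ge> 0"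
      using C3 by (simp add: c_def)
    fix G \<kappa> A U
    assume G: "G \<in> C0" and \<kappa>: "\<kappa> ` verts G \<subseteq> K" and A: "A \<subseteq> verts G" "A \<noteq> {}" and U: "U \<subseteq> verts G"
      and dist: "\<And>u u'. u \<in> U \<Longrightarrow> u' \<in> U \<Longrightarrow> u \<noteq> u' \<Longrightarrow>
        \<exists>a\<in>A. tp (verts G) (edges G) \<kappa> q [u, a] \<noteq> tp (verts G) (edges G) \<kappa> q [u', a]"
    have wfG: "wf_graph G" and finV: "finite (verts G)"
      using wf G by (auto simp: wf_graph_def)
    have fin: "finite A" "finite U"
      using A(1) U finV finite_subset by blast+
    define m where "m = card A"
    have m: "m \<ge> 1"
      using A fin(1) by (simp add: m_def Suc_le_eq card_gt_0_iff)
    have cU: "card U \<le> c1 * (m + 1) ^ D"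
      unfolding m_def
    proof (rule types[OF G \<kappa> fin(1) A(1) U _ dist])
      \<comment> \<open>A walk ending in a meets A in its last vertex, so A itself is an admissible,
        though large, separator.\<close>
      show "separates G (5 ^ q) A u a" if "a \<in> A" for u a
        using that unfolding separates_def walk_def by (metis IntI empty_iff last_in_set)
    qed auto
    have "\<exists>F. finite F \<and> card F \<le> ((m + 1) * (R + 2)) ^ (R + 1) \<and>
      (\<forall>X\<in>F. X \<subseteq> verts G \<and> card X \<le> R + 1) \<and>
      (\<forall>W Y. \<Union>F \<subseteq> W \<longrightarrow> finite Y \<longrightarrow> card Y \<le> m \<longrightarrow>
      (\<forall>xs. walk G xs \<longrightarrow> hd xs = u \<longrightarrow> last xs = a \<longrightarrow> length xs \<le> R + 1 \<longrightarrow> set xs \<subseteq> W \<longrightarrow> set xs \<inter> Y \<noteq> {}) \<longrightarrow>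
      separates G R Y u a)" for u a
      by (rule walk_kernel[OF wfG, of m R u a]) blast
    then obtain F where F: "\<And>u a. finite (F u a)" "\<And>u a. card (F u a) \<le> ((m + 1) * (R + 2)) ^ (R + 1)"
      "\<And>u a X. X \<in> F u a \<Longrightarrow> X \<subseteq> verts G \<and> card X \<le> R + 1"
      "\<And>u a W Y. \<Union>(F u a) \<subseteq> W \<Longrightarrow> finite Y \<Longrightarrow> card Y \<le> m \<Longrightarrow>
      (\<forall>xs. walk G xs \<longrightarrow> hd xs = u \<longrightarrow> last xs = a \<longrightarrow> length xs \<le> R + 1 \<longrightarrow> set xs \<subseteq> W \<longrightarrow> set xs \<inter> Y \<noteq> {}) \<Longrightarrow>
      separates G R Y u a"
      by metis
    define W where "W = A \<union> U \<union> (\<Union>u\<in>U. \<Union>a\<in>A. \<Union>(F u a))"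
    have WV: "W \<subseteq> verts G" "A \<subseteq> W" "U \<subseteq> W"
      using A(1) U F(3) by (auto simp: W_def) blast
    define n where "n = wcol (2 * R) (induce G W)"
    have cW: "card W \<le> C1 * (m + 1) ^ E"
    proof -
      let ?g = "((m + 1) * (R + 2)) ^ (R + 1)"
      have 1: "card (\<Union>(F u a)) \<le> ?g * (R + 1)" for u a
      proof -
        have "card (\<Union>(F u a)) \<le> sum card (F u a)"
          by (rule card_Union_le_sum_card)
        also have "\<dots> \<le> card (F u a) * (R + 1)"
          using sum_bounded_above[of "F u a" card "R + 1"] F(3) by simp
        also have "\<dots> \<le> ?g * (R + 1)"
          using F(2) by (rule mult_le_mono1)
        finally show ?thesis .
      qed
      have 2: "card (\<Union>a\<in>A. \<Union>(F u a)) \<le> m * (?g * (R + 1))" for u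
        using card_UN_le[OF fin(1), of "\<lambda>a. \<Union>(F u a)"]
          sum_bounded_above[of A "\<lambda>a. card (\<Union>(F u a))", OF 1] by (simp add: m_def)
      have "card (\<Union>u\<in>U. \<Union>a\<in>A. \<Union>(F u a)) \<le> card U * (m * (?g * (R + 1)))"
        using card_UN_le[OF fin(2), of "\<lambda>u. \<Union>a\<in>A. \<Union>(F u a)"]
          sum_bounded_above[of U "\<lambda>u. card (\<Union>a\<in>A. \<Union>(F u a))", OF 2] by simp
      also have "\<dots> \<le> (c1 * (m + 1) ^ D) * ((m + 1) * (?g * (R + 1)))"
        using cU by (intro mult_le_mono) auto
      also have "\<dots> = (c1 * (R + 2) ^ (R + 1) * (R + 1)) * (m + 1) ^ E"
        unfolding E_def by (simp only: power_mult_distrib power_add power_one_right power2_eq_square mult_ac)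
      finally have 3: "card (\<Union>u\<in>U. \<Union>a\<in>A. \<Union>(F u a)) \<le> (c1 * (R + 2) ^ (R + 1) * (R + 1)) * (m + 1) ^ E" .
      have "m + 1 \<le> (m + 1) ^ E"
        using E0 by (intro self_le_power) auto
      then have 4: "card A \<le> (m + 1) ^ E"
        unfolding m_def by linarith
      have "c1 * (m + 1) ^ D \<le> c1 * (m + 1) ^ E"
        by (intro mult_le_mono2 power_increasing) (auto simp: E_def)
      then have 5: "card U \<le> c1 * (m + 1) ^ E"
        using cU by linarith
      have "card W \<le> card A + card U + card (\<Union>u\<in>U. \<Union>a\<in>A. \<Union>(F u a))"
        unfolding W_def using card_Un_le[of "A \<union> U" "\<Union>u\<in>U. \<Union>a\<in>A. \<Union>(F u a)"] card_Un_le[of A U] by linarith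
      also have "\<dots> \<le> (m + 1) ^ E + c1 * (m + 1) ^ E + (c1 * (R + 2) ^ (R + 1) * (R + 1)) * (m + 1) ^ E"
        using 3 4 5 by (intro add_mono)
      also have "\<dots> = C1 * (m + 1) ^ E"
        unfolding C1_def by (simp only: distrib_right mult_1)
      finally show ?thesis .
    qed
    have m1: "real m \<ge> 1"
      using m by simp
    have nb: "real n \<le> C3 * real m powr \<epsilon>'"
    proof -
      have "real (card W) \<le> C2 * real m ^ E"
      proof -
        have "real (card W) \<le> real C1 * (real m + 1) ^ E"
          using cW of_nat_le_iff[where 'a = real, of "card W" "C1 * (m + 1) ^ E"] by (simp add: add.commute)
        also have "\<dots> \<le> real C1 * (2 * real m) ^ E"
          using m1 by (intro mult_left_mono power_mono) auto
        finally show ?thesis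
          by (simp add: C2_def power_mult_distrib)
      qed
      then have "real (card W) powr \<delta> \<le> (C2 * real m ^ E) powr \<delta>"
        using \<delta>(1) by (intro powr_mono2) auto
      also have "\<dots> = C2 powr \<delta> * real m powr \<epsilon>'"
      proof -
        have "(real m ^ E) powr \<delta> = real m powr \<epsilon>'"
          using m1 by (simp add: powr_powr \<delta>(2) flip: powr_realpow)
        then show ?thesis
          by (simp add: powr_mult)
      qed
      finally have "c2 * real (card W) powr \<delta> \<le> c2 * (C2 powr \<delta> * real m powr \<epsilon>')"
        using c2(1) by (intro mult_left_mono) auto
      moreover have "real n \<le> c2 * real (card W) powr \<delta>"
        using c2(2)[OF G subgraph_induce[OF wfG WV(1)]] by (simp add: n_def induce_def)
      ultimately show ?thesis
        by (simp add: C3_def mult.assoc)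
    qed
    have p1: "real m powr (1 + \<epsilon>) \<ge> 1"
      using ge_one_powr_ge_zero[of "real m" "1 + \<epsilon>"] m1 \<epsilon> by simp
    show "real (card U) \<le> c * real (card A) powr (1 + \<epsilon>)"
    proof (cases "n \<le> m")
      case True
      obtain \<S> where \<S>: "finite \<S>" "card \<S> \<le> m * n + 1" "\<And>S. S \<in> \<S> \<Longrightarrow> finite S \<and> card S \<le> n"
        "\<And>u. u \<in> U \<Longrightarrow> \<exists>S\<in>\<S>. \<forall>a\<in>A. separates G R S u a"
      proof (rule order_separators[OF wfG WV, of R m])
        show "wcol (2 * R) (induce G W) \<le> m"
          using True by (simp add: n_def)
        show "separates G R Y u a" if "u \<in> U" "a \<in> A" "finite Y" "card Y \<le> m"
          "\<And>xs. walk G xs \<Longrightarrow> hd xs = u \<Longrightarrow> last xs = a \<Longrightarrow> length xs \<le> R + 1 \<Longrightarrow> set xs \<subseteq> W \<Longrightarrow> set xs \<inter> Y \<noteq> {}"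
          for u a Y
          using F(4)[of u a W Y] that by (auto simp: W_def)
      qed (auto simp: n_def m_def)
      define US where "US S = {u \<in> U. \<forall>a\<in>A. separates G R S u a}" for S
      have US: "card (US S) \<le> c1 * (n + 1) ^ D" if S: "S \<in> \<S>" for S
      proof -
        have "card (US S) \<le> c1 * (card S + 1) ^ D"
        proof (rule types[OF G \<kappa> _ A(1)])
          show "finite S"
            using \<S>(3)[OF S] by simp
          show "US S \<subseteq> verts G"
            using U by (auto simp: US_def)
          show "separates G (5 ^ q) S u a" if "u \<in> US S" "a \<in> A" for u a
            using that by (simp add: US_def R_def)
          show "\<exists>a\<in>A. tp (verts G) (edges G) \<kappa> q [u, a] \<noteq> tp (verts G) (edges G) \<kappa> q [u', a]"
            if "u \<in> US S" "u' \<in> US S" "u \<noteq> u'" for u u'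
            using that dist by (simp add: US_def)
        qed
        also have "\<dots> \<le> c1 * (n + 1) ^ D"
          using \<S>(3)[OF S] by (intro mult_le_mono2 power_mono) auto
        finally show ?thesis .
      qed
      have "U \<subseteq> (\<Union>S\<in>\<S>. US S)"
        using \<S>(4) by (auto simp: US_def)
      moreover have "finite (\<Union>S\<in>\<S>. US S)"
        using \<S>(1) fin(2) by (auto simp: US_def)
      ultimately have "card U \<le> card (\<Union>S\<in>\<S>. US S)"
        by (intro card_mono)
      also have "\<dots> \<le> (\<Sum>S\<in>\<S>. card (US S))"
        by (rule card_UN_le[OF \<S>(1)])
      also have "\<dots> \<le> card \<S> * (c1 * (n + 1) ^ D)"
        using sum_bounded_above[of \<S> "\<lambda>S. card (US S)", OF US] by simp
      also have "\<dots> \<le> (m * n + 1) * (c1 * (n + 1) ^ D)"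
        using \<S>(2) by (rule mult_le_mono1)
      also have "\<dots> \<le> (m * (n + 1)) * (c1 * (n + 1) ^ D)"
        using m by (intro mult_le_mono1) simp
      also have "\<dots> = c1 * m * (n + 1) ^ (D + 1)"
        by (simp only: power_add power_one_right mult_ac)
      finally have "real (card U) \<le> real (c1 * m * (n + 1) ^ (D + 1))"
        by (simp only: of_nat_le_iff)
      also have "\<dots> = real c1 * real m * (real n + 1) ^ (D + 1)"
        by (simp only: of_nat_mult of_nat_power of_nat_add of_nat_1)
      also have "\<dots> \<le> real c1 * real m * ((C3 + 1) * real m powr \<epsilon>') ^ (D + 1)"
      proof (intro mult_left_mono power_mono)
        have "1 \<le> real m powr \<epsilon>'"
          using ge_one_powr_ge_zero[of "real m" \<epsilon>'] m1 \<epsilon>' by simp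
        then show "real n + 1 \<le> (C3 + 1) * real m powr \<epsilon>'"
          using nb by (simp add: distrib_right)
      qed auto
      also have "\<dots> = real c1 * (C3 + 1) ^ (D + 1) * (real m * (real m powr \<epsilon>') ^ (D + 1))"
        by (simp only: power_mult_distrib mult_ac)
      also have "real m * (real m powr \<epsilon>') ^ (D + 1) = real m powr (1 + \<epsilon>' * (D + 1))"
        using m1 by (simp add: powr_add powr_powr distrib_left flip: powr_realpow)
      also have "real c1 * (C3 + 1) ^ (D + 1) * real m powr (1 + \<epsilon>' * (D + 1)) \<le>
          real c1 * (C3 + 1) ^ (D + 1) * real m powr (1 + \<epsilon>)"
        using \<epsilon>'(3) m1 C3 by (intro mult_left_mono powr_mono) auto
      also have "\<dots> \<le> c * real m powr (1 + \<epsilon>)"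
        using C3 by (intro mult_right_mono) (auto simp: c_def)
      finally show ?thesis
        by (simp add: m_def)
    next
      case False
      \<comment> \<open>The kernels only certify separators of size at most m. If n exceeds m, then
        \<epsilon>' \<le> 1/2 forces m to be bounded by a constant, and the crude bound on U is a
        constant too.\<close>
      then have "real m < C3 * real m powr \<epsilon>'"
        using nb by simp
      also have "\<dots> \<le> C3 * real m powr (1/2)"
        using \<epsilon>' m1 C3 by (intro mult_left_mono powr_mono) auto
      finally have "sqrt (real m) * sqrt (real m) < C3 * sqrt (real m)"
        by (simp add: powr_half_sqrt)
      then have "sqrt (real m) < C3"
        by (rule mult_right_less_imp_less) simp
      then have "(sqrt (real m))\<^sup>2 \<le> C3\<^sup>2"
        by (intro power_mono) auto
      then have mC: "real m \<le> C3\<^sup>2"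
        by simp
      have "real (card U) \<le> real c1 * (real m + 1) ^ D"
        using cU of_nat_le_iff[where 'a = real, of "card U" "c1 * (m + 1) ^ D"] by (simp add: add.commute)
      also have "\<dots> \<le> real c1 * (C3\<^sup>2 + 1) ^ D"
        using mC by (intro mult_left_mono power_mono) auto
      also have "\<dots> \<le> c * 1"
        using C3 by (simp add: c_def)
      also have "\<dots> \<le> c * real m powr (1 + \<epsilon>)"
        using p1 C3 by (intro mult_left_mono) (auto simp: c_def)
      finally show ?thesis
        by (simp add: m_def)
    qed
  qed
qed

subsection \<open>Orders with low crossing number\<close>

fun crossings :: "('a \<Rightarrow> bool) \<Rightarrow> 'a list \<Rightarrow> nat" where
  "crossings P (x # y # zs) = (if P x \<noteq> P y then 1 else 0) + crossings P (y # zs)"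
| "crossings P _ = 0"

lemma crossings_append: "crossings P (xs @ x # ys) = crossings P (xs @ [x]) + crossings P (x # ys)"
proof (induction xs)
  case (Cons a xs)
  then show ?case by (cases xs) auto
qed simp

text \<open>Inserting x directly behind y is free for a set that does not distinguish x from y, and
  costs two crossings otherwise.\<close>

lemma crossings_insert:
  "crossings P (xs @ y # x # zs) \<le> crossings P (xs @ y # zs) + (if P x \<noteq> P y then 2 else 0)"
proof -
  have "crossings P (y # x # zs) \<le> crossings P (y # zs) + (if P x \<noteq> P y then 2 else 0)"
    by (cases zs) auto
  then show ?thesis
    by (simp only: crossings_append[of P xs y "x # zs"] crossings_append[of P xs y zs])
qed

lemma crossings_pos:
  assumes "x \<in> set l" "y \<in> set l" "P x" "\<not> P y"
  shows "crossings P l \<ge> 1"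
proof (rule ccontr)
  assume "\<not> ?thesis"
  then have "crossings P l = 0" by simp
  then have "\<forall>v\<in>set l. P v = P (hd l)"
    by (induction P l rule: crossings.induct) (auto split: if_splits)
  then show False
    using assms by blast
qed

text \<open>Every maximal prefix covered by one centre is left by each set that meets it, which costs a
  crossing.\<close>
lemma interval_partition:
  assumes "\<And>v. v \<in> V \<Longrightarrow> \<rho> v v" "set l \<subseteq> V"
  shows "\<exists>parts. concat parts = l \<and> (\<forall>p\<in>set parts. \<exists>c\<in>V. \<forall>v\<in>set p. \<rho> c v) \<and>
    (\<forall>u\<in>V. length (filter (\<lambda>p. \<exists>v\<in>set p. \<rho> u v) parts) \<le> crossings (\<rho> u) l + 1)"
  using assms(2)
proof (induction "length l" arbitrary: l rule: less_induct)
  case less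
  show ?case
  proof (cases "l = []")
    case True
    then show ?thesis by (intro exI[of _ "[]"]) auto
  next
    case False
    define ok where "ok n \<longleftrightarrow> n \<le> length l \<and> (\<exists>c\<in>V. \<forall>v\<in>set (take n l). \<rho> c v)" for n
    have "hd l \<in> V"
      using less.prems False by auto
    then have ok1: "ok 1"
      using assms(1) False by (cases l) (auto simp: ok_def)
    define n where "n = Max (Collect ok)"
    have fin: "finite (Collect ok)"
      by (rule finite_subset[of _ "{..length l}"]) (auto simp: ok_def)
    have n: "ok n" and max: "\<And>k. ok k \<Longrightarrow> k \<le> n"
      using Max_in[OF fin] Max_ge[OF fin] ok1 by (auto simp: n_def)
    have n1: "n \<ge> 1"
      using max ok1 by blast
    have len: "length (drop n l) < length l"
      using n1 False by (cases l) auto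
    have "set (drop n l) \<subseteq> V"
      using less.prems set_drop_subset by fast
    from less.hyps[OF len this] obtain parts where parts: "concat parts = drop n l"
      "\<forall>p\<in>set parts. \<exists>c\<in>V. \<forall>v\<in>set p. \<rho> c v"
      "\<forall>u\<in>V. length (filter (\<lambda>p. \<exists>v\<in>set p. \<rho> u v) parts) \<le> crossings (\<rho> u) (drop n l) + 1"
      by blast
    define p where "p = take n l"
    have "length (filter (\<lambda>p. \<exists>v\<in>set p. \<rho> u v) (p # parts)) \<le> crossings (\<rho> u) l + 1" if u: "u \<in> V" for u
    proof (cases "drop n l")
      case Nil
      \<comment> \<open>\<open>p\<close> ends the list, so no crossing pays for it; it is covered by
        the summand 1.\<close>
      then have "\<forall>p\<in>set parts. p = []"
        using parts(1) by simp
      then have "filter (\<lambda>p. \<exists>v\<in>set p. \<rho> u v) parts = []"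
        by (auto simp: filter_empty_conv)
      then show ?thesis by simp
    next
      case (Cons h t)
      have l: "l = p @ h # t"
        using append_take_drop_id[of n l] Cons by (simp add: p_def)
      have split: "crossings (\<rho> u) l = crossings (\<rho> u) (p @ [h]) + crossings (\<rho> u) (h # t)"
        unfolding l by (rule crossings_append)
      have IH: "length (filter (\<lambda>p. \<exists>v\<in>set p. \<rho> u v) parts) \<le> crossings (\<rho> u) (h # t) + 1"
        using parts(3) u Cons by auto
      show ?thesis
      proof (cases "\<exists>v\<in>set p. \<rho> u v")
        case True
        then obtain v where v: "v \<in> set p" "\<rho> u v" by blast
        have "n < length l"
          using Cons by (metis drop_all linorder_not_less list.distinct(1))
        then have "take (Suc n) l = p @ [h]"
          using Cons by (simp add: p_def take_Suc_conv_app_nth hd_drop_conv_nth[symmetric])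
        moreover have "\<not> ok (Suc n)"
          using max[of "Suc n"] by auto
        \<comment> \<open>Maximality is applied with u itself as the centre: the set of u cannot
          contain all of \<open>p @ [h]\<close>.\<close>
        ultimately have "\<exists>v'\<in>set (p @ [h]). \<not> \<rho> u v'"
          using u \<open>n < length l\<close> unfolding ok_def by (metis Suc_leI)
        then have "crossings (\<rho> u) (p @ [h]) \<ge> 1"
          using v crossings_pos[of v "p @ [h]" _ "\<rho> u"] by auto
        then show ?thesis
          using split IH by simp
      next
        case False
        then show ?thesis
          using split IH by auto
      qed
    qed
    moreover have "\<exists>c\<in>V. \<forall>v\<in>set p. \<rho> c v"
      using n by (simp add: ok_def p_def)
    moreover have "concat (p # parts) = l"
      using parts(1) by (simp add: p_def)
    ultimately show ?thesis
      using parts(2) by (intro exI[of _ "p # parts"]) auto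
  qed
qed

section \<open>Balls, and covers obtained from orders\<close>

lemma ball_subset: "ball G v r \<subseteq> verts G"
  by (auto simp: ball_def walk_def)

lemma ball_refl: "v \<in> verts G \<Longrightarrow> v \<in> ball G v r"
  by (auto simp: ball_def walk_def intro!: exI[of _ "[v]"])

lemma ball_sym: "wf_graph G \<Longrightarrow> v \<in> ball G u r \<Longrightarrow> u \<in> ball G v r"
proof -
  assume wf: "wf_graph G" and "v \<in> ball G u r"
  then obtain xs where "walk G xs" "hd xs = u" "last xs = v" "length xs \<le> r + 1"
    by (auto simp: ball_def)
  then show "u \<in> ball G v r"
    unfolding ball_def using walk_rev[OF wf, of xs]
    by (intro CollectI exI[of _ "rev xs"]) (auto simp: walk_def hd_rev last_rev)
qed

lemma ball_mono: "r \<le> r' \<Longrightarrow> ball G v r \<subseteq> ball G v r'"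
  unfolding ball_def by (auto intro: order_trans)

lemma ball_trans: "v \<in> ball G u r \<Longrightarrow> w \<in> ball G v s \<Longrightarrow> w \<in> ball G u (r + s)"
proof -
  assume "v \<in> ball G u r" "w \<in> ball G v s"
  then obtain xs ys where xs: "walk G xs" "hd xs = u" "last xs = v" "length xs \<le> r + 1"
    and ys: "walk G ys" "hd ys = v" "last ys = w" "length ys \<le> s + 1"
    by (auto simp: ball_def)
  obtain t where t: "ys = v # t"
    using ys(1,2) by (cases ys) (auto simp: walk_def)
  have "walk G (xs @ t)"
    using xs ys(1) unfolding t walk_def by (auto simp: successively_append_iff successively_Cons)
  moreover have "hd (xs @ t) = u" "last (xs @ t) = w"
    using xs ys(3) t by (auto simp: walk_def last_append)
  moreover have "length (xs @ t) \<le> r + s + 1"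
    using xs ys t by simp
  ultimately show "w \<in> ball G u (r + s)"
    unfolding ball_def by blast
qed

text \<open>By symmetry of balls, v lies in the cluster of a part exactly if its own ball meets that
  part, so the degree is controlled by the crossings of the ball of v.\<close>

lemma cover_from_order:
  assumes wf: "wf_graph G" and l: "set l = verts G" and s: "2 * r \<le> s"
    and k: "\<And>u. u \<in> verts G \<Longrightarrow> real (crossings (\<lambda>v. v \<in> ball G u r) l) + 1 \<le> k"
  shows "\<exists>X. weak_nbhd_cover G r k s X"
proof -
  obtain parts where parts: "concat parts = l"
    "\<And>p. p \<in> set parts \<Longrightarrow> \<exists>c\<in>verts G. \<forall>v\<in>set p. v \<in> ball G c r"
    "\<And>u. u \<in> verts G \<Longrightarrow> length (filter (\<lambda>p. \<exists>v\<in>set p. v \<in> ball G u r) parts) \<le>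
       crossings (\<lambda>v. v \<in> ball G u r) l + 1"
    using interval_partition[of "verts G" "\<lambda>u v. v \<in> ball G u r" l] ball_refl[of _ G r] l by auto
  define cl where "cl p = (\<Union>x\<in>set p. ball G x r)" for p
  have "weak_nbhd_cover G r k s (cl ` set parts)"
    unfolding weak_nbhd_cover_def
  proof (intro conjI ballI)
    fix S assume "S \<in> cl ` set parts"
    then obtain p where p: "p \<in> set parts" "S = cl p" by blast
    obtain c where c: "c \<in> verts G" "\<forall>v\<in>set p. v \<in> ball G c r"
      using parts(2)[OF p(1)] by blast
    have "cl p \<subseteq> ball G c (r + r)"
      using c(2) ball_trans[of _ G c r _ r] by (auto simp: cl_def)
    then show "\<exists>c\<in>verts G. S \<subseteq> ball G c s"
      using ball_mono[of "r + r" s G c] s c(1) p(2) by auto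
  next
    fix w assume "w \<in> verts G"
    then have "w \<in> (\<Union>p\<in>set parts. set p)"
      using l parts(1) by auto
    then obtain p where "p \<in> set parts" "w \<in> set p"
      by blast
    then show "\<exists>S\<in>cl ` set parts. ball G w r \<subseteq> S"
      by (auto simp: cl_def)
  next
    fix v assume v: "v \<in> verts G"
    have "{S \<in> cl ` set parts. v \<in> S} \<subseteq> cl ` set (filter (\<lambda>p. \<exists>x\<in>set p. x \<in> ball G v r) parts)"
      using ball_sym[OF wf] by (auto simp: cl_def) blast
    then have "card {S \<in> cl ` set parts. v \<in> S} \<le> card (cl ` set (filter (\<lambda>p. \<exists>x\<in>set p. x \<in> ball G v r) parts))"
      by (intro card_mono) auto
    also have "\<dots> \<le> card (set (filter (\<lambda>p. \<exists>x\<in>set p. x \<in> ball G v r) parts))"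
      by (rule card_image_le) simp
    also have "\<dots> \<le> length (filter (\<lambda>p. \<exists>x\<in>set p. x \<in> ball G v r) parts)"
      by (rule card_length)
    also have "\<dots> \<le> crossings (\<lambda>x. x \<in> ball G v r) l + 1"
      by (rule parts(3)[OF v])
    finally show "real (card {S \<in> cl ` set parts. v \<in> S}) \<le> k"
      using k[OF v] by linarith
  qed
  then show ?thesis by blast
qed

text \<open>By weighted averaging some u distinguishes a fraction \<delta> of the pairs still
  undistinguished. Starting from at most |X|^2 ordered pairs, each choice leaves a fraction of at
  most 1 - \<delta>.\<close>

lemma greedy_separation:
  fixes w :: "'b \<Rightarrow> real" and \<rho> :: "'b \<Rightarrow> 'a \<Rightarrow> bool"
  assumes U: "finite U" "U \<noteq> {}" "\<And>u. u \<in> U \<Longrightarrow> w u > 0" and X: "finite X" and \<delta>: "\<delta> \<le> 1"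
    and sep: "\<And>x y. x \<in> X \<Longrightarrow> y \<in> X \<Longrightarrow> x \<noteq> y \<Longrightarrow> \<delta> * sum w U \<le> sum w {u \<in> U. \<rho> u x \<noteq> \<rho> u y}"
  shows "\<exists>A\<subseteq>U. card A \<le> t \<and>
    real (card {(x, y). x \<in> X \<and> y \<in> X \<and> x \<noteq> y \<and> (\<forall>a\<in>A. \<rho> a x = \<rho> a y)}) \<le> (real (card X))\<^sup>2 * (1 - \<delta>) ^ t"
proof (induction t)
  case 0
  have "card {(x, y). x \<in> X \<and> y \<in> X \<and> x \<noteq> y} \<le> card (X \<times> X)"
    using X by (intro card_mono) auto
  then have "card {(x, y). x \<in> X \<and> y \<in> X \<and> x \<noteq> y} \<le> (card X)\<^sup>2"
    by (simp add: card_cartesian_product power2_eq_square)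
  then have "real (card {(x, y). x \<in> X \<and> y \<in> X \<and> x \<noteq> y}) \<le> real ((card X)\<^sup>2)"
    by (simp only: of_nat_le_iff)
  then show ?case
    by (intro exI[of _ "{}"]) simp
next
  case (Suc t)
  then obtain A where A: "A \<subseteq> U" "card A \<le> t"
    "real (card {(x, y). x \<in> X \<and> y \<in> X \<and> x \<noteq> y \<and> (\<forall>a\<in>A. \<rho> a x = \<rho> a y)}) \<le> (real (card X))\<^sup>2 * (1 - \<delta>) ^ t"
    by blast
  define P where "P = {(x, y). x \<in> X \<and> y \<in> X \<and> x \<noteq> y \<and> (\<forall>a\<in>A. \<rho> a x = \<rho> a y)}"
  have finP: "finite P"
    by (rule finite_subset[of _ "X \<times> X"]) (auto simp: P_def X)
  define f where "f u = {p \<in> P. \<rho> u (fst p) \<noteq> \<rho> u (snd p)}" for u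
  have "\<exists>u\<in>U. \<delta> * card P \<le> card (f u)"
  proof (rule ccontr)
    assume "\<not> ?thesis"
    then have *: "real (card (f u)) < \<delta> * card P" if "u \<in> U" for u
      using that by (meson not_le)
    have "(\<Sum>u\<in>U. w u * real (card (f u))) < (\<Sum>u\<in>U. w u * (\<delta> * card P))"
      using U * by (intro sum_strict_mono mult_strict_left_mono) auto
    also have "\<dots> = (\<Sum>p\<in>P. \<delta> * sum w U)"
      by (simp add: sum_distrib_right[symmetric])
    also have "\<dots> \<le> (\<Sum>p\<in>P. sum w {u \<in> U. \<rho> u (fst p) \<noteq> \<rho> u (snd p)})"
      using sep by (intro sum_mono) (auto simp: P_def)
    also have "\<dots> = (\<Sum>p\<in>P. \<Sum>u\<in>U. if \<rho> u (fst p) \<noteq> \<rho> u (snd p) then w u else 0)"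
      by (rule sum.cong[OF refl]) (simp only: sum.inter_filter[OF U(1)])
    also have "\<dots> = (\<Sum>u\<in>U. \<Sum>p\<in>P. if \<rho> u (fst p) \<noteq> \<rho> u (snd p) then w u else 0)"
      by (rule sum.swap)
    also have "\<dots> = (\<Sum>u\<in>U. w u * real (card (f u)))"
    proof (rule sum.cong)
      fix u
      have "(\<Sum>p\<in>P. if \<rho> u (fst p) \<noteq> \<rho> u (snd p) then w u else 0) = (\<Sum>p\<in>f u. w u)"
        unfolding f_def using finP by (simp only: sum.inter_filter)
      then show "(\<Sum>p\<in>P. if \<rho> u (fst p) \<noteq> \<rho> u (snd p) then w u else 0) = w u * real (card (f u))"
        by simp
    qed simp
    finally show False by simp
  qed
  then obtain u where u: "u \<in> U" "\<delta> * card P \<le> card (f u)" by blast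
  have eq: "{(x, y). x \<in> X \<and> y \<in> X \<and> x \<noteq> y \<and> (\<forall>a\<in>insert u A. \<rho> a x = \<rho> a y)} = P - f u"
    by (auto simp: P_def f_def)
  have "real (card (P - f u)) = real (card P) - real (card (f u))"
    using card_mono[of P "f u"] finP by (subst card_Diff_subset) (auto simp: f_def of_nat_diff)
  also have "\<dots> \<le> (1 - \<delta>) * card P"
    using u(2) by (simp add: left_diff_distrib)
  also have "\<dots> \<le> (1 - \<delta>) * ((real (card X))\<^sup>2 * (1 - \<delta>) ^ t)"
    using A(3) \<delta> unfolding P_def by (intro mult_left_mono) auto
  finally have "real (card (P - f u)) \<le> (real (card X))\<^sup>2 * (1 - \<delta>) ^ Suc t"
    by (simp add: mult_ac)
  moreover have "card (insert u A) \<le> Suc t"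
    using A(2) card_insert_le_m1[of "Suc t" A u] by simp
  ultimately show ?case
    using u(1) A(1) eq by (intro exI[of _ "insert u A"]) simp
qed

text \<open>A bound on the dual shatter function of the sets \<open>\<rho> u\<close>: X picks
  representatives of different cells in the Venn diagram of the sets indexed by A.\<close>

definition low_shatter :: "real \<Rightarrow> real \<Rightarrow> 'a set \<Rightarrow> ('a \<Rightarrow> 'a \<Rightarrow> bool) \<Rightarrow> bool" where
  "low_shatter c \<epsilon> U \<rho> \<longleftrightarrow> (\<forall>A X. A \<subseteq> U \<longrightarrow> A \<noteq> {} \<longrightarrow> X \<subseteq> U \<longrightarrow>
     (\<forall>x\<in>X. \<forall>y\<in>X. x \<noteq> y \<longrightarrow> (\<exists>a\<in>A. \<rho> a x \<noteq> \<rho> a y)) \<longrightarrow> real (card X) \<le> c * real (card A) powr (1 + \<epsilon>))"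

text \<open>If every pair were distinguished by a fraction \<delta> of the weight, about 2 ln |X| /
  \<delta> sets would distinguish all of X, contradicting \<open>low_shatter\<close>. In \<delta>,
  the term 4/\<beta> comes from bounding the logarithm by a power with exponent \<beta>/2, the 2
  from rounding, and c + 1 strictly beats the constant c.\<close>

lemma close_pair:
  fixes w :: "'a \<Rightarrow> real"
  assumes U: "finite U" "\<And>u. u \<in> U \<Longrightarrow> w u > 0" and X: "X \<subseteq> U" "card X \<ge> 2"
    and \<beta>: "0 < \<beta>" "\<beta> < 1" and c: "c \<ge> 0" and ls: "low_shatter c (\<beta> / 2) U \<rho>"
    and \<delta>: "\<delta> = (4 / \<beta> + 2) * (c + 1) * real (card X) powr (\<beta> - 1)"
  shows "\<exists>x\<in>X. \<exists>y\<in>X. x \<noteq> y \<and> sum w {u \<in> U. \<rho> u x \<noteq> \<rho> u y} \<le> \<delta> * sum w U"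
proof (cases "\<delta> < 1")
  case False
  obtain x y where xy: "x \<in> X" "y \<in> X" "x \<noteq> y"
    using X(2) card_le_Suc0_iff_eq[of X] finite_subset[OF X(1) U(1)] by fastforce
  have W: "0 \<le> sum w U"
    using U(2) by (intro sum_nonneg) (simp add: less_imp_le)
  have "sum w {u \<in> U. \<rho> u x \<noteq> \<rho> u y} \<le> sum w U"
    using U by (intro sum_mono2) (auto simp: less_imp_le)
  also have "\<dots> \<le> \<delta> * sum w U"
    using False W mult_right_mono[of 1 \<delta> "sum w U"] by simp
  finally show ?thesis
    using xy by blast
next
  case True
  define i where "i = real (card X)"
  define C where "C = (4 / \<beta> + 2) * (c + 1)"
  have i: "i \<ge> 2"
    using X(2) by (simp add: i_def)
  have C: "C > 0"
    using \<beta> c by (simp add: C_def add_pos_nonneg)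
  have \<delta>0: "\<delta> > 0" and \<delta>i: "\<delta> = C * i powr (\<beta> - 1)"
    using C i by (auto simp: \<delta> C_def i_def)
  \<comment> \<open>Large enough that i^2 * (1 - \<delta>)^t < 1, so no undistinguished pair is
    left.\<close>
  define t where "t = nat \<lceil>2 * ln i / \<delta>\<rceil> + 1"
  have lni: "ln i > 0"
    using i by simp
  have t1: "2 * ln i / \<delta> + 1 \<le> real t"
  proof -
    have "2 * ln i / \<delta> \<le> real (nat \<lceil>2 * ln i / \<delta>\<rceil>)"
      by (rule real_nat_ceiling_ge)
    then show ?thesis by (simp add: t_def)
  qed
  have t2: "real t \<le> 2 * ln i / \<delta> + 2"
  proof -
    have "0 \<le> 2 * ln i / \<delta>"
      using lni \<delta>0 by simp
    then show ?thesis
      unfolding t_def by (simp, linarith)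
  qed
  have "2 * ln i < \<delta> * real t"
    using t1 \<delta>0 by (simp add: field_simps)
  have small: "i\<^sup>2 * (1 - \<delta>) ^ t < 1"
  proof -
    have "(1 - \<delta>) ^ t \<le> exp (- \<delta>) ^ t"
      using True exp_ge_add_one_self[of "- \<delta>"] by (intro power_mono) auto
    also have "\<dots> = exp (- (\<delta> * real t))"
      by (simp add: exp_of_nat_mult[symmetric] mult.commute)
    also have "\<dots> < exp (- (2 * ln i))"
      using \<open>2 * ln i < \<delta> * real t\<close> by simp
    also have "\<dots> = 1 / i\<^sup>2"
    proof -
      have "exp (2 * ln i) = i\<^sup>2"
        using i by (simp add: exp_double)
      then show ?thesis
        by (simp add: exp_minus inverse_eq_divide)
    qed
    finally show ?thesis
      using i by (simp add: field_simps)
  qed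
  \<comment> \<open>The choice of \<delta> gives t \<le> i^(1 - \<beta>/2) / (c + 1), and (1 -
    \<beta>/2) * (1 + \<beta>/2) \<le> 1.\<close>
  have few: "c * real t powr (1 + \<beta> / 2) < i"
  proof -
    have "i powr (\<beta> - 1) * i powr (1 - \<beta>) = 1"
      using i by (simp flip: powr_add)
    moreover have "C * i powr (\<beta> - 1) < 1"
      using True \<delta>i by simp
    ultimately have Ci: "C < i powr (1 - \<beta>)"
      using i mult_strict_right_mono[of "C * i powr (\<beta> - 1)" 1 "i powr (1 - \<beta>)"] by (simp add: mult.assoc)
    have inv: "1 / \<delta> = i powr (1 - \<beta>) / C"
      using i C unfolding \<delta>i by (simp add: powr_diff field_simps)
    have "ln i \<le> i powr (\<beta> / 2) / (\<beta> / 2)"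
      using i \<beta> by (intro ln_powr_bound) auto
    then have "2 * ln i * (1 / \<delta>) \<le> (4 / \<beta>) * i powr (\<beta> / 2) * (1 / \<delta>)"
      using \<delta>0 by (intro mult_right_mono) (auto simp: field_simps)
    also have "\<dots> = (4 / \<beta>) / C * (i powr (\<beta> / 2) * i powr (1 - \<beta>))"
      unfolding inv by simp
    also have "i powr (\<beta> / 2) * i powr (1 - \<beta>) = i powr (1 - \<beta> / 2)"
      by (simp flip: powr_add)
    finally have 1: "2 * ln i / \<delta> \<le> (4 / \<beta>) / C * i powr (1 - \<beta> / 2)"
      by simp
    have "i powr (1 - \<beta>) \<le> i powr (1 - \<beta> / 2)"
      using i \<beta> by (intro powr_mono) auto
    then have "C \<le> i powr (1 - \<beta> / 2)"
      using Ci by simp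
    then have 2: "2 \<le> 2 / C * i powr (1 - \<beta> / 2)"
      using C by (simp add: field_simps)
    have "real t \<le> (4 / \<beta>) / C * i powr (1 - \<beta> / 2) + 2 / C * i powr (1 - \<beta> / 2)"
      using t2 1 2 by linarith
    also have "\<dots> = (4 / \<beta> + 2) / C * i powr (1 - \<beta> / 2)"
      by (simp add: add_divide_distrib distrib_right)
    also have "(4 / \<beta> + 2) / C = 1 / (c + 1)"
    proof -
      have "4 / \<beta> + 2 \<noteq> 0"
        using \<beta> by (simp add: add_pos_pos less_imp_neq[symmetric])
      then show ?thesis
        by (simp add: C_def)
    qed
    finally have "real t powr (1 + \<beta> / 2) \<le> (1 / (c + 1) * i powr (1 - \<beta> / 2)) powr (1 + \<beta> / 2)"
      using \<beta> by (intro powr_mono2) auto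
    also have "\<dots> = (1 / (c + 1)) powr (1 + \<beta> / 2) * i powr ((1 - \<beta> / 2) * (1 + \<beta> / 2))"
      using c by (subst powr_mult) (simp_all add: powr_powr)
    also have "\<dots> \<le> (1 / (c + 1)) * i"
    proof (intro mult_mono)
      show "(1 / (c + 1)) powr (1 + \<beta> / 2) \<le> 1 / (c + 1)"
        using powr_mono'[of 1 "1 + \<beta> / 2" "1 / (c + 1)"] c \<beta> by simp
      have "(1 - \<beta> / 2) * (1 + \<beta> / 2) \<le> 1"
        by (simp add: algebra_simps)
      then show "i powr ((1 - \<beta> / 2) * (1 + \<beta> / 2)) \<le> i"
        using powr_mono[of "(1 - \<beta> / 2) * (1 + \<beta> / 2)" 1 i] i by simp
    qed (use c in auto)
    finally have "c * real t powr (1 + \<beta> / 2) \<le> c * ((1 / (c + 1)) * i)"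
      using c by (intro mult_left_mono)
    also have "\<dots> < i"
      using c i by (simp add: field_simps)
    finally show ?thesis .
  qed
  show ?thesis
  proof (rule ccontr)
    assume "\<not> ?thesis"
    then have far: "\<delta> * sum w U \<le> sum w {u \<in> U. \<rho> u x \<noteq> \<rho> u y}" if "x \<in> X" "y \<in> X" "x \<noteq> y" for x y
      using that by (meson le_cases)
    have finX: "finite X"
      using X(1) U(1) finite_subset by blast
    have "U \<noteq> {}"
      using X by auto
    then obtain A where A: "A \<subseteq> U" "card A \<le> t"
      "real (card {(x, y). x \<in> X \<and> y \<in> X \<and> x \<noteq> y \<and> (\<forall>a\<in>A. \<rho> a x = \<rho> a y)}) \<le> (real (card X))\<^sup>2 * (1 - \<delta>) ^ t"
      using greedy_separation[of U w X \<delta> \<rho> t] U finX True far by auto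
    then have "card {(x, y). x \<in> X \<and> y \<in> X \<and> x \<noteq> y \<and> (\<forall>a\<in>A. \<rho> a x = \<rho> a y)} = 0"
      using small by (simp add: i_def)
    moreover have "finite {(x, y). x \<in> X \<and> y \<in> X \<and> x \<noteq> y \<and> (\<forall>a\<in>A. \<rho> a x = \<rho> a y)}"
      by (rule finite_subset[of _ "X \<times> X"]) (auto simp: finX)
    ultimately have sep: "\<forall>x\<in>X. \<forall>y\<in>X. x \<noteq> y \<longrightarrow> (\<exists>a\<in>A. \<rho> a x \<noteq> \<rho> a y)"
      by auto
    obtain x y where "x \<in> X" "y \<in> X" "x \<noteq> y"
      using X(2) card_le_Suc0_iff_eq[of X] finX by fastforce
    then have "A \<noteq> {}"
      using sep by blast
    then have "i \<le> c * real (card A) powr (1 + \<beta> / 2)"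
      using ls A(1) X(1) sep unfolding low_shatter_def i_def by blast
    also have "\<dots> \<le> c * real t powr (1 + \<beta> / 2)"
      using A(2) c \<beta> by (intro mult_left_mono powr_mono2) auto
    finally show False
      using few by simp
  qed
qed

text \<open>Welzl's scheme: take a close pair x, y, double the weight of each u that distinguishes
  it, order the rest with the new weights, and insert x behind y. \<open>\<kappa> u\<close> counts
  the doublings for u, each worth at most two crossings, while the total weight grows only by the
  factor 1 + \<delta> per step.\<close>

lemma reweighted_order:
  fixes w :: "'a \<Rightarrow> real"
  assumes U: "finite U" and \<beta>: "0 < \<beta>" "\<beta> < 1" and c: "c \<ge> 0" and ls: "low_shatter c (\<beta> / 2) U \<rho>"
    and \<delta>: "\<And>i. \<delta> i = (4 / \<beta> + 2) * (c + 1) * real i powr (\<beta> - 1)"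
    and "card X = n" "X \<subseteq> U" "\<And>u. u \<in> U \<Longrightarrow> w u > 0"
  shows "\<exists>l \<kappa>. set l = X \<and> (\<forall>u\<in>U. crossings (\<rho> u) l \<le> 2 * \<kappa> u) \<and>
    (\<Sum>u\<in>U. w u * 2 ^ \<kappa> u) \<le> sum w U * (\<Prod>i=1..n. 1 + \<delta> i)"
  using assms(7-)
proof (induction n arbitrary: X w)
  case 0
  have "X = {}"
    using 0 finite_subset[OF _ U] by auto
  then show ?case
    by (intro exI[of _ "[]"] exI[of _ "\<lambda>_. 0"]) auto
next
  case (Suc n)
  have finX: "finite X"
    using Suc.prems(2) U finite_subset by blast
  have \<delta>0: "\<delta> i \<ge> 0" for i
    using \<beta> c by (simp add: \<delta>)
  have W0: "sum w U \<ge> 0"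
    using Suc.prems(3) by (intro sum_nonneg) (simp add: less_imp_le)
  show ?case
  proof (cases "n = 0")
    case True
    then obtain x where "X = {x}"
      using Suc.prems(1) card_1_singletonE by auto
    then show ?thesis
      using True \<delta>0 W0 by (intro exI[of _ "[x]"] exI[of _ "\<lambda>_. 0"]) (auto simp: distrib_left)
  next
    case False
    have "\<delta> (Suc n) = (4 / \<beta> + 2) * (c + 1) * real (card X) powr (\<beta> - 1)" "card X \<ge> 2"
      using Suc.prems(1) False by (simp_all add: \<delta>)
    then have "\<exists>x\<in>X. \<exists>y\<in>X. x \<noteq> y \<and> sum w {u \<in> U. \<rho> u x \<noteq> \<rho> u y} \<le> \<delta> (Suc n) * sum w U"
      by (intro close_pair[where w = w, OF U Suc.prems(3,2) _ \<beta> c ls])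
    then obtain x y where xy: "x \<in> X" "y \<in> X" "x \<noteq> y"
      "sum w {u \<in> U. \<rho> u x \<noteq> \<rho> u y} \<le> \<delta> (Suc n) * sum w U"
      by blast
    define s where "s u = (if \<rho> u x \<noteq> \<rho> u y then 1 else 0 :: nat)" for u
    define w' where "w' u = w u * 2 ^ s u" for u
    have w': "sum w' U \<le> sum w U * (1 + \<delta> (Suc n))"
    proof -
      have "sum w' U = (\<Sum>u\<in>U. w u + (if \<rho> u x \<noteq> \<rho> u y then w u else 0))"
        by (intro sum.cong) (auto simp: w'_def s_def)
      also have "\<dots> = sum w U + sum w {u \<in> U. \<rho> u x \<noteq> \<rho> u y}"
        using U by (simp only: sum.distrib sum.inter_filter)
      finally show ?thesis
        using xy(4) by (simp add: distrib_left mult.commute)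
    qed
    have "card (X - {x}) = n" "X - {x} \<subseteq> U" "\<And>u. u \<in> U \<Longrightarrow> w' u > 0"
      using Suc.prems xy(1) finX by (auto simp: w'_def)
    from Suc.IH[of "X - {x}" w', OF this] obtain l \<kappa> where l: "set l = X - {x}" "\<forall>u\<in>U. crossings (\<rho> u) l \<le> 2 * \<kappa> u"
      "(\<Sum>u\<in>U. w' u * 2 ^ \<kappa> u) \<le> sum w' U * (\<Prod>i=1..n. 1 + \<delta> i)"
      by blast
    have "y \<in> set l"
      using l(1) xy by simp
    then obtain as bs where ab: "l = as @ y # bs"
      using split_list by metis
    have "set (as @ y # x # bs) = X"
      using l(1) xy(1) ab by auto
    moreover have "\<forall>u\<in>U. crossings (\<rho> u) (as @ y # x # bs) \<le> 2 * (\<kappa> u + s u)"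
    proof
      fix u assume "u \<in> U"
      then show "crossings (\<rho> u) (as @ y # x # bs) \<le> 2 * (\<kappa> u + s u)"
        using crossings_insert[of "\<rho> u" as y x bs] l(2) ab by (auto simp: s_def split: if_splits)
    qed
    moreover have "(\<Sum>u\<in>U. w u * 2 ^ (\<kappa> u + s u)) \<le> sum w U * (\<Prod>i=1..Suc n. 1 + \<delta> i)"
    proof -
      have "(\<Sum>u\<in>U. w u * 2 ^ (\<kappa> u + s u)) = (\<Sum>u\<in>U. w' u * 2 ^ \<kappa> u)"
        by (simp add: w'_def power_add mult_ac)
      also have "\<dots> \<le> sum w' U * (\<Prod>i=1..n. 1 + \<delta> i)"
        by (rule l(3))
      also have "\<dots> \<le> (sum w U * (1 + \<delta> (Suc n))) * (\<Prod>i=1..n. 1 + \<delta> i)"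
        using w' \<delta>0 by (intro mult_right_mono prod_nonneg) (auto simp: add_nonneg_nonneg)
      also have "\<dots> = sum w U * (\<Prod>i=1..Suc n. 1 + \<delta> i)"
        by (simp add: mult_ac)
      finally show ?thesis .
    qed
    ultimately show ?thesis
      by (intro exI[of _ "as @ y # x # bs"] exI[of _ "\<lambda>u. \<kappa> u + s u"]) simp
  qed
qed

text \<open>Comparison with the integral of x^(\<beta> - 1), term by term through the mean value
  theorem.\<close>

lemma sum_powr_le:
  fixes \<beta> :: real
  assumes "0 < \<beta>" "\<beta> < 1"
  shows "\<beta> * (\<Sum>i=1..n. real i powr (\<beta> - 1)) \<le> real n powr \<beta>"
proof (induction n)
  case (Suc n)
  have "\<beta> * real (Suc n) powr (\<beta> - 1) \<le> real (Suc n) powr \<beta> - real n powr \<beta>"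
  proof (cases "n = 0")
    case False
    then have "\<exists>z>real n. z < real (Suc n) \<and>
        real (Suc n) powr \<beta> - real n powr \<beta> = (real (Suc n) - real n) * (\<beta> * z powr (\<beta> - 1))"
      by (intro MVT2) (auto intro!: has_real_derivative_powr)
    then obtain z where z: "z > real n" "z < real (Suc n)"
      "real (Suc n) powr \<beta> - real n powr \<beta> = \<beta> * z powr (\<beta> - 1)"
      by auto
    have "real (Suc n) powr (\<beta> - 1) \<le> z powr (\<beta> - 1)"
      using z assms by (intro powr_mono2') auto
    then show ?thesis
      using z(3) assms by simp
  qed (use assms in simp)
  then show ?case
    using Suc by (simp add: distrib_left)
qed simp

text \<open>With initial weights 1, the single summand 2^(\<open>\<kappa> u\<close>) is at most the
  final total weight, which is at most n times the exponential of the sum of all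
  \<open>\<delta> i\<close>. Taking logarithms bounds \<open>\<kappa> u\<close> by a multiple of
  n^\<beta>.\<close>

lemma low_crossing_order:
  fixes \<beta> c :: real
  assumes \<beta>: "0 < \<beta>" "\<beta> < 1" and c: "c \<ge> 0"
  obtains c' :: real where "c' \<ge> 0" "\<And>(U :: 'a set) \<rho>. finite U \<Longrightarrow> low_shatter c (\<beta> / 2) U \<rho> \<Longrightarrow>
    \<exists>l. set l = U \<and> (\<forall>u\<in>U. real (crossings (\<rho> u) l) \<le> c' * real (card U) powr \<beta>)"
proof -
  define C where "C = (4 / \<beta> + 2) * (c + 1)"
  define c' where "c' = 2 * ((1 + C) / (\<beta> * ln 2))"
  have C: "C \<ge> 0"
    using \<beta> c by (simp add: C_def)
  show thesis
  proof (rule that[of c'])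
    show "c' \<ge> 0"
      using C \<beta> by (simp add: c'_def)
    fix U :: "'a set" and \<rho> assume U: "finite U" and ls: "low_shatter c (\<beta> / 2) U \<rho>"
    define n where "n = card U"
    define \<delta> where "\<delta> i = C * real i powr (\<beta> - 1)" for i :: nat
    have \<delta>0: "\<delta> i \<ge> 0" for i
      using C by (simp add: \<delta>_def)
    have \<delta>': "\<delta> i = (4 / \<beta> + 2) * (c + 1) * real i powr (\<beta> - 1)" for i
      by (simp add: \<delta>_def C_def)
    have "\<exists>l \<kappa>. set l = U \<and> (\<forall>u\<in>U. crossings (\<rho> u) l \<le> 2 * \<kappa> u) \<and>
      (\<Sum>u\<in>U. (1::real) * 2 ^ \<kappa> u) \<le> (\<Sum>u\<in>U. 1) * (\<Prod>i=1..n. 1 + \<delta> i)"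
      by (rule reweighted_order[OF U \<beta> c ls \<delta>']) (auto simp: n_def)
    then obtain l \<kappa> where l: "set l = U" "\<forall>u\<in>U. crossings (\<rho> u) l \<le> 2 * \<kappa> u"
      "(\<Sum>u\<in>U. (2::real) ^ \<kappa> u) \<le> real n * (\<Prod>i=1..n. 1 + \<delta> i)"
      by (auto simp: n_def)
    have "real (crossings (\<rho> u) l) \<le> c' * real n powr \<beta>" if u: "u \<in> U" for u
    proof -
      have n1: "real n \<ge> 1"
        using u U by (auto simp: n_def Suc_le_eq card_gt_0_iff)
      have "(2::real) ^ \<kappa> u \<le> (\<Sum>u\<in>U. 2 ^ \<kappa> u)"
        using member_le_sum[OF u, of "\<lambda>u. (2::real) ^ \<kappa> u"] U by simp
      also have "\<dots> \<le> real n * (\<Prod>i=1..n. 1 + \<delta> i)"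
        by (rule l(3))
      also have "\<dots> \<le> real n * (\<Prod>i=1..n. exp (\<delta> i))"
        using \<delta>0 by (intro mult_left_mono prod_mono) (auto simp: add_nonneg_nonneg)
      also have "\<dots> = real n * exp (\<Sum>i=1..n. \<delta> i)"
        by (simp add: exp_sum)
      finally have "ln (2 ^ \<kappa> u) \<le> ln (real n * exp (\<Sum>i=1..n. \<delta> i))"
        using n1 by (subst ln_le_cancel_iff) auto
      then have "real (\<kappa> u) * ln 2 \<le> ln (real n) + (\<Sum>i=1..n. \<delta> i)"
        using n1 by (simp add: ln_realpow ln_mult)
      also have "\<dots> \<le> real n powr \<beta> / \<beta> + C * real n powr \<beta> / \<beta>"
      proof (rule add_mono)
        show "ln (real n) \<le> real n powr \<beta> / \<beta>"
          using n1 \<beta> by (intro ln_powr_bound) auto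
        have "(\<Sum>i=1..n. real i powr (\<beta> - 1)) \<le> real n powr \<beta> / \<beta>"
          using sum_powr_le[OF \<beta>, of n] \<beta> by (simp add: field_simps)
        then show "(\<Sum>i=1..n. \<delta> i) \<le> C * real n powr \<beta> / \<beta>"
          using mult_left_mono[OF _ C] by (fastforce simp: \<delta>_def sum_distrib_left)
      qed
      finally have "real (\<kappa> u) \<le> (1 + C) / (\<beta> * ln 2) * real n powr \<beta>"
        using \<beta> by (simp add: field_simps)
      moreover have "real (crossings (\<rho> u) l) \<le> 2 * real (\<kappa> u)"
        using l(2) u by (metis of_nat_le_iff of_nat_mult of_nat_numeral)
      ultimately have "real (crossings (\<rho> u) l) \<le> 2 * ((1 + C) / (\<beta> * ln 2) * real n powr \<beta>)"
        by linarith
      then show ?thesis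
        by (simp only: c'_def mult.assoc)
    qed
    then show "\<exists>l. set l = U \<and> (\<forall>u\<in>U. real (crossings (\<rho> u) l) \<le> c' * real (card U) powr \<beta>)"
      using l(1) by (auto simp: n_def)
  qed
qed

subsection \<open>Covers of interpreted graphs\<close>

lemma ball_0: "u \<in> verts G \<Longrightarrow> ball G u 0 = {u}"
proof -
  assume u: "u \<in> verts G"
  have "v = u" if v: "v \<in> ball G u 0" for v
  proof -
    obtain xs where "xs \<noteq> []" "length xs \<le> 1" "hd xs = u" "last xs = v"
      using v by (auto simp: ball_def walk_def)
    then show ?thesis
      by (cases xs) auto
  qed
  then show ?thesis
    using ball_refl[OF u] by blast
qed

lemma ball_Suc:
  assumes "wf_graph G"
  shows "v \<in> ball G u (Suc r) \<longleftrightarrow> v \<in> ball G u r \<or> (\<exists>z\<in>ball G u r. edges G z v)"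
proof
  assume "v \<in> ball G u (Suc r)"
  then obtain xs where xs: "walk G xs" "hd xs = u" "last xs = v" "length xs \<le> r + 2"
    by (auto simp: ball_def)
  show "v \<in> ball G u r \<or> (\<exists>z\<in>ball G u r. edges G z v)"
  proof (cases "length xs \<le> r + 1")
    case True
    then show ?thesis
      using xs unfolding ball_def by blast
  next
    case False
    define ys where "ys = butlast xs"
    have "length ys > 0"
      using False by (simp add: ys_def)
    then have "ys \<noteq> []"
      by (rule length_greater_0_conv[THEN iffD1])
    have "xs \<noteq> []"
      using False by auto
    then have ys: "ys \<noteq> []" "xs = ys @ [v]"
      using append_butlast_last_id[of xs] xs(3) \<open>ys \<noteq> []\<close> by (simp_all add: ys_def)
    have "walk G ys" "edges G (last ys) v"
      using xs(1) ys by (auto simp: walk_def successively_append_iff)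
    moreover have "hd ys = u" "length ys \<le> r + 1"
      using xs ys by auto
    ultimately show ?thesis
      unfolding ball_def by blast
  qed
next
  assume "v \<in> ball G u r \<or> (\<exists>z\<in>ball G u r. edges G z v)"
  then show "v \<in> ball G u (Suc r)"
  proof
    assume "\<exists>z\<in>ball G u r. edges G z v"
    then obtain z where z: "z \<in> ball G u r" "edges G z v" by blast
    then have "z \<in> verts G" "v \<in> verts G"
      using assms by (auto simp: wf_graph_def)
    then have "v \<in> ball G z 1"
      using z(2) unfolding ball_def walk_def by (intro CollectI exI[of _ "[z, v]"]) auto
    then show ?thesis
      using ball_trans[OF z(1)] by fastforce
  qed (use ball_mono[of r "Suc r" G u] in auto)
qed

text \<open>The colour \<kappa> also records membership in the image of H, so that quantification over H is
  quantification over a colour class.\<close>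
definition interpreted :: "nat \<Rightarrow> 'b graph \<Rightarrow> ('b \<Rightarrow> nat) \<Rightarrow> ('a \<Rightarrow> 'b) \<Rightarrow> 'a graph \<Rightarrow> bool" where
  "interpreted q G \<kappa> g H \<longleftrightarrow> inj_on g (verts H) \<and> g ` verts H \<subseteq> verts G \<and>
     (\<forall>x\<in>verts G. \<forall>y\<in>verts G. \<kappa> x = \<kappa> y \<longrightarrow> x \<in> g ` verts H \<longrightarrow> y \<in> g ` verts H) \<and>
     (\<forall>u\<in>verts H. \<forall>v\<in>verts H. \<forall>u'\<in>verts H. \<forall>v'\<in>verts H.
        tp (verts G) (edges G) \<kappa> q [g u, g v] = tp (verts G) (edges G) \<kappa> q [g u', g v'] \<longrightarrow>
        edges H u v \<longrightarrow> edges H u' v')"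

text \<open>A path in H is copied backwards, one rank per step: a move of the game copies its last
  inner vertex z, and \<open>tp_sub\<close> splits the resulting triple into (u, z), for the
  induction, and (z, v), for the edge.\<close>

lemma ball_tp_invariant:
  assumes int: "interpreted q G \<kappa> g H" and wf: "wf_graph G" "wf_graph H"
    and "u \<in> verts H" "v \<in> verts H" "u' \<in> verts H" "v' \<in> verts H"
    and "tp (verts G) (edges G) \<kappa> (q + r) [g u, g v] = tp (verts G) (edges G) \<kappa> (q + r) [g u', g v']"
    and "v \<in> ball H u r"
  shows "v' \<in> ball H u' r"
  using assms(4-)
proof (induction r arbitrary: v v')
  case 0
  have "tp (verts G) (edges G) \<kappa> 0 [g u, g v] = tp (verts G) (edges G) \<kappa> 0 [g u', g v']"
    using tp_mono[OF 0(5)] by simp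
  then have "g u = g v \<longleftrightarrow> g u' = g v'"
    by (subst (asm) tp_0_iff) (auto simp: less_Suc_eq)
  moreover have "inj_on g (verts H)"
    using int by (simp add: interpreted_def)
  ultimately show ?case
    using 0 by (auto simp: ball_0 inj_on_def)
next
  case (Suc r)
  have fin: "finite (verts G)"
    using wf(1) by (simp add: wf_graph_def)
  let ?t = "tp (verts G) (edges G) \<kappa>"
  show ?case
  proof (cases "v \<in> ball H u r")
    case True
    have "?t (q + r) [g u, g v] = ?t (q + r) [g u', g v']"
      using tp_mono[OF Suc.prems(5)] by simp
    then show ?thesis
      using Suc.IH[OF Suc.prems(1-4)] True ball_Suc[OF wf(2)] by blast
  next
    case False
    then obtain z where z: "z \<in> ball H u r" "edges H z v"
      using Suc.prems(6) ball_Suc[OF wf(2)] by blast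
    have zH: "z \<in> verts H"
      using z(1) ball_subset by fast
    then have "g z \<in> verts G"
      using int by (auto simp: interpreted_def)
    moreover have "?t (Suc (q + r)) [g u, g v] = ?t (Suc (q + r)) [g u', g v']"
      using Suc.prems(5) by simp
    ultimately obtain d where d: "d \<in> verts G"
      "?t (q + r) ([g u, g v] @ [g z]) = ?t (q + r) ([g u', g v'] @ [d])"
      using tp_forth[OF fin] by metis
    then have eq: "?t (q + r) [g u, g v, g z] = ?t (q + r) [g u', g v', d]"
      by simp
    have "?t 0 [g u, g v, g z] = ?t 0 [g u', g v', d]"
      using tp_mono[OF eq] by simp
    then have "\<kappa> (g z) = \<kappa> d"
      by (subst (asm) tp_0_iff) (auto simp: less_Suc_eq)
    then have "d \<in> g ` verts H"
      using int \<open>g z \<in> verts G\<close> d(1) zH unfolding interpreted_def by blast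
    then obtain z' where z': "z' \<in> verts H" "d = g z'" by blast
    have "?t (q + r) [g u, g z] = ?t (q + r) [g u', g z']"
      using tp_sub[OF fin _ eq, of "[0, 2]"] z'(2) by simp
    then have "z' \<in> ball H u' r"
      using Suc.IH[OF Suc.prems(1) zH Suc.prems(3) z'(1)] z(1) by blast
    moreover have "?t (q + r) [g z, g v] = ?t (q + r) [g z', g v']"
      using tp_sub[OF fin _ eq, of "[2, 1]"] z'(2) by simp
    then have "?t q [g z, g v] = ?t q [g z', g v']"
      by (rule tp_mono) simp
    then have "edges H z' v'"
      using int z(2) zH z'(1) Suc.prems(2,4) unfolding interpreted_def by blast
    ultimately show ?thesis
      using ball_Suc[OF wf(2)] by blast
  qed
qed

text \<open>Types of pairs (x, a) decide whether a is in the ball of x, whereas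
  \<open>low_shatter\<close> asks whether x is in the ball of a; symmetry of balls connects the two.
  As g is injective, the counts in G are counts in H.\<close>

lemma interpreted_covers:
  fixes \<epsilon> :: real and D :: "'a graph set" and C0 :: "'b graph set"
  assumes nd: "nowhere_dense C0" and wf: "\<forall>G\<in>C0. wf_graph G" and K: "finite K" and \<epsilon>: "\<epsilon> > 0"
    and D: "\<And>H. H \<in> D \<Longrightarrow> wf_graph H \<and> (\<exists>G\<in>C0. \<exists>\<kappa> g. \<kappa> ` verts G \<subseteq> K \<and> interpreted q G \<kappa> g H)"
    and s: "2 * r \<le> s"
  shows "\<exists>c::real. \<forall>H\<in>D. \<exists>X. weak_nbhd_cover H r (c * real (card (verts H)) powr \<epsilon>) s X"
proof -
  \<comment> \<open>\<open>low_crossing_order\<close> works below exponent 1; a smaller exponent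
    gives a stronger bound since H has at least one vertex whenever there is something to
    check.\<close>
  define \<beta> where "\<beta> = min \<epsilon> (1/2)"
  have \<beta>: "0 < \<beta>" "\<beta> < 1" "\<beta> \<le> \<epsilon>"
    using \<epsilon> by (auto simp: \<beta>_def)
  have \<beta>2: "\<beta> / 2 > 0"
    using \<beta> by simp
  obtain c where c: "c \<ge> 0" and types: "\<And>G \<kappa> A U. G \<in> C0 \<Longrightarrow> \<kappa> ` verts G \<subseteq> K \<Longrightarrow>
    A \<subseteq> verts G \<Longrightarrow> A \<noteq> {} \<Longrightarrow> U \<subseteq> verts G \<Longrightarrow>
    (\<And>u u'. u \<in> U \<Longrightarrow> u' \<in> U \<Longrightarrow> u \<noteq> u' \<Longrightarrow>
       \<exists>a\<in>A. tp (verts G) (edges G) \<kappa> (q + r) [u, a] \<noteq> tp (verts G) (edges G) \<kappa> (q + r) [u', a]) \<Longrightarrow>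
    real (card U) \<le> c * real (card A) powr (1 + \<beta> / 2)"
    using card_types_almost_linear[OF nd wf K \<beta>2, of "q + r"] by blast
  obtain c' where c': "c' \<ge> 0" and order: "\<And>(U :: 'a set) \<rho>. finite U \<Longrightarrow> low_shatter c (\<beta> / 2) U \<rho> \<Longrightarrow>
    \<exists>l. set l = U \<and> (\<forall>u\<in>U. real (crossings (\<rho> u) l) \<le> c' * real (card U) powr \<beta>)"
    using low_crossing_order[OF \<beta>(1,2) c] by blast
  show ?thesis
  proof (intro exI[of _ "c' + 1"] ballI)
    fix H assume H: "H \<in> D"
    obtain G \<kappa> g where wfH: "wf_graph H" and G: "G \<in> C0" "\<kappa> ` verts G \<subseteq> K" and int: "interpreted q G \<kappa> g H"
      using D[OF H] by blast
    have wfG: "wf_graph G"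
      using wf G by blast
    have finH: "finite (verts H)"
      using wfH by (simp add: wf_graph_def)
    have g: "inj_on g (verts H)" "g ` verts H \<subseteq> verts G"
      using int by (auto simp: interpreted_def)
    have "low_shatter c (\<beta> / 2) (verts H) (\<lambda>u v. v \<in> ball H u r)"
      unfolding low_shatter_def
    proof (intro allI impI)
      fix A X
      assume A: "A \<subseteq> verts H" "A \<noteq> {}" and X: "X \<subseteq> verts H"
        and sep: "\<forall>x\<in>X. \<forall>y\<in>X. x \<noteq> y \<longrightarrow> (\<exists>a\<in>A. (x \<in> ball H a r) \<noteq> (y \<in> ball H a r))"
      have "real (card (g ` X)) \<le> c * real (card (g ` A)) powr (1 + \<beta> / 2)"
      proof (rule types[OF G])
        show "g ` A \<subseteq> verts G" "g ` A \<noteq> {}" "g ` X \<subseteq> verts G"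
          using A X g(2) by auto
        fix u u' assume "u \<in> g ` X" "u' \<in> g ` X" "u \<noteq> u'"
        then obtain x y where xy: "x \<in> X" "y \<in> X" "x \<noteq> y" "u = g x" "u' = g y" by blast
        then obtain a where a: "a \<in> A" "(x \<in> ball H a r) \<noteq> (y \<in> ball H a r)"
          using sep by blast
        have V: "x \<in> verts H" "y \<in> verts H" "a \<in> verts H"
          using xy X a(1) A(1) by auto
        have "tp (verts G) (edges G) \<kappa> (q + r) [g x, g a] \<noteq> tp (verts G) (edges G) \<kappa> (q + r) [g y, g a]"
        proof
          assume eq: "tp (verts G) (edges G) \<kappa> (q + r) [g x, g a] = tp (verts G) (edges G) \<kappa> (q + r) [g y, g a]"
          then have "a \<in> ball H x r \<longleftrightarrow> a \<in> ball H y r"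
            using ball_tp_invariant[OF int wfG wfH V(1,3,2,3) eq]
              ball_tp_invariant[OF int wfG wfH V(2,3,1,3) eq[symmetric]] by blast
          then show False
            using a(2) ball_sym[OF wfH] by blast
        qed
        then show "\<exists>a\<in>g ` A. tp (verts G) (edges G) \<kappa> (q + r) [u, a] \<noteq> tp (verts G) (edges G) \<kappa> (q + r) [u', a]"
          using a(1) xy by blast
      qed
      moreover have "card (g ` X) = card X" "card (g ` A) = card A"
        using card_image[OF inj_on_subset[OF g(1)]] A(1) X by auto
      ultimately show "real (card X) \<le> c * real (card A) powr (1 + \<beta> / 2)"
        by simp
    qed
    then obtain l where l: "set l = verts H"
      "\<forall>u\<in>verts H. real (crossings (\<lambda>v. v \<in> ball H u r) l) \<le> c' * real (card (verts H)) powr \<beta>"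
      using order[OF finH] by blast
    show "\<exists>X. weak_nbhd_cover H r ((c' + 1) * real (card (verts H)) powr \<epsilon>) s X"
    proof (rule cover_from_order[OF wfH l(1) s])
      fix u assume u: "u \<in> verts H"
      have n1: "real (card (verts H)) \<ge> 1"
        using u finH by (auto simp: Suc_le_eq card_gt_0_iff)
      have "c' * real (card (verts H)) powr \<beta> \<le> c' * real (card (verts H)) powr \<epsilon>"
        using c' n1 \<beta> by (intro mult_left_mono powr_mono) auto
      moreover have "1 \<le> real (card (verts H)) powr \<epsilon>"
        using n1 \<epsilon> ge_one_powr_ge_zero[of "real (card (verts H))" \<epsilon>] by simp
      ultimately show "real (crossings (\<lambda>v. v \<in> ball H u r) l) + 1 \<le> (c' + 1) * real (card (verts H)) powr \<epsilon>"
        using l(2) u by (fastforce simp: distrib_right)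
    qed
  qed
qed

section \<open>First-order formulas and types\<close>

primrec qrank :: "fo \<Rightarrow> nat" where
  "qrank (Eq x y) = 0"
| "qrank (Adj x y) = 0"
| "qrank (Col i x) = 0"
| "qrank (XCol i x) = 0"
| "qrank (Neg \<phi>) = qrank \<phi>"
| "qrank (Conj \<phi> \<psi>) = max (qrank \<phi>) (qrank \<psi>)"
| "qrank (Ex x \<phi>) = Suc (qrank \<phi>)"

primrec col_bound :: "fo \<Rightarrow> nat" where
  "col_bound (Eq x y) = 0"
| "col_bound (Adj x y) = 0"
| "col_bound (Col i x) = Suc i"
| "col_bound (XCol i x) = Suc i"
| "col_bound (Neg \<phi>) = col_bound \<phi>"
| "col_bound (Conj \<phi> \<psi>) = max (col_bound \<phi>) (col_bound \<psi>)"
| "col_bound (Ex x \<phi>) = col_bound \<phi>"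

text \<open>Assignments are total, so the tuple has to list the values of all variables. A
  quantifier appends its witness and leaves the overwritten value in the tuple, so positions need
  not correspond to variables.\<close>

lemma sat_tp:
  assumes fin: "finite (verts G)"
    and col: "\<And>x y i. \<kappa> x = \<kappa> y \<Longrightarrow> i < N \<Longrightarrow> (x \<in> colors G i \<longleftrightarrow> y \<in> colors G i) \<and> (x \<in> P i \<longleftrightarrow> y \<in> P i)"
    and "col_bound \<phi> \<le> N" "qrank \<phi> \<le> q" "length xs = length ys"
    and "tp (verts G) (edges G) \<kappa> q xs = tp (verts G) (edges G) \<kappa> q ys"
    and "\<And>x. \<exists>j<length xs. s x = xs ! j \<and> s' x = ys ! j"
  shows "sat G P s \<phi> \<longleftrightarrow> sat G P s' \<phi>"
  using assms(3-)
proof (induction \<phi> arbitrary: q xs ys s s')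
  case (Eq x y)
  have "tp (verts G) (edges G) \<kappa> 0 xs = tp (verts G) (edges G) \<kappa> 0 ys"
    using tp_mono[OF Eq(4)] by simp
  then show ?case
    using Eq(5)[of x] Eq(5)[of y] unfolding tp_0_iff[OF Eq(3)] by fastforce
next
  case (Adj x y)
  have "tp (verts G) (edges G) \<kappa> 0 xs = tp (verts G) (edges G) \<kappa> 0 ys"
    using tp_mono[OF Adj(4)] by simp
  then show ?case
    using Adj(5)[of x] Adj(5)[of y] unfolding tp_0_iff[OF Adj(3)] by fastforce
next
  case (Col i x)
  have "tp (verts G) (edges G) \<kappa> 0 xs = tp (verts G) (edges G) \<kappa> 0 ys"
    using tp_mono[OF Col(4)] by simp
  then have "\<kappa> (s x) = \<kappa> (s' x)"
    using Col(5)[of x] unfolding tp_0_iff[OF Col(3)] by fastforce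
  then show ?case
    using col[of "s x" "s' x" i] Col(1) by simp
next
  case (XCol i x)
  have "tp (verts G) (edges G) \<kappa> 0 xs = tp (verts G) (edges G) \<kappa> 0 ys"
    using tp_mono[OF XCol(4)] by simp
  then have "\<kappa> (s x) = \<kappa> (s' x)"
    using XCol(5)[of x] unfolding tp_0_iff[OF XCol(3)] by fastforce
  then show ?case
    using col[of "s x" "s' x" i] XCol(1) by simp
next
  case (Neg \<phi>)
  then show ?case
    using Neg.IH[of q xs ys s s'] by simp
next
  case (Conj \<phi> \<psi>)
  then show ?case
    using Conj.IH(1)[of q xs ys s s'] Conj.IH(2)[of q xs ys s s'] by simp
next
  case (Ex x \<phi>)
  obtain q' where q: "q = Suc q'" "qrank \<phi> \<le> q'"
    using Ex.prems(2) by (cases q) auto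
  have *: "sat G P s' (Ex x \<phi>)"
    if len: "length xs = length ys" and eq: "tp (verts G) (edges G) \<kappa> q xs = tp (verts G) (edges G) \<kappa> q ys"
      and s: "\<And>x. \<exists>j<length xs. s x = xs ! j \<and> s' x = ys ! j" and sat: "sat G P s (Ex x \<phi>)"
    for xs ys s s'
  proof -
    obtain a where a: "a \<in> verts G" "sat G P (s(x := a)) \<phi>"
      using sat by auto
    obtain d where d: "d \<in> verts G" "tp (verts G) (edges G) \<kappa> q' (xs @ [a]) = tp (verts G) (edges G) \<kappa> q' (ys @ [d])"
      using tp_forth[OF fin eq[unfolded q(1)] a(1)] by blast
    have "\<exists>j<length (xs @ [a]). (s(x := a)) y = (xs @ [a]) ! j \<and> (s'(x := d)) y = (ys @ [d]) ! j" for y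
    proof (cases "y = x")
      case True
      then show ?thesis
        using len by (intro exI[of _ "length xs"]) (auto simp: nth_append)
    next
      case False
      obtain j where "j < length xs" "s y = xs ! j" "s' y = ys ! j"
        using s by blast
      then show ?thesis
        using False len by (intro exI[of _ j]) (auto simp: nth_append)
    qed
    then have "sat G P (s(x := a)) \<phi> \<longleftrightarrow> sat G P (s'(x := d)) \<phi>"
      by (intro Ex.IH[OF _ q(2) _ d(2)]) (use Ex.prems(1) len in auto)
    then have "sat G P (s'(x := d)) \<phi>"
      using a(2) by blast
    then show ?thesis
      using d(1) by auto
  qed
  show ?case
  proof
    show "sat G P s (Ex x \<phi>) \<Longrightarrow> sat G P s' (Ex x \<phi>)"
      using *[of xs ys s s'] Ex.prems(3-5) by blast
    have "\<exists>j<length ys. s' x = ys ! j \<and> s x = xs ! j" for x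
      using Ex.prems(3,5) by metis
    then show "sat G P s' (Ex x \<phi>) \<Longrightarrow> sat G P s (Ex x \<phi>)"
      using *[of ys xs s' s] Ex.prems(3,4) by metis
  qed
qed

section \<open>Flips as additional colours\<close>

lemma wf_flip: "wf_graph G \<Longrightarrow> wf_graph (flip G AB)"
  by (auto simp: wf_graph_def flip_def)

lemma wf_foldl_flip: "wf_graph G \<Longrightarrow> wf_graph (foldl flip G fs)"
  by (induction fs arbitrary: G) (auto intro: wf_flip)

lemma verts_foldl_flip: "verts (foldl flip G fs) = verts G"
  by (induction fs arbitrary: G) (auto simp: flip_def)

lemma edges_foldl_flip:
  assumes "u \<in> verts G" "v \<in> verts G" "u' \<in> verts G" "v' \<in> verts G" "u = v \<longleftrightarrow> u' = v'"
    and "\<And>AB. AB \<in> set fs \<Longrightarrow> (u \<in> fst AB \<longleftrightarrow> u' \<in> fst AB) \<and> (u \<in> snd AB \<longleftrightarrow> u' \<in> snd AB) \<and>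
      (v \<in> fst AB \<longleftrightarrow> v' \<in> fst AB) \<and> (v \<in> snd AB \<longleftrightarrow> v' \<in> snd AB)"
    and "edges G u v \<longleftrightarrow> edges G u' v'"
  shows "edges (foldl flip G fs) u v \<longleftrightarrow> edges (foldl flip G fs) u' v'"
  using assms
proof (induction fs arbitrary: G)
  case (Cons AB fs)
  have V: "verts (flip G AB) = verts G"
    by (simp add: flip_def)
  have "edges (flip G AB) u v \<longleftrightarrow> edges (flip G AB) u' v'"
    using Cons.prems(6)[of AB] Cons.prems(1-5,7) by (simp add: flip_def)
  then show ?case
    using Cons.IH[of "flip G AB"] Cons.prems V by simp
qed simp

text \<open>Packs finitely many unary predicates into the single colour that \<open>tp\<close> works
  with.\<close>

definition mark :: "('b \<Rightarrow> bool) list \<Rightarrow> 'b \<Rightarrow> nat" where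
  "mark Ps x = set_encode {i. i < length Ps \<and> (Ps ! i) x}"

lemma mark_eqD:
  assumes "mark Ps x = mark Ps y" "p \<in> set Ps"
  shows "p x \<longleftrightarrow> p y"
proof -
  have "{i. i < length Ps \<and> (Ps ! i) x} = {i. i < length Ps \<and> (Ps ! i) y}"
    using assms(1) unfolding mark_def by (subst (asm) set_encode_eq) auto
  moreover obtain i where "i < length Ps" "p = Ps ! i"
    using assms(2) by (metis in_set_conv_nth)
  ultimately show ?thesis
    by blast
qed

lemma mark_range: "length Ps \<le> n \<Longrightarrow> mark Ps x \<in> set_encode ` Pow {..<n}"
  unfolding mark_def by (intro imageI) auto

text \<open>Whether a flip toggles a pair depends only on the membership of its two vertices in the
  flipped sets. Marking these sets in G keeps the rank of the edge formula; only the number of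
  colours grows with l.\<close>

lemma flip_class_interpreted:
  assumes T: "\<forall>H\<in>C. \<exists>G\<in>C0. \<exists>P. graph_iso (apply_trans T G P) H"
    and wf: "\<forall>G\<in>C0. wf_graph G" and wfC: "\<forall>H\<in>C. wf_graph H" and H: "H \<in> flip_class C l"
  shows "wf_graph H \<and> (\<exists>G\<in>C0. \<exists>\<kappa> g.
    \<kappa> ` verts G \<subseteq> set_encode ` Pow {..<2 * col_bound (t_eta T) + 1 + 2 * l} \<and>
    interpreted (qrank (t_eta T)) G \<kappa> g H)"
proof -
  obtain H0 fs where H0: "H0 \<in> C" "length fs \<le> l" "H = foldl flip H0 fs"
    using H unfolding flip_class_def by blast
  obtain G P where G: "G \<in> C0" "graph_iso (apply_trans T G P) H0"
    using T H0(1) by blast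
  define A where "A = apply_trans T G P"
  obtain f where f: "bij_betw f (verts A) (verts H0)"
    "\<forall>u\<in>verts A. \<forall>v\<in>verts A. edges A u v \<longleftrightarrow> edges H0 (f u) (f v)"
    using G(2) unfolding graph_iso_def A_def by blast
  define g where "g = inv_into (verts A) f"
  have g: "bij_betw g (verts H0) (verts A)" "\<And>v. v \<in> verts H0 \<Longrightarrow> f (g v) = v"
    using bij_betw_inv_into[OF f(1)] bij_betw_inv_into_right[OF f(1)] by (auto simp: g_def)
  have gA: "g v \<in> verts A" if "v \<in> verts H0" for v
    using g(1) that by (auto simp: bij_betw_def)
  have AG: "verts A \<subseteq> verts G"
    by (auto simp: A_def apply_trans_def Let_def)
  have inj: "inj_on g (verts H0)"
    using g(1) by (simp add: bij_betw_def)
  have VH: "verts H = verts H0"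
    by (simp add: H0(3) verts_foldl_flip)
  have finG: "finite (verts G)"
    using wf G(1) by (simp add: wf_graph_def)
  define N where "N = col_bound (t_eta T)"
  \<comment> \<open>N original colours, N extra predicates, the image of the vertex set, and two
    sets per flip: at most 2 * N + 1 + 2 * l predicates.\<close>
  define Ps where "Ps = map (\<lambda>i x. x \<in> colors G i) [0..<N] @ map (\<lambda>i x. x \<in> P i) [0..<N] @
    [\<lambda>x. x \<in> g ` verts H0] @ map (\<lambda>AB x. x \<in> g ` (fst AB \<inter> verts H0)) fs @
    map (\<lambda>AB x. x \<in> g ` (snd AB \<inter> verts H0)) fs"
  define \<kappa> where "\<kappa> = mark Ps"
  have col: "(x \<in> colors G i \<longleftrightarrow> y \<in> colors G i) \<and> (x \<in> P i \<longleftrightarrow> y \<in> P i)"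
    if "\<kappa> x = \<kappa> y" "i < N" for x y i
    using mark_eqD[OF that(1)[unfolded \<kappa>_def], of "\<lambda>x. x \<in> colors G i"]
      mark_eqD[OF that(1)[unfolded \<kappa>_def], of "\<lambda>x. x \<in> P i"] that(2) by (auto simp: Ps_def)
  have dom: "x \<in> g ` verts H0 \<longleftrightarrow> y \<in> g ` verts H0" if "\<kappa> x = \<kappa> y" for x y
    using mark_eqD[OF that[unfolded \<kappa>_def], of "\<lambda>x. x \<in> g ` verts H0"] by (auto simp: Ps_def)
  have flips: "(u \<in> fst AB \<longleftrightarrow> v \<in> fst AB) \<and> (u \<in> snd AB \<longleftrightarrow> v \<in> snd AB)"
    if "\<kappa> (g u) = \<kappa> (g v)" "AB \<in> set fs" "u \<in> verts H0" "v \<in> verts H0" for u v AB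
  proof -
    have m: "g w \<in> g ` (B \<inter> verts H0) \<longleftrightarrow> w \<in> B" if "w \<in> verts H0" for w B
      using inj that by (auto simp: inj_on_def)
    have "g u \<in> g ` (fst AB \<inter> verts H0) \<longleftrightarrow> g v \<in> g ` (fst AB \<inter> verts H0)"
      using mark_eqD[OF that(1)[unfolded \<kappa>_def], of "\<lambda>x. x \<in> g ` (fst AB \<inter> verts H0)"] that(2)
      by (auto simp: Ps_def)
    moreover have "g u \<in> g ` (snd AB \<inter> verts H0) \<longleftrightarrow> g v \<in> g ` (snd AB \<inter> verts H0)"
      using mark_eqD[OF that(1)[unfolded \<kappa>_def], of "\<lambda>x. x \<in> g ` (snd AB \<inter> verts H0)"] that(2)
      by (auto simp: Ps_def)
    ultimately show ?thesis
      by (simp only: m[OF that(3)] m[OF that(4)])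
  qed
  let ?q = "qrank (t_eta T)"
  let ?t = "tp (verts G) (edges G) \<kappa>"
  have eta: "sat G P (\<lambda>i. if i = 0 then a else b) (t_eta T) \<longleftrightarrow> sat G P (\<lambda>i. if i = 0 then a' else b') (t_eta T)"
    if "?t ?q [a, b] = ?t ?q [a', b']" for a b a' b'
  proof (rule sat_tp[OF finG col])
    show "\<exists>j<length [a, b]. (if x = 0 then a else b) = [a, b] ! j \<and> (if x = 0 then a' else b') = [a', b'] ! j"
      for x :: nat
      by (cases "x = 0") auto
  qed (use that in \<open>auto simp: N_def\<close>)
  have edge: "edges H u v \<longleftrightarrow> edges H u' v'"
    if V: "u \<in> verts H0" "v \<in> verts H0" "u' \<in> verts H0" "v' \<in> verts H0"
      and eq: "?t ?q [g u, g v] = ?t ?q [g u', g v']" for u v u' v'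
  proof -
    have "?t 0 [g u, g v] = ?t 0 [g u', g v']"
      using tp_mono[OF eq] by simp
    then have t0: "g u = g v \<longleftrightarrow> g u' = g v'" "\<kappa> (g u) = \<kappa> (g u')" "\<kappa> (g v) = \<kappa> (g v')"
      by (subst (asm) tp_0_iff; auto simp: less_Suc_eq)+
    \<comment> \<open>\<open>apply_trans\<close> symmetrises the edge formula, so the reversed pair
      has to be compared as well.\<close>
    have eq': "?t ?q [g v, g u] = ?t ?q [g v', g u']"
      using tp_sub[OF finG _ eq, of "[1, 0]"] by simp
    have "edges A (g u) (g v) \<longleftrightarrow> edges A (g u') (g v')"
      using eta[OF eq] eta[OF eq'] t0(1) gA[OF V(1)] gA[OF V(2)] gA[OF V(3)] gA[OF V(4)]
      by (auto simp: A_def apply_trans_def Let_def)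
    then have "edges H0 u v \<longleftrightarrow> edges H0 u' v'"
      using f(2) gA V g(2) by metis
    moreover have "u = v \<longleftrightarrow> u' = v'"
      using t0(1) inj V by (auto simp: inj_on_def)
    ultimately show ?thesis
      unfolding H0(3) using flips t0(2,3) V by (intro edges_foldl_flip) blast+
  qed
  have "interpreted ?q G \<kappa> g H"
    unfolding interpreted_def VH using inj gA AG dom edge by blast
  moreover have "\<kappa> x \<in> set_encode ` Pow {..<2 * N + 1 + 2 * l}" for x
    unfolding \<kappa>_def using H0(2) by (intro mark_range) (simp add: Ps_def)
  then have "\<kappa> ` verts G \<subseteq> set_encode ` Pow {..<2 * N + 1 + 2 * l}"
    by blast
  moreover have "wf_graph H"
    using wfC H0(1,3) wf_foldl_flip by metis
  ultimately show ?thesis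
    using G(1) unfolding N_def by blast
qed

theorem theorem1p5:
  fixes C :: "'a graph set" and C0 :: "'b graph set"
  assumes "\<forall>G\<in>C. wf_graph G"
    and "\<forall>G\<in>C0. wf_graph G"
    and "nowhere_dense C0"
    and "is_transduction_of C C0"
  shows "(\<forall>r. \<forall>\<epsilon>>0. \<exists>c::real. \<forall>G\<in>C. \<exists>X.
            weak_nbhd_cover G r (c * real (card (verts G)) powr \<epsilon>) (34 * r) X)
         \<and> flip_closed_sparse_covers C"
proof -
  obtain T where T: "\<forall>H\<in>C. \<exists>G\<in>C0. \<exists>P. graph_iso (apply_trans T G P) H"
    using assms(4) unfolding is_transduction_of_def by blast
  \<comment> \<open>The colours depend only on the transduction and on l, so one constant serves the
    whole flip class. The spread obtained is 2 r, which is at most 34 r.\<close>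
  have covers: "\<exists>c::real. \<forall>G\<in>flip_class C l. \<exists>X.
      weak_nbhd_cover G r (c * real (card (verts G)) powr \<epsilon>) (34 * r) X" if "\<epsilon> > 0" for r l and \<epsilon> :: real
    by (rule interpreted_covers[OF assms(3,2) _ that flip_class_interpreted[OF T assms(2,1)]]) auto
  have "C \<subseteq> flip_class C 0"
    by (auto simp: flip_class_def)
  then have "\<exists>c::real. \<forall>G\<in>C. \<exists>X. weak_nbhd_cover G r (c * real (card (verts G)) powr \<epsilon>) (34 * r) X"
    if "\<epsilon> > 0" for r and \<epsilon> :: real
    using covers[OF that, of 0 r] by blast
  moreover have "flip_closed_sparse_covers C"
  proof -
    \<comment> \<open>Choice turns the constants into a function of r, \<epsilon> and l; its values
      at \<epsilon> \<le> 0 are arbitrary.\<close>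
    define h where "h r \<epsilon> l = (SOME c::real. \<forall>G\<in>flip_class C l. \<exists>X.
        weak_nbhd_cover G r (c * real (card (verts G)) powr \<epsilon>) (34 * r) X)" for r \<epsilon> l
    have "\<forall>G\<in>flip_class C l. \<exists>X. weak_nbhd_cover G r (h r \<epsilon> l * real (card (verts G)) powr \<epsilon>) (34 * r) X"
      if "\<epsilon> > 0" for r l and \<epsilon> :: real
      unfolding h_def by (rule someI_ex[OF covers[OF that]])
    then show ?thesis
      unfolding flip_closed_sparse_covers_def by (intro exI[of _ h] exI[of _ "\<lambda>r. 34 * r"]) auto
  qed
  ultimately show ?thesis
    by blast
qed

end
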